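(* Let $X$ be an abelian variety over a number field $K$. Then there exists $n_0\in\mathbb{Z}_{\ge 1}$ that depends only on $X$ with the following property. For any isogeny $\varphi\colon X\to X$ and any $\varphi$-periodic abelian subvariety $A\subset X$, we have $\varphi^{n_0}(A)=A$.
   Context: Isogenies and abelian subvarieties are defined over $K$. An abelian subvariety $A\subset X$ is $\varphi$-periodic if $\varphi^n(A)=A$ for some $n\in\mathbb{Z}_{\ge 1}$, where $\varphi^n$ is the $n$-th iterate. *)

theory Defs
  imports "HOL-Library.Poly_Mapping" "HOL-Algebra.Algebraic_Closure_Type" "HOL-Algebra.Coset"
begin

(* Varieties are treated classically: a projective variety over a field is the set of its points
   over a fixed algebraically closed field 'a, inside a projective space, and the ground field
   enters as a subset C of 'a in which the coefficients of all defining equations and of all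
   morphisms lie.  C is meant to be a perfect subfield of 'a (for a number field K: the image of
   K in its algebraic closure); over such a subfield, being the zero set of forms with coefficients
   in C is the same as being defined over C. *)

section \<open>Number fields\<close>

definition number_field :: "'k::field_char_0 itself \<Rightarrow> bool" where
  "number_field _ \<longleftrightarrow>
     (\<exists>B::'k set. finite B \<and> module.span (\<lambda>(q::rat) x. of_rat q * x) B = UNIV)"

section \<open>Projective space\<close>

(* The projective space with homogeneous coordinates indexed by 'i, i.e. of dimension
   CARD('i) - 1. *)
quotient_type (overloaded) ('i, 'a) proj =
  "'i \<Rightarrow> 'a::field" / partial: "\<lambda>x y. (\<exists>i. x i \<noteq> 0) \<and> (\<exists>c. c \<noteq> 0 \<and> y = (\<lambda>i. c * x i))"
proof (rule part_equivpI)
  let ?R = "\<lambda>x y :: 'i \<Rightarrow> 'a. (\<exists>i. x i \<noteq> 0) \<and> (\<exists>c. c \<noteq> 0 \<and> y = (\<lambda>i. c * x i))"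
  have "?R (\<lambda>_. 1) (\<lambda>_. 1)"
    by (intro conjI exI[of _ 1]) simp_all
  then show "\<exists>x. ?R x x"
    by (rule exI[of _ "\<lambda>_. 1"])
  show "symp ?R"
  proof (rule sympI, elim conjE exE)
    fix x y :: "'i \<Rightarrow> 'a" and i c
    assume "x i \<noteq> 0" "c \<noteq> 0" "y = (\<lambda>i. c * x i)"
    then show "?R y x"
      by (intro conjI exI[of _ i] exI[of _ "inverse c"]) (simp_all add: fun_eq_iff)
  qed
  show "transp ?R"
  proof (rule transpI, elim conjE exE)
    fix x y z :: "'i \<Rightarrow> 'a" and i c d
    assume "x i \<noteq> 0" "c \<noteq> 0" "d \<noteq> 0" "y = (\<lambda>i. c * x i)" "z = (\<lambda>i. d * y i)"
    then show "?R x z"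
      by (intro conjI exI[of _ i] exI[of _ "d * c"]) (simp_all add: fun_eq_iff)
  qed
qed

(* The point [x] with homogeneous coordinates x; meaningful only for x not identically zero. *)
definition point :: "('i \<Rightarrow> 'a::field) \<Rightarrow> ('i, 'a) proj" where
  "point x = abs_proj x"

definition coords :: "('i, 'a::field) proj \<Rightarrow> ('i \<Rightarrow> 'a) set" where
  "coords P = {x. (\<exists>i. x i \<noteq> 0) \<and> point x = P}"

definition rational_point :: "'a set \<Rightarrow> ('i, 'a::field) proj \<Rightarrow> bool" where
  "rational_point C P \<longleftrightarrow> (\<exists>x \<in> coords P. range x \<subseteq> C)"

section \<open>Projective varieties\<close>

(* Polynomials in the variables 'i: finitely supported functions from monomials, i.e. from
   finitely supported exponent vectors, to coefficients. *)
type_synonym ('i, 'a) mpoly = "('i \<Rightarrow>\<^sub>0 nat) \<Rightarrow>\<^sub>0 'a"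

definition eval_mpoly :: "('i::finite, 'a::field) mpoly \<Rightarrow> ('i \<Rightarrow> 'a) \<Rightarrow> 'a" where
  "eval_mpoly F x =
     (\<Sum>m \<in> Poly_Mapping.keys F. Poly_Mapping.lookup F m * (\<Prod>i\<in>UNIV. x i ^ Poly_Mapping.lookup m i))"

(* Homogeneous polynomials of degree d (including 0) with coefficients in C. *)
definition forms :: "'a set \<Rightarrow> nat \<Rightarrow> ('i::finite, 'a::field) mpoly set" where
  "forms C d =
     {F. range (Poly_Mapping.lookup F) \<subseteq> C \<and>
         (\<forall>m \<in> Poly_Mapping.keys F. (\<Sum>i\<in>UNIV. Poly_Mapping.lookup m i) = d)}"

definition vanishes_at :: "('i::finite, 'a::field) mpoly \<Rightarrow> ('i, 'a) proj \<Rightarrow> bool" where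
  "vanishes_at F P \<longleftrightarrow> (\<forall>x \<in> coords P. eval_mpoly F x = 0)"

definition closed_over :: "'a set \<Rightarrow> ('i::finite, 'a::alg_closed_field) proj set \<Rightarrow> bool" where
  "closed_over C V \<longleftrightarrow> (\<exists>S \<subseteq> (\<Union>d. forms C d). V = {P. \<forall>F \<in> S. vanishes_at F P})"

(* Irreducibility is tested with closed sets over the algebraically closed field 'a, so it is
   geometric irreducibility. *)
definition irreducible_set :: "('i::finite, 'a::alg_closed_field) proj set \<Rightarrow> bool" where
  "irreducible_set V \<longleftrightarrow> V \<noteq> {} \<and>
     (\<forall>Y Z. closed_over UNIV Y \<and> closed_over UNIV Z \<and> V \<subseteq> Y \<union> Z \<longrightarrow> V \<subseteq> Y \<or> V \<subseteq> Z)"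

definition projective_variety :: "'a set \<Rightarrow> ('i::finite, 'a::alg_closed_field) proj set \<Rightarrow> bool" where
  "projective_variety C V \<longleftrightarrow> closed_over C V \<and> irreducible_set V"

section \<open>Morphisms and products\<close>

(* Around each point, f is given by forms of the same degree with coefficients in C.  On an
   irreducible V, a local formula for f holds on all of V where its forms do not vanish
   simultaneously. *)
definition morphism_over ::
  "'a set \<Rightarrow> ('i::finite, 'a::alg_closed_field) proj set \<Rightarrow> ('j::finite, 'a) proj set \<Rightarrow>
   (('i, 'a) proj \<Rightarrow> ('j, 'a) proj) \<Rightarrow> bool" where
  "morphism_over C V W f \<longleftrightarrow> f ` V \<subseteq> W \<and>
     (\<forall>P \<in> V. \<exists>d F. (\<forall>j. F j \<in> forms C d) \<and> (\<exists>j. \<not> vanishes_at (F j) P) \<and>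
        (\<forall>Q \<in> V. \<forall>x \<in> coords Q. (\<exists>j. eval_mpoly (F j) x \<noteq> 0) \<longrightarrow>
           f Q = point (\<lambda>j. eval_mpoly (F j) x)))"

lift_definition segre :: "('i, 'a::field) proj \<Rightarrow> ('j, 'a) proj \<Rightarrow> ('i \<times> 'j, 'a) proj"
  is "\<lambda>x y (i, j). x i * y j"
proof (elim conjE exE)
  fix x x' :: "'i \<Rightarrow> 'a" and y y' :: "'j \<Rightarrow> 'a" and i j c d
  assume "x i \<noteq> 0" "y j \<noteq> 0" "c \<noteq> 0" "d \<noteq> 0"
    and "x' = (\<lambda>i. c * x i)" "y' = (\<lambda>j. d * y j)"
  then show "(\<exists>p. (case p of (i, j) \<Rightarrow> x i * y j) \<noteq> 0) \<and>
      (\<exists>c. c \<noteq> 0 \<and> (\<lambda>(i, j). x' i * y' j) = (\<lambda>p. c * (case p of (i, j) \<Rightarrow> x i * y j)))"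
    by (intro conjI exI[of _ "(i, j)"] exI[of _ "c * d"]) (simp_all add: fun_eq_iff)
qed

(* The product variety V \<times> W is identified with its image under the Segre embedding. *)
definition product_variety ::
  "('i, 'a::field) proj set \<Rightarrow> ('j, 'a) proj set \<Rightarrow> ('i \<times> 'j, 'a) proj set" where
  "product_variety V W = {segre P Q | P Q. P \<in> V \<and> Q \<in> W}"

section \<open>Abelian varieties\<close>

(* An abelian variety is a projective variety that is also an algebraic group.  Commutativity and
   smoothness are consequences and therefore not part of the definition. *)
definition abelian_variety :: "'a set \<Rightarrow> ('i::finite, 'a::alg_closed_field) proj monoid \<Rightarrow> bool" where
  "abelian_variety C \<X> \<longleftrightarrow>
     projective_variety C (carrier \<X>) \<and>
     group \<X> \<and>
     rational_point C \<one>\<^bsub>\<X>\<^esub> \<and>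
     (\<exists>\<mu>. morphism_over C (product_variety (carrier \<X>) (carrier \<X>)) (carrier \<X>) \<mu> \<and>
          (\<forall>P \<in> carrier \<X>. \<forall>Q \<in> carrier \<X>. \<mu> (segre P Q) = P \<otimes>\<^bsub>\<X>\<^esub> Q)) \<and>
     morphism_over C (carrier \<X>) (carrier \<X>) (\<lambda>P. inv\<^bsub>\<X>\<^esub> P)"

definition abelian_subvariety ::
  "'a set \<Rightarrow> ('i::finite, 'a::alg_closed_field) proj set \<Rightarrow> ('i, 'a) proj monoid \<Rightarrow> bool" where
  "abelian_subvariety C A \<X> \<longleftrightarrow>
     subgroup A \<X> \<and> abelian_variety C (\<X>\<lparr>carrier := A\<rparr>)"

definition isogeny ::
  "'a set \<Rightarrow> ('i::finite, 'a::alg_closed_field) proj monoid \<Rightarrow> ('j::finite, 'a) proj monoid \<Rightarrow>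
   (('i, 'a) proj \<Rightarrow> ('j, 'a) proj) \<Rightarrow> bool" where
  "isogeny C \<X> \<Y> \<phi> \<longleftrightarrow>
     morphism_over C (carrier \<X>) (carrier \<Y>) \<phi> \<and> \<phi> \<in> hom \<X> \<Y> \<and>
     \<phi> ` carrier \<X> = carrier \<Y> \<and> finite (kernel \<X> \<Y> \<phi>)"

definition periodic_subset :: "('p \<Rightarrow> 'p) \<Rightarrow> 'p set \<Rightarrow> bool" where
  "periodic_subset \<phi> A \<longleftrightarrow> (\<exists>n\<ge>1. (\<phi> ^^ n) ` A = A)"

end

(* A closed irreducible A through e = 1 is determined by the functions of the local ring of X at e
   that vanish on A (Krull).  An isogeny phi acts on this local ring, and it acts surjectively on
   the cotangent space: in characteristic 0 the function field of X is separably algebraic over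
   the functions pulled back by phi, so phi is unramified at a general point, hence by translation
   at e.  Modulo any power of the maximal ideal, the eigenvalues of phi are therefore products of
   eigenvalues on the cotangent space, which has a K-structure; these lie in an extension of Q of
   degree bounded in terms of X.  A root of unity that is a quotient of two such products is then
   killed by a uniform exponent n0, so that distinct eigenvalues of phi^n0 have distinct n-th
   powers for every n, and phi^n0 is, modulo any power of the maximal ideal, a polynomial in
   phi^(n0 n).  Hence phi^n0 preserves every A that is preserved by phi^n. *)

theory Submission
  imports Defs "HOL-Library.Function_Algebras" "HOL-Computational_Algebra.Fundamental_Theorem_Algebra"
begin

section \<open>Commutative algebra: Hilbert's basis theorem and Krull's intersection theorem\<close>

section \<open>Noetherian subrings\<close>

text \<open>Only an iterate of phi maps A to itself, so the ideal of A is not stable under phi. The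
  argument therefore runs in the local ring of X, where phi acts, and the point is to express phi^n0
  through phi^(n0 n). Interpolation does this on generalized eigenspaces as long as the power map is
  injective and unramified on the eigenvalues; at 0 it is ramified, and surjectivity on the
  cotangent space serves to exclude the eigenvalue 0. Modulo high powers of the maximal ideal the
  eigenvalues are products of unbounded length, yet all lie in one ring generated over K by the
  cotangent eigenvalues, whose rank over Q is bounded. The bounds come from the number n of
  homogeneous coordinates: the n coordinate functions span the cotangent space, and each is killed
  there by a polynomial over K of degree at most n, so at most n*n eigenvalues occur. Algebraicity
  over the functions pulled back by phi comes from counting independent forms instead of dimension
  theory. Functions are total, so equality near a point appears as a difference lying in every power
  of the maximal ideal.\<close>

definition is_subring :: "'u::comm_ring_1 set \<Rightarrow> bool" where
  "is_subring R \<longleftrightarrow> 1 \<in> R \<and> (\<forall>x\<in>R. \<forall>y\<in>R. x - y \<in> R \<and> x * y \<in> R)"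

text \<open>\<open>R\<close> ranges over rings and also over ideals: with an ideal for
  \<open>R\<close> and one of its powers for \<open>S\<close> this is the next power, which is how
  \<open>mpow\<close> is built.\<close>

inductive_set ispan :: "'u::comm_ring_1 set \<Rightarrow> 'u set \<Rightarrow> 'u set" for R S where
  zero: "0 \<in> ispan R S"
| step: "r \<in> R \<Longrightarrow> s \<in> S \<Longrightarrow> x \<in> ispan R S \<Longrightarrow> r * s + x \<in> ispan R S"

text \<open>For a subring this is equivalent to the ascending chain condition on ideals. The
  sequence form fits its two uses: leading coefficients in the basis theorem, and the monomials
  \<open>b T^k\<close> in Krull's theorem.\<close>

definition noeth :: "'u::comm_ring_1 set \<Rightarrow> bool" where
  "noeth R \<longleftrightarrow> (\<forall>b::nat \<Rightarrow> 'u. range b \<subseteq> R \<longrightarrow> (\<exists>N. b N \<in> ispan R (b ` {..<N})))"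

lemma subring_one: "is_subring R \<Longrightarrow> 1 \<in> R"
  and subring_diff: "is_subring R \<Longrightarrow> x \<in> R \<Longrightarrow> y \<in> R \<Longrightarrow> x - y \<in> R"
  and subring_mult: "is_subring R \<Longrightarrow> x \<in> R \<Longrightarrow> y \<in> R \<Longrightarrow> x * y \<in> R"
  by (auto simp: is_subring_def)

lemma subring_zero: "is_subring R \<Longrightarrow> 0 \<in> R"
  using subring_diff[of R 1 1] by (simp add: subring_one)

lemma subring_minus: "is_subring R \<Longrightarrow> x \<in> R \<Longrightarrow> - x \<in> R"
  using subring_diff[of R 0 x] by (simp add: subring_zero)

lemma subring_add: "is_subring R \<Longrightarrow> x \<in> R \<Longrightarrow> y \<in> R \<Longrightarrow> x + y \<in> R"
  using subring_diff[of R x "- y"] by (simp add: subring_minus)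

lemma subring_power: "is_subring R \<Longrightarrow> x \<in> R \<Longrightarrow> x ^ n \<in> R"
  by (induction n) (auto intro: subring_one subring_mult)

lemma subring_sum: "is_subring R \<Longrightarrow> (\<And>i. i \<in> I \<Longrightarrow> f i \<in> R) \<Longrightarrow> sum f I \<in> R"
  by (induction I rule: infinite_finite_induct) (auto intro: subring_zero subring_add)

lemma subring_prod: "is_subring R \<Longrightarrow> (\<And>i. i \<in> I \<Longrightarrow> f i \<in> R) \<Longrightarrow> prod f I \<in> R"
  by (induction I rule: infinite_finite_induct) (auto intro: subring_one subring_mult)

lemma ispan_add: "x \<in> ispan R S \<Longrightarrow> y \<in> ispan R S \<Longrightarrow> x + y \<in> ispan R S"
  by (induction rule: ispan.induct) (auto simp: add.assoc intro: ispan.intros)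

lemma ispan_base: "r \<in> R \<Longrightarrow> s \<in> S \<Longrightarrow> r * s \<in> ispan R S"
  using ispan.step[OF _ _ ispan.zero] by fastforce

lemma ispan_sum: "(\<And>i. i \<in> I \<Longrightarrow> f i \<in> ispan R S) \<Longrightarrow> sum f I \<in> ispan R S"
  by (induction I rule: infinite_finite_induct) (auto intro: ispan.zero ispan_add)

lemma ispan_scale:
  assumes "x \<in> ispan R S" "\<And>r. r \<in> R \<Longrightarrow> c * r \<in> R'"
  shows "c * x \<in> ispan R' S"
  using assms(1)
proof (induction rule: ispan.induct)
  case (step r s x)
  then have "(c * r) * s + c * x \<in> ispan R' S"
    using assms(2) by (intro ispan.step) auto
  then show ?case by (simp add: algebra_simps)
qed (simp add: ispan.zero)

lemma ispan_mono: "R \<subseteq> R' \<Longrightarrow> S \<subseteq> S' \<Longrightarrow> x \<in> ispan R S \<Longrightarrow> x \<in> ispan R' S'"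
  by (erule ispan.induct) (auto intro: ispan.intros)

lemma ispan_subset:
  assumes "x \<in> ispan R S" "0 \<in> M" "\<And>x y. x \<in> M \<Longrightarrow> y \<in> M \<Longrightarrow> x + y \<in> M"
    and "\<And>r s. r \<in> R \<Longrightarrow> s \<in> S \<Longrightarrow> r * s \<in> M"
  shows "x \<in> M"
  using assms(1) by (induction rule: ispan.induct) (auto intro: assms)

lemma ispan_trans:
  assumes "is_subring R" "x \<in> ispan R S" "S \<subseteq> ispan R T"
  shows "x \<in> ispan R T"
  by (rule ispan_subset[OF assms(2)])
     (use assms in \<open>auto intro: ispan.zero ispan_add ispan_scale[where R = R] subring_mult\<close>)

lemma ispan_incl: "is_subring R \<Longrightarrow> s \<in> S \<Longrightarrow> s \<in> ispan R S"
  using ispan_base[of 1 R s S] by (simp add: subring_one)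

lemma ispan_minus: "is_subring R \<Longrightarrow> x \<in> ispan R S \<Longrightarrow> - x \<in> ispan R S"
  using ispan_scale[of x R S "-1" R] by (simp add: subring_minus)

lemma ispan_diff: "is_subring R \<Longrightarrow> x \<in> ispan R S \<Longrightarrow> y \<in> ispan R S \<Longrightarrow> x - y \<in> ispan R S"
  using ispan_add[of x R S "- y"] by (simp add: ispan_minus)

lemma ispan_finite:
  assumes "x \<in> ispan R (range b)"
  shows "\<exists>N::nat. \<forall>M\<ge>N. x \<in> ispan R (b ` {..<M})"
  using assms
proof (induction rule: ispan.induct)
  case (step r s x)
  then obtain N k where "\<forall>M\<ge>N. x \<in> ispan R (b ` {..<M})" "s = b k"
    by auto
  then show ?case
    using step(1) by (intro exI[of _ "max N (Suc k)"]) (auto intro!: ispan.step)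
qed (auto intro: ispan.zero)

definition coeff_ring :: "'u::comm_ring_1 set \<Rightarrow> 'u poly set" where
  "coeff_ring R = {p. \<forall>i. coeff p i \<in> R}"

lemma coeff_ring_subring: "is_subring R \<Longrightarrow> is_subring (coeff_ring R)"
  unfolding is_subring_def[of "coeff_ring R"]
  by (auto simp: coeff_ring_def coeff_mult coeff_1 of_bool_def subring_zero subring_one
        intro!: subring_diff subring_sum subring_mult)

lemma monom_coeff_ring: "is_subring R \<Longrightarrow> r \<in> R \<Longrightarrow> monom r n \<in> coeff_ring R"
  by (auto simp: coeff_ring_def subring_zero)

lemma lead_coeff_ispan:
  assumes R: "is_subring R" and f: "\<And>j. j \<in> I \<Longrightarrow> degree (f j) \<le> d"
    and x: "x \<in> ispan R ((\<lambda>j. lead_coeff (f j)) ` I)"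
  shows "\<exists>h \<in> ispan (coeff_ring R) (f ` I). degree h \<le> d \<and> coeff h d = x"
  using x
proof (induction rule: ispan.induct)
  case zero
  show ?case by (rule bexI[of _ 0]) (auto intro: ispan.zero)
next
  case (step r s x)
  then obtain h j where h: "h \<in> ispan (coeff_ring R) (f ` I)" "degree h \<le> d" "coeff h d = x"
    and j: "j \<in> I" "s = lead_coeff (f j)" by auto
  let ?h = "monom r (d - degree (f j)) * f j + h"
  have "?h \<in> ispan (coeff_ring R) (f ` I)"
    using h j step R by (intro ispan.step monom_coeff_ring) auto
  moreover have "degree (monom r (d - degree (f j)) * f j) \<le> d"
    using degree_mult_le[of "monom r (d - degree (f j))" "f j"] degree_monom_le[of r "d - degree (f j)"] f[OF j(1)]
    by linarith
  moreover have "coeff (monom r (d - degree (f j)) * f j) d = r * s"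
    using f[OF j(1)] j by (simp add: coeff_monom_mult)
  ultimately show ?case
    using h by (intro bexI[of _ ?h]) (auto intro: degree_add_le)
qed

text \<open>Hilbert's argument by minimal degrees: if the leading coefficient of \<open>f N\<close>
  is in the ideal of the earlier ones, subtracting a combination of those \<open>f j\<close> lowers
  the degree and contradicts minimality.\<close>

lemma hilbert_basis:
  assumes R: "is_subring R" and N: "noeth R"
  shows "noeth (coeff_ring R)"
  unfolding noeth_def
proof (intro allI impI, rule ccontr)
  fix b :: "nat \<Rightarrow> 'a poly"
  let ?P = "coeff_ring R"
  note P = coeff_ring_subring[OF R]
  assume b: "range b \<subseteq> ?P" and contra: "\<not> (\<exists>N. b N \<in> ispan ?P (b ` {..<N}))"
  define I where "I = ispan ?P (range b)"
  have I_P: "I \<subseteq> ?P"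
    unfolding I_def using b P
    by (auto elim!: ispan_subset intro: subring_zero subring_add subring_mult)
  define g where "g F = (ARG_MIN degree h. h \<in> I - ispan ?P F)" for F
  define F where "F = rec_nat {} (\<lambda>_ F. insert (g F) F)"
  define f where "f k = g (F k)" for k :: nat
  have F_img: "F k = f ` {..<k}" for k
    by (induction k) (auto simp: F_def f_def lessThan_Suc)
  \<comment> \<open>Were the ideal generated by finitely many \<open>f j\<close>, these would lie in
    the span of finitely many \<open>b i\<close>, and so would the next \<open>b M\<close>, against
    the choice of \<open>b\<close>.\<close>
  have ne: "\<exists>h. h \<in> I - ispan ?P (F k)" if Fk: "F k \<subseteq> I" for k
  proof (rule ccontr)
    assume "\<not> ?thesis"
    then have sub: "I \<subseteq> ispan ?P (F k)" by auto
    have "\<exists>N. \<forall>M\<ge>N. \<forall>j\<in>{..<k}. f j \<in> ispan ?P (b ` {..<M})"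
    proof -
      have *: "\<forall>j\<in>{..<k}. \<exists>N. \<forall>M\<ge>N. f j \<in> ispan ?P (b ` {..<M})"
        using Fk ispan_finite[of _ ?P b] unfolding F_img I_def by auto
      then obtain N where "\<forall>j\<in>{..<k}. \<forall>M\<ge>N j. f j \<in> ispan ?P (b ` {..<M})"
        by metis
      then show ?thesis
        by (intro exI[of _ "Max (insert 0 (N ` {..<k}))"]) auto
    qed
    then obtain M where "\<forall>j\<in>{..<k}. f j \<in> ispan ?P (b ` {..<M})" by auto
    then have "F k \<subseteq> ispan ?P (b ` {..<M})" by (auto simp: F_img)
    moreover have "b M \<in> I" unfolding I_def by (intro ispan_incl P) auto
    ultimately have "b M \<in> ispan ?P (b ` {..<M})"
      using sub ispan_trans[OF P] by blast
    then show False using contra by auto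
  qed
  have gmin: "f k \<in> I - ispan ?P (F k) \<and> (\<forall>h \<in> I - ispan ?P (F k). degree (f k) \<le> degree h)"
    if Fk: "F k \<subseteq> I" for k
  proof -
    obtain h where "h \<in> I - ispan ?P (F k)" using ne[OF Fk] by blast
    then show ?thesis
      using arg_min_nat_lemma[of "\<lambda>h. h \<in> I - ispan ?P (F k)" h degree] by (simp add: f_def g_def)
  qed
  have FI: "F k \<subseteq> I" for k
  proof (induction k)
    case (Suc k)
    then show ?case using gmin[OF Suc] by (auto simp: F_def f_def)
  qed (simp add: F_def)
  note gmin = gmin[OF FI]
  have mono: "degree (f j) \<le> degree (f k)" if "j \<le> k" for j k
  proof -
    have "F j \<subseteq> F k" unfolding F_img using that by auto
    then have "ispan ?P (F j) \<subseteq> ispan ?P (F k)" using ispan_mono by blast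
    then show ?thesis using gmin[of j] gmin[of k] by auto
  qed
  have "range (\<lambda>k. lead_coeff (f k)) \<subseteq> R"
    using gmin I_P by (auto simp: coeff_ring_def)
  then obtain N where "lead_coeff (f N) \<in> ispan R ((\<lambda>k. lead_coeff (f k)) ` {..<N})"
    using N unfolding noeth_def by blast
  from lead_coeff_ispan[OF R _ this, of "degree (f N)"]
  obtain h where h: "h \<in> ispan ?P (F N)" "degree h \<le> degree (f N)" "coeff h (degree (f N)) = lead_coeff (f N)"
    using mono by (auto simp: F_img)
  have hI: "h \<in> I"
    using h(1) FI ispan_trans[OF P] unfolding I_def by blast
  have "f N - h \<in> I"
    using gmin[of N] hI unfolding I_def by (auto intro: ispan_diff P)
  moreover have ni: "f N - h \<notin> ispan ?P (F N)"
  proof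
    assume "f N - h \<in> ispan ?P (F N)"
    from ispan_add[OF this h(1)] show False using gmin[of N] by simp
  qed
  ultimately have le: "degree (f N) \<le> degree (f N - h)" using gmin[of N] by auto
  have "degree (f N - h) \<le> degree (f N)" using h by (intro degree_diff_le) auto
  then have "degree (f N - h) = degree (f N)" using le by auto
  then have "lead_coeff (f N - h) = 0" using h by simp
  then have "f N - h = 0" by (rule leading_coeff_0_iff[THEN iffD1])
  then show False using ni ispan.zero by metis
qed

lemma noeth_image:
  assumes N: "noeth P" and "h 0 = 0"
    and "\<And>x y. h (x + y) = h x + h y" "\<And>x y. h (x * y) = h x * h y"
  shows "noeth (h ` P)"
  unfolding noeth_def
proof (intro allI impI)
  fix b :: "nat \<Rightarrow> 'b" assume "range b \<subseteq> h ` P"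
  then have "\<forall>k. \<exists>c\<in>P. b k = h c" by auto
  then obtain c where c: "\<And>k. c k \<in> P" "\<And>k. b k = h (c k)" by metis
  then obtain N where "c N \<in> ispan P (c ` {..<N})"
    using N unfolding noeth_def by (metis image_subsetI)
  then have "h (c N) \<in> ispan (h ` P) (h ` c ` {..<N})"
    by (induction rule: ispan.induct) (auto simp: assms intro: ispan.intros)
  then show "\<exists>N. b N \<in> ispan (h ` P) (b ` {..<N})"
    unfolding c(2) image_image by metis
qed

text \<open>Either \<open>b 0\<close> is zero and lies in the span of nothing, or \<open>b 1\<close>
  is a multiple of it.\<close>

lemma noeth_field:
  fixes c :: "'a::field \<Rightarrow> 'u::comm_ring_1"
  assumes "c 0 = 0" "\<And>x y. c (x * y) = c x * c y"
  shows "noeth (range c)"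
  unfolding noeth_def
proof (intro allI impI)
  fix b :: "nat \<Rightarrow> 'u" assume "range b \<subseteq> range c"
  then have "\<forall>k. \<exists>x. b k = c x" by auto
  then obtain x where x: "\<And>k. b k = c (x k)" by metis
  show "\<exists>N. b N \<in> ispan (range c) (b ` {..<N})"
  proof (cases "x 0 = 0")
    case True
    then have "b 0 = 0" using x assms by simp
    then show ?thesis by (intro exI[of _ 0]) (simp add: ispan.zero)
  next
    case False
    then have "b 1 = c (x 1 / x 0) * b 0" by (simp add: x flip: assms)
    then show ?thesis by (intro exI[of _ 1]) (auto intro!: ispan_base)
  qed
qed

inductive_set ring_gen :: "'u::comm_ring_1 set \<Rightarrow> 'u set \<Rightarrow> 'u set" for R G where
  base: "x \<in> R \<Longrightarrow> x \<in> ring_gen R G"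
| gen: "x \<in> G \<Longrightarrow> x \<in> ring_gen R G"
| diff: "x \<in> ring_gen R G \<Longrightarrow> y \<in> ring_gen R G \<Longrightarrow> x - y \<in> ring_gen R G"
| mult: "x \<in> ring_gen R G \<Longrightarrow> y \<in> ring_gen R G \<Longrightarrow> x * y \<in> ring_gen R G"

lemma ring_gen_subring: "is_subring R \<Longrightarrow> is_subring (ring_gen R G)"
  unfolding is_subring_def[of "ring_gen R G"]
  by (auto intro: ring_gen.intros subring_one)

lemma ring_gen_least:
  assumes "is_subring Q" "R \<subseteq> Q" "G \<subseteq> Q"
  shows "ring_gen R G \<subseteq> Q"
proof
  fix x assume "x \<in> ring_gen R G"
  then show "x \<in> Q" by induction (use assms in \<open>auto intro: subring_diff subring_mult\<close>)
qed

text \<open>Generators are adjoined one at a time: the ring enlarged by \<open>y\<close> is the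
  image, under evaluation at \<open>y\<close>, of the polynomials over the smaller ring, so
  Hilbert's theorem applies.\<close>

lemma noeth_ring_gen:
  assumes "finite G" "is_subring R" "noeth R"
  shows "noeth (ring_gen R G)"
  using assms(1)
proof (induction rule: finite_induct)
  case empty
  have "ring_gen R {} \<subseteq> R"
    by (rule ring_gen_least) (use assms in auto)
  then have "ring_gen R {} = R" by (auto intro: ring_gen.base)
  then show ?case using assms by simp
next
  case (insert y G)
  let ?R = "ring_gen R G"
  have R: "is_subring ?R" by (simp add: ring_gen_subring assms)
  let ?Q = "(\<lambda>p. poly p y) ` coeff_ring ?R"
  have P: "is_subring (coeff_ring ?R)" by (simp add: coeff_ring_subring R)
  have Q: "is_subring ?Q"
    unfolding is_subring_def
    using subring_diff[OF P] subring_mult[OF P] subring_one[OF P]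
    by (auto simp flip: poly_diff poly_mult intro: rev_image_eqI)
  have "ring_gen R (insert y G) = ?Q"
  proof
    have "x \<in> ?Q" if "x \<in> ?R" for x
      using monom_coeff_ring[OF R that, of 0] by (auto intro!: rev_image_eqI simp: poly_monom)
    moreover have "y \<in> ?Q"
      using monom_coeff_ring[OF R subring_one[OF R], of 1] by (auto intro!: rev_image_eqI simp: poly_monom)
    ultimately show "ring_gen R (insert y G) \<subseteq> ?Q"
      using Q by (intro ring_gen_least) (auto intro: ring_gen.intros)
    have "is_subring (ring_gen R (insert y G))" by (simp add: ring_gen_subring assms)
    moreover have "?R \<subseteq> ring_gen R (insert y G)"
      using calculation by (intro ring_gen_least) (auto intro: ring_gen.intros)
    ultimately show "?Q \<subseteq> ring_gen R (insert y G)"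
      unfolding poly_altdef coeff_ring_def
      by (auto intro!: subring_sum[of "ring_gen R (insert y G)"] subring_mult[of "ring_gen R (insert y G)"]
            subring_power[of "ring_gen R (insert y G)"] intro: ring_gen.gen)
  qed
  moreover have "noeth ?Q"
    using hilbert_basis[OF R insert.IH] by (rule noeth_image) auto
  ultimately show ?case by simp
qed

section \<open>Powers of an ideal\<close>

primrec mpow :: "'u::comm_ring_1 set \<Rightarrow> 'u set \<Rightarrow> nat \<Rightarrow> 'u set" where
  "mpow B m 0 = B"
| "mpow B m (Suc k) = ispan m (mpow B m k)"

lemma mpow_zero: "is_subring B \<Longrightarrow> 0 \<in> mpow B m k"
  by (cases k) (auto intro: subring_zero ispan.zero)

lemma mpow_add: "is_subring B \<Longrightarrow> x \<in> mpow B m k \<Longrightarrow> y \<in> mpow B m k \<Longrightarrow> x + y \<in> mpow B m k"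
  by (cases k) (auto intro: subring_add ispan_add)

lemma mpow_scale:
  assumes "is_subring B" "\<And>b x. b \<in> B \<Longrightarrow> x \<in> m \<Longrightarrow> b * x \<in> m" "b \<in> B" "x \<in> mpow B m k"
  shows "b * x \<in> mpow B m k"
  using assms by (cases k) (auto intro: subring_mult ispan_scale)

lemma mpow_mult:
  assumes "is_subring B" "m \<subseteq> B" "\<And>b x. b \<in> B \<Longrightarrow> x \<in> m \<Longrightarrow> b * x \<in> m"
    and "x \<in> mpow B m j" "y \<in> mpow B m k"
  shows "x * y \<in> mpow B m (j + k)"
  using assms(4)
proof (induction j arbitrary: x)
  case 0
  then show ?case using assms by (auto intro: mpow_scale)
next
  case (Suc j)
  have "x \<in> {x. x * y \<in> mpow B m (Suc j + k)}"
  proof (rule ispan_subset)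
    show "x \<in> ispan m (mpow B m j)" using Suc by simp
    fix r s assume rs: "r \<in> m" "s \<in> mpow B m j"
    then have "r * (s * y) \<in> ispan m (mpow B m (j + k))"
      by (intro ispan_base Suc.IH)
    then show "r * s \<in> {x. x * y \<in> mpow B m (Suc j + k)}" by (simp add: mult.assoc)
  qed (auto simp: distrib_right intro: ispan.zero ispan_add)
  then show ?case by simp
qed

lemma mpow_1:
  assumes "is_subring B" "m \<subseteq> B" "\<And>b x. b \<in> B \<Longrightarrow> x \<in> m \<Longrightarrow> b * x \<in> m"
    and "0 \<in> m" "\<And>x y. x \<in> m \<Longrightarrow> y \<in> m \<Longrightarrow> x + y \<in> m"
  shows "mpow B m (Suc 0) = m"
proof
  have "x * b \<in> m" if "x \<in> m" "b \<in> B" for x b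
    using assms(3)[OF that(2,1)] by (simp add: mult.commute)
  then show "mpow B m (Suc 0) \<subseteq> m"
    using assms by (auto elim!: ispan_subset)
  show "m \<subseteq> mpow B m (Suc 0)"
    using ispan_base[OF _ subring_one[OF assms(1)], of _ m] by auto
qed

text \<open>By the Noetherian property of the Rees algebra \<open>B[mT] \<subseteq> U[T]\<close>: the ideal generated by the elements \<open>b T\<^sup>k\<close> is finitely generated.\<close>

lemma krull_intersection:
  fixes c :: "'a::field \<Rightarrow> 'u::comm_ring_1" and G :: "'u set"
  defines "B \<equiv> ring_gen (range c) G"
  defines "m \<equiv> ispan B G"
  assumes c: "c 1 = 1" "\<And>x y. c (x * y) = c x * c y" "\<And>x y. c (x - y) = c x - c y"
    and G: "finite G" and b: "\<And>k. b \<in> mpow B m k"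
  shows "\<exists>w\<in>m. b = w * b"
proof -
  have c0: "c 0 = 0" using c(3)[of 0 0] by simp
  have cs: "is_subring (range c)"
    unfolding is_subring_def using c by (auto intro: rev_image_eqI simp flip: c)
  have B: "is_subring B" unfolding B_def by (rule ring_gen_subring[OF cs])
  have GB: "G \<subseteq> B" unfolding B_def by (auto intro: ring_gen.gen)
  have mB: "m \<subseteq> B"
    unfolding m_def using GB B by (auto elim!: ispan_subset intro: subring_zero subring_add subring_mult)
  have m_scale: "x * y \<in> m" if "x \<in> B" "y \<in> m" for x y
    using that B unfolding m_def by (auto intro: ispan_scale subring_mult)
  \<comment> \<open>The Rees algebra: each generator of the ideal occurs in degree 0 and, multiplied
    by the variable, in degree 1. It is finitely generated over a field, hence Noetherian.\<close>
  define R where "R = ring_gen (range (\<lambda>a. [:c a:])) ((\<lambda>g. [:g:]) ` G \<union> (\<lambda>g. monom g 1) ` G)"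
  have cs': "is_subring (range (\<lambda>a. [:c a:]))"
    unfolding is_subring_def using c by (auto intro!: rev_image_eqI simp flip: c simp: one_pCons)
  have R: "is_subring R" unfolding R_def by (rule ring_gen_subring[OF cs'])
  have "noeth R"
    unfolding R_def using G cs' by (intro noeth_ring_gen noeth_field) (auto simp: c0 c)
  have B_R: "[:x:] \<in> R" if "x \<in> B" for x
    using that unfolding B_def
  proof induction
    case (diff x y)
    then show ?case using subring_diff[OF R diff.IH] by simp
  next
    case (mult x y)
    then show ?case using subring_mult[OF R mult.IH] by (simp add: mult.commute)
  qed (auto simp: R_def intro: ring_gen.intros)
  have m_R: "monom x 1 \<in> R" if "x \<in> m" for x
    using that unfolding m_def
  proof induction
    case zero
    then show ?case using subring_zero[OF R] by simp
  next
    case (step r s x)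
    have "[:r:] * monom s 1 \<in> R"
      using step by (intro subring_mult[OF R] B_R) (auto simp: R_def intro: ring_gen.gen)
    then show ?case using subring_add[OF R _ step.IH, of "[:r:] * monom s 1"]
      by (simp add: smult_monom flip: add_monom)
  qed
  have mpow_R: "monom x k \<in> R" if "x \<in> mpow B m k" for x k
    using that
  proof (induction k arbitrary: x)
    case 0
    then show ?case using B_R by (simp add: monom_0)
  next
    case (Suc k)
    then have "x \<in> ispan m (mpow B m k)" by simp
    then show ?case
    proof induction
      case zero
      then show ?case using subring_zero[OF R] by simp
    next
      case (step r s x)
      have "monom r 1 * monom s k \<in> R"
        using step Suc.IH by (intro subring_mult[OF R] m_R) auto
      then show ?case using subring_add[OF R _ step.IH, of "monom r 1 * monom s k"]
        by (simp add: mult_monom flip: add_monom)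
    qed
  qed
  \<comment> \<open>A crude upper bound for the Rees algebra. In degree \<open>j\<close> its
    coefficients even lie in the \<open>j\<close>-th power of \<open>m\<close>, but membership in
    \<open>m\<close> is what the final comparison of coefficients uses.\<close>
  define Q where "Q = {p. coeff p 0 \<in> B \<and> (\<forall>j\<ge>1. coeff p j \<in> m)}"
  have coeff_B: "coeff p j \<in> B" if "p \<in> Q" for p j
    using that mB by (cases j) (auto simp: Q_def)
  have Q: "is_subring Q"
    unfolding is_subring_def
  proof (intro conjI ballI)
    show "1 \<in> Q" using subring_one[OF B] by (auto simp: Q_def m_def intro: ispan.zero)
    fix p q assume pq: "p \<in> Q" "q \<in> Q"
    then show "p - q \<in> Q"
      using B by (auto simp: Q_def m_def intro: subring_diff ispan_diff)
    have "coeff (p * q) j \<in> m" if "j \<ge> 1" for j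
      unfolding coeff_mult m_def
    proof (rule ispan_sum, fold m_def)
      fix i assume "i \<in> {..j}"
      show "coeff p i * coeff q (j - i) \<in> m"
      proof (cases "i = 0")
        case True
        moreover have "coeff q j \<in> m" using that pq by (auto simp: Q_def)
        ultimately show ?thesis using m_scale[OF coeff_B[OF pq(1)]] by simp
      next
        case False
        then have "coeff p i \<in> m" using pq by (auto simp: Q_def)
        then have "coeff q (j - i) * coeff p i \<in> m" by (rule m_scale[OF coeff_B[OF pq(2)]])
        then show ?thesis by (simp add: mult.commute)
      qed
    qed
    moreover have "coeff (p * q) 0 \<in> B"
      using pq B by (auto simp: coeff_mult Q_def intro: subring_mult)
    ultimately show "p * q \<in> Q" by (simp add: Q_def)
  qed
  have GmB: "g \<in> m" if "g \<in> G" for g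
    unfolding m_def using that B by (intro ispan_incl)
  have "range c \<subseteq> B" unfolding B_def by (auto intro: ring_gen.base)
  then have RQ: "R \<subseteq> Q"
    unfolding R_def using GB GmB B
    by (intro ring_gen_least Q)
       (auto simp: Q_def coeff_pCons m_def split: nat.splits intro: ispan.zero subring_zero)
  \<comment> \<open>Comparing coefficients in degree \<open>N\<close> will finish: the multiplier of
    \<open>monom b k\<close> with \<open>k < N\<close> contributes its coefficient of positive
    degree \<open>N - k\<close>, which lies in \<open>m\<close>.\<close>
  obtain N where N: "monom b N \<in> ispan R ((\<lambda>k. monom b k) ` {..<N})"
    using \<open>noeth R\<close> mpow_R[OF b] unfolding noeth_def by blast
  have "\<exists>w\<in>m. coeff p N = w * b" if "p \<in> ispan R ((\<lambda>k. monom b k) ` {..<N})" for p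
    using that
  proof induction
    case zero
    show ?case by (rule bexI[of _ 0]) (auto simp: m_def intro: ispan.zero)
  next
    case (step r s p)
    then obtain w k where w: "w \<in> m" "coeff p N = w * b" and k: "k < N" "s = monom b k" by auto
    have "coeff r (N - k) \<in> m" using step(1) RQ k by (auto simp: Q_def)
    then have "coeff r (N - k) + w \<in> m" using w unfolding m_def by (intro ispan_add)
    moreover have "coeff (r * s + p) N = (coeff r (N - k) + w) * b"
    proof -
      have "coeff (r * s) N = b * coeff r (N - k)"
        using k by (subst mult.commute) (simp add: coeff_monom_mult)
      then show ?thesis using w by (simp add: algebra_simps)
    qed
    ultimately show ?case by blast
  qed
  from this[OF N] show ?thesis by simp
qed

section \<open>Linear dynamics: generalized eigenvectors and interpolation on the
  eigenvalues\<close>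

section \<open>Polynomials in a substitution operator\<close>

definition act :: "('p \<Rightarrow> 'p) \<Rightarrow> 'a::field poly \<Rightarrow> ('p \<Rightarrow> 'a) \<Rightarrow> 'p \<Rightarrow> 'a" where
  "act \<phi> p f = (\<lambda>x. \<Sum>i\<le>degree p. coeff p i * f ((\<phi> ^^ i) x))"

lemma act_0 [simp]: "act \<phi> 0 f = 0"
  by (simp add: act_def fun_eq_iff)

lemma act_pCons: "act \<phi> (pCons a p) f = (\<lambda>x. a * f x + act \<phi> p f (\<phi> x))"
proof (cases "p = 0")
  case False
  then show ?thesis
    by (simp add: act_def fun_eq_iff sum.atMost_Suc_shift funpow_swap1 del: sum.atMost_Suc)
qed (simp add: act_def)

lemma act_add: "act \<phi> (p + q) f = act \<phi> p f + act \<phi> q f"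
  by (induction p q rule: poly_induct2) (auto simp: act_pCons fun_eq_iff algebra_simps)

lemma act_smult: "act \<phi> (smult a p) f = (\<lambda>x. a * act \<phi> p f x)"
  by (induction p) (auto simp: act_pCons fun_eq_iff algebra_simps)

lemma act_mult: "act \<phi> (p * q) f = act \<phi> p (act \<phi> q f)"
  by (induction p) (auto simp: act_pCons act_add act_smult fun_eq_iff)

lemma act_fun_add: "act \<phi> p (f + g) = act \<phi> p f + act \<phi> p g"
  by (simp add: act_def fun_eq_iff sum.distrib algebra_simps)

lemma act_fun_scale: "act \<phi> p (\<lambda>x. c * f x) = (\<lambda>x. c * act \<phi> p f x)"
  by (simp add: act_def fun_eq_iff sum_distrib_left mult_ac)

lemma act_1 [simp]: "act \<phi> 1 f = f"
  by (simp add: one_pCons act_pCons)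

lemma act_monom: "act \<phi> (monom 1 j) f = (\<lambda>x. f ((\<phi> ^^ j) x))"
proof -
  have "(\<Sum>i\<le>j. coeff (monom 1 j) i * f ((\<phi> ^^ i) x)) = (\<Sum>i\<in>{j}. f ((\<phi> ^^ i) x))" for x :: 'a
    by (rule sum.mono_neutral_cong_right) auto
  then show ?thesis by (simp add: act_def degree_monom_eq)
qed

lemma act_pcompose: "act \<phi> (pcompose p (monom 1 j)) f = act (\<phi> ^^ j) p f"
  by (induction p) (auto simp: pcompose_pCons act_pCons act_add act_mult act_monom fun_eq_iff)

definition op_stable :: "('p \<Rightarrow> 'p) \<Rightarrow> ('p \<Rightarrow> 'a::field) set \<Rightarrow> bool" where
  "op_stable \<phi> J \<longleftrightarrow> 0 \<in> J \<and> (\<forall>f\<in>J. \<forall>g\<in>J. f + g \<in> J) \<and> (\<forall>c. \<forall>f\<in>J. (\<lambda>x. c * f x) \<in> J) \<and>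
     (\<forall>f\<in>J. (\<lambda>x. f (\<phi> x)) \<in> J)"

lemma op_stable_act:
  assumes "op_stable \<phi> J" "f \<in> J"
  shows "act \<phi> p f \<in> J"
proof (induction p)
  case (pCons a p)
  have "(\<lambda>x. a * f x) + (\<lambda>x. act \<phi> p f (\<phi> x)) \<in> J"
    using assms pCons by (auto simp: op_stable_def)
  then show ?case by (simp add: act_pCons plus_fun_def)
qed (use assms in \<open>auto simp: op_stable_def\<close>)

definition root_poly :: "'a::field list \<Rightarrow> 'a poly" where
  "root_poly gs = prod_list (map (\<lambda>g. [:- g, 1:]) gs)"

lemma root_poly_simps [simp]:
  "root_poly [] = 1" "root_poly (g # gs) = [:- g, 1:] * root_poly gs"
  "root_poly (gs @ hs) = root_poly gs * root_poly hs"
  by (simp_all add: root_poly_def)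

text \<open>Roots may repeat, so this describes sums of generalized eigenvectors modulo
  \<open>J\<close> with eigenvalues in \<Gamma>. Annihilating polynomials of single functions take
  the place of quotient spaces and their dimensions.\<close>

definition op_killed :: "('p \<Rightarrow> 'p) \<Rightarrow> 'a::field set \<Rightarrow> ('p \<Rightarrow> 'a) set \<Rightarrow> ('p \<Rightarrow> 'a) \<Rightarrow> bool" where
  "op_killed \<phi> \<Gamma> J f \<longleftrightarrow> (\<exists>gs. set gs \<subseteq> \<Gamma> \<and> act \<phi> (root_poly gs) f \<in> J)"

lemma op_killed_add:
  assumes "op_stable \<phi> J" "op_killed \<phi> \<Gamma> J f" "op_killed \<phi> \<Gamma> J g"
  shows "op_killed \<phi> \<Gamma> J (f + g)"
proof -
  obtain gs hs where gs: "set gs \<subseteq> \<Gamma>" "act \<phi> (root_poly gs) f \<in> J"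
    and hs: "set hs \<subseteq> \<Gamma>" "act \<phi> (root_poly hs) g \<in> J"
    using assms by (auto simp: op_killed_def)
  have "act \<phi> (root_poly hs * root_poly gs) f + act \<phi> (root_poly gs * root_poly hs) g \<in> J"
    using assms(1) op_stable_act[OF assms(1)] gs hs by (auto simp: act_mult op_stable_def)
  then show ?thesis
    unfolding op_killed_def using gs(1) hs(1)
    by (intro exI[of _ "gs @ hs"]) (simp add: act_fun_add mult.commute)
qed

lemma op_killed_scale:
  assumes "op_stable \<phi> J" "op_killed \<phi> \<Gamma> J f"
  shows "op_killed \<phi> \<Gamma> J (\<lambda>x. c * f x)"
  using assms by (auto simp: op_killed_def act_fun_scale op_stable_def)

lemma op_killed_trans:
  assumes "op_killed \<phi> \<Gamma> J f" "\<And>g. g \<in> J \<Longrightarrow> op_killed \<phi> \<Gamma> J' g"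
  shows "op_killed \<phi> \<Gamma> J' f"
proof -
  obtain gs where gs: "set gs \<subseteq> \<Gamma>" "act \<phi> (root_poly gs) f \<in> J"
    using assms by (auto simp: op_killed_def)
  obtain hs where "set hs \<subseteq> \<Gamma>" "act \<phi> (root_poly hs) (act \<phi> (root_poly gs) f) \<in> J'"
    using assms(2)[OF gs(2)] by (auto simp: op_killed_def)
  then show ?thesis
    unfolding op_killed_def using gs(1) by (intro exI[of _ "hs @ gs"]) (simp add: act_mult)
qed

lemma op_killed_base: "f \<in> J \<Longrightarrow> op_killed \<phi> \<Gamma> J f"
  unfolding op_killed_def by (intro exI[of _ "[]"]) simp

lemma op_killed_step:
  assumes "op_killed \<phi> \<Gamma> J (\<lambda>x. f (\<phi> x) - c * f x)" "c \<in> \<Gamma>"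
  shows "op_killed \<phi> \<Gamma> J f"
proof -
  obtain gs where gs: "set gs \<subseteq> \<Gamma>" "act \<phi> (root_poly gs) (\<lambda>x. f (\<phi> x) - c * f x) \<in> J"
    using assms by (auto simp: op_killed_def)
  moreover have "(\<lambda>x. f (\<phi> x) - c * f x) = act \<phi> [:- c, 1:] f"
    by (simp add: act_pCons fun_eq_iff)
  ultimately have "act \<phi> (root_poly gs * [:- c, 1:]) f \<in> J"
    unfolding act_mult by simp
  then show ?thesis
    unfolding op_killed_def using gs(1) assms(2) by (intro exI[of _ "gs @ [c]"]) simp
qed

text \<open>With \<open>f' = f \<circ> \<phi> - \<lambda>f\<close> and \<open>g' = g \<circ> \<phi> - \<mu>g\<close> one has
  \<open>(fg) \<circ> \<phi> - \<lambda>\<mu>fg = \<lambda>fg' + \<mu>f'g + f'g'\<close>.\<close>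

lemma op_killed_mult:
  assumes J: "op_stable \<phi> J" "op_stable \<phi> V" "op_stable \<phi> W"
    and XY: "\<And>f g. f \<in> J' \<Longrightarrow> g \<in> W \<Longrightarrow> f * g \<in> J" "\<And>f g. f \<in> V \<Longrightarrow> g \<in> J'' \<Longrightarrow> f * g \<in> J"
    and \<Gamma>: "\<And>a b. a \<in> \<Gamma> \<Longrightarrow> b \<in> \<Gamma> \<Longrightarrow> a * b \<in> \<Gamma>"
    and f: "f \<in> V" "op_killed \<phi> \<Gamma> J' f" and g: "g \<in> W" "op_killed \<phi> \<Gamma> J'' g"
  shows "op_killed \<phi> \<Gamma> J (f * g)"
proof -
  have "op_killed \<phi> \<Gamma> J (f * g)"
    if "f \<in> V" "set as \<subseteq> \<Gamma>" "act \<phi> (root_poly as) f \<in> J'"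
      "g \<in> W" "set bs \<subseteq> \<Gamma>" "act \<phi> (root_poly bs) g \<in> J''" for as bs f g
    using that
  \<comment> \<open>In each of the products \<open>f * g'\<close>, \<open>f' * g\<close> and
    \<open>f' * g'\<close> at least one list has lost its head, so the total length drops.\<close>
  proof (induction "length as + length bs" arbitrary: as bs f g rule: less_induct)
    case less
    show ?case
    proof (cases "as = [] \<or> bs = []")
      case True
      then show ?thesis using less.prems XY by (auto intro!: op_killed_base)
    next
      case False
      then obtain l as' m bs' where as: "as = l # as'" and bs: "bs = m # bs'"
        by (meson neq_Nil_conv)
      define f' where "f' = act \<phi> [:- l, 1:] f"
      define g' where "g' = act \<phi> [:- m, 1:] g"
      have f'V: "f' \<in> V" and g'W: "g' \<in> W"
        unfolding f'_def g'_def using less.prems J by (auto intro: op_stable_act)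
      have as': "act \<phi> (root_poly as') f' \<in> J'" and bs': "act \<phi> (root_poly bs') g' \<in> J''"
        unfolding f'_def g'_def act_mult[symmetric] using less.prems
        by (simp_all add: as bs mult.commute del: mult_pCons_left mult_pCons_right)
      have f: "f (\<phi> x) = f' x + l * f x" and g: "g (\<phi> x) = g' x + m * g x" for x
        by (simp_all add: f'_def g'_def act_pCons)
      have 1: "op_killed \<phi> \<Gamma> J (f * g')"
        using less.prems as bs bs' g'W by (intro less.hyps[of as bs']) auto
      have 2: "op_killed \<phi> \<Gamma> J (f' * g)"
        using less.prems as bs as' f'V by (intro less.hyps[of as' bs]) auto
      have 3: "op_killed \<phi> \<Gamma> J (f' * g')"
        using less.prems as bs as' bs' f'V g'W by (intro less.hyps[of as' bs']) auto
      have "op_killed \<phi> \<Gamma> J ((\<lambda>x. l * (f * g') x) + ((\<lambda>x. m * (f' * g) x) + f' * g'))"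
        by (intro op_killed_add op_killed_scale J 1 2 3)
      moreover have "(\<lambda>x. l * (f * g') x) + ((\<lambda>x. m * (f' * g) x) + f' * g')
          = (\<lambda>x. (f * g) (\<phi> x) - (l * m) * (f * g) x)"
        by (simp add: fun_eq_iff f g algebra_simps)
      moreover have "l * m \<in> \<Gamma>"
        using less.prems as bs by (intro \<Gamma>) auto
      ultimately show ?thesis
        using op_killed_step[of \<phi> \<Gamma> J "f * g" "l * m"] by simp
    qed
  qed
  then show ?thesis using f g unfolding op_killed_def by blast
qed

section \<open>Roots separated by powers\<close>

text \<open>Every \<open>g\<close> is a root of \<open>X^n - g^n\<close>, and a simple one if
  \<open>g \<noteq> 0\<close>, as the derivative \<open>n g^(n-1)\<close> does not vanish in
  characteristic 0. So \<open>u\<close> can vanish at a nonzero \<open>t\<close> only if a root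
  other than \<open>t\<close> has the same \<open>n\<close>-th power. The point 0 is excluded
  because \<open>X^n\<close> is ramified there once \<open>n > 1\<close>.\<close>

lemma root_poly_pcompose:
  fixes gs :: "'a::field_char_0 list"
  assumes "n \<ge> 1"
  shows "\<exists>u. pcompose (root_poly (map (\<lambda>g. g ^ n) gs)) (monom 1 n) = root_poly gs * u \<and>
    (\<forall>t. t \<noteq> 0 \<longrightarrow> (\<forall>g\<in>set gs. t ^ n = g ^ n \<longrightarrow> t = g) \<longrightarrow> poly u t \<noteq> 0)"
proof (induction gs)
  case Nil
  show ?case by (intro exI[of _ 1]) (simp add: pcompose_1)
next
  case (Cons g gs)
  then obtain u where u: "pcompose (root_poly (map (\<lambda>g. g ^ n) gs)) (monom 1 n) = root_poly gs * u"
    "\<And>t. t \<noteq> 0 \<Longrightarrow> (\<forall>g\<in>set gs. t ^ n = g ^ n \<longrightarrow> t = g) \<Longrightarrow> poly u t \<noteq> 0" by blast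
  let ?q = "pcompose [:- (g ^ n), 1:] (monom 1 n)"
  have q: "?q = [:- (g ^ n):] + monom 1 n" by (simp add: pcompose_pCons)
  have "poly ?q g = 0" by (simp add: q poly_monom)
  then obtain v where v: "?q = [:- g, 1:] * v" by (auto simp: poly_eq_0_iff_dvd)
  have "poly v t \<noteq> 0" if t: "t \<noteq> 0" "t ^ n = g ^ n \<longrightarrow> t = g" for t
  proof (cases "t = g")
    case True
    have "pderiv ?q = v + [:- g, 1:] * pderiv v"
      unfolding v pderiv_mult by (simp add: pderiv_pCons del: mult_pCons_left mult_pCons_right)
    then have "poly (pderiv ?q) g = poly v g" by simp
    moreover have "poly (pderiv ?q) g = of_nat n * g ^ (n - 1)"
      by (simp add: q pderiv_add pderiv_pCons pderiv_monom poly_monom)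
    ultimately show ?thesis using assms t True by auto
  next
    case False
    have "poly ?q t = t ^ n - g ^ n" by (simp add: q poly_monom)
    then show ?thesis using t False v by auto
  qed
  moreover have "pcompose (root_poly (map (\<lambda>g. g ^ n) (g # gs))) (monom 1 n) = root_poly (g # gs) * (v * u)"
    by (simp only: list.map root_poly_simps pcompose_mult v u(1) mult_ac)
  ultimately show ?case using u(2) by (intro exI[of _ "v * u"]) auto
qed

text \<open>Interpolation: on the roots \<open>\<sigma>\<close> the \<open>n\<close>-th power is injective and unramified, so \<open>\<sigma>\<close> is a
  polynomial in \<open>\<sigma>\<^sup>n\<close>, with multiplicities.\<close>

lemma X_poly_in_power:
  fixes gs :: "'a::field_char_0 list"
  assumes n: "n \<ge> 1" and gs: "0 \<notin> set gs" "\<And>s t. s \<in> set gs \<Longrightarrow> t \<in> set gs \<Longrightarrow> s ^ n = t ^ n \<Longrightarrow> s = t"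
  shows "\<exists>p r. [:0, 1:] = pcompose p (monom 1 n) + root_poly gs * r"
  using gs
proof (induction gs)
  case Nil
  show ?case by (intro exI[of _ 0] exI[of _ "[:0,1:]"]) simp
next
  case (Cons t gs)
  have "\<exists>p r. [:0, 1:] = pcompose p (monom 1 n) + root_poly gs * r"
  proof (rule Cons.IH)
    show "0 \<notin> set gs" using Cons.prems(1) by simp
    show "s = t" if "s \<in> set gs" "t \<in> set gs" "s ^ n = t ^ n" for s t
      using Cons.prems(2)[of s t] that by simp
  qed
  then obtain p r where pr: "[:0, 1:] = pcompose p (monom 1 n) + root_poly gs * r" by blast
  obtain u where u: "pcompose (root_poly (map (\<lambda>g. g ^ n) gs)) (monom 1 n) = root_poly gs * u" "poly u t \<noteq> 0"
  proof -
    have "\<forall>g\<in>set gs. t ^ n = g ^ n \<longrightarrow> t = g"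
      using Cons.prems(2)[of t] by simp
    moreover have "t \<noteq> 0" using Cons.prems(1) by auto
    ultimately show thesis using root_poly_pcompose[OF n, of gs] that by blast
  qed
  \<comment> \<open>Newton interpolation: adding \<open>c\<close> times the composed root polynomial
    changes the remainder \<open>r\<close> into \<open>r - c u\<close>, and \<open>c\<close> is
    chosen so that this vanishes at the new root \<open>t\<close>.\<close>
  define c where "c = poly r t / poly u t"
  have "poly (r - smult c u) t = 0" using u(2) by (simp add: c_def)
  then obtain r' where r': "r - smult c u = [:- t, 1:] * r'"
    unfolding poly_eq_0_iff_dvd by (rule dvdE)
  have "pcompose (p + smult c (root_poly (map (\<lambda>g. g ^ n) gs))) (monom 1 n) + root_poly (t # gs) * r'
     = pcompose p (monom 1 n) + root_poly gs * (smult c u + [:- t, 1:] * r')"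
    by (simp add: pcompose_add pcompose_smult u(1) algebra_simps del: mult_pCons_left mult_pCons_right)
  also have "\<dots> = [:0, 1:]" unfolding r'[symmetric] pr by simp
  finally show ?case by metis
qed

text \<open>Interpolation at the \<open>n0\<close>-th powers of the roots, which \<open>sep\<close>
  makes distinguishable by their \<open>n\<close>-th powers, followed by substituting
  \<open>X^n0\<close> for the variable.\<close>

lemma power_poly_in_power:
  fixes gs :: "'a::field_char_0 list"
  assumes n: "n \<ge> 1" "n0 \<ge> 1" and gs: "0 \<notin> set gs"
    and sep: "\<And>s t. s \<in> set gs \<Longrightarrow> t \<in> set gs \<Longrightarrow> s ^ (n0 * n) = t ^ (n0 * n) \<Longrightarrow> s ^ n0 = t ^ n0"
  shows "\<exists>p r. monom 1 n0 = pcompose (pcompose p (monom 1 n)) (monom 1 n0) + root_poly gs * r"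
proof -
  have "\<exists>p r. [:0, 1:] = pcompose p (monom 1 n) + root_poly (map (\<lambda>g. g ^ n0) gs) * r"
  proof (rule X_poly_in_power[OF n(1)])
    show "0 \<notin> set (map (\<lambda>g. g ^ n0) gs)" using gs by auto
    fix s t assume "s \<in> set (map (\<lambda>g. g ^ n0) gs)" "t \<in> set (map (\<lambda>g. g ^ n0) gs)" and st: "s ^ n = t ^ n"
    then obtain s' t' where "s' \<in> set gs" "t' \<in> set gs" "s = s' ^ n0" "t = t' ^ n0" by auto
    then show "s = t" using sep[of s' t'] st by (simp add: power_mult)
  qed
  then obtain p r where pr: "[:0, 1:] = pcompose p (monom 1 n) + root_poly (map (\<lambda>g. g ^ n0) gs) * r"
    by blast
  obtain u where u: "pcompose (root_poly (map (\<lambda>g. g ^ n0) gs)) (monom 1 n0) = root_poly gs * u"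
    using root_poly_pcompose[OF n(2), of gs] by blast
  have "monom 1 n0 = pcompose [:0, 1:] (monom 1 n0 :: 'a poly)" by (simp add: pcompose_pCons)
  also have "\<dots> = pcompose (pcompose p (monom 1 n)) (monom 1 n0) + root_poly gs * (u * pcompose r (monom 1 n0))"
    unfolding pr by (simp add: pcompose_add pcompose_mult u mult.assoc)
  finally show ?thesis by blast
qed

section \<open>Dynamics at a fixed point\<close>

text \<open>No equivalence classes are formed: members of \<open>Os\<close> are total functions. One
  that vanishes near \<open>e\<close> need not be 0, but it lies in every \<open>mp k\<close>, as
  \<open>germ_zero_mp\<close> shows for local rings.\<close>

locale function_germs =
  fixes Os :: "('p \<Rightarrow> 'a::field_char_0) set" and e :: 'p
  assumes subring: "is_subring Os" and const: "(\<lambda>_. c) \<in> Os"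
begin

definition maxid :: "('p \<Rightarrow> 'a) set" where
  "maxid = {f \<in> Os. f e = 0}"

abbreviation mp :: "nat \<Rightarrow> ('p \<Rightarrow> 'a) set" where
  "mp k \<equiv> mpow Os maxid k"

lemma maxid_scale: "f \<in> Os \<Longrightarrow> g \<in> maxid \<Longrightarrow> f * g \<in> maxid"
  using subring by (auto simp: maxid_def intro: subring_mult)

lemma maxid_zero: "0 \<in> maxid"
  using subring by (auto simp: maxid_def intro: subring_zero)

lemma maxid_add: "f \<in> maxid \<Longrightarrow> g \<in> maxid \<Longrightarrow> f + g \<in> maxid"
  using subring by (auto simp: maxid_def intro: subring_add)

lemma maxid_sub: "maxid \<subseteq> Os"
  by (auto simp: maxid_def)

lemma mp_add: "f \<in> mp k \<Longrightarrow> g \<in> mp k \<Longrightarrow> f + g \<in> mp k"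
  by (rule mpow_add[OF subring])

lemma mp_zero: "0 \<in> mp k"
  by (rule mpow_zero[OF subring])

lemma mp_scale: "f \<in> Os \<Longrightarrow> g \<in> mp k \<Longrightarrow> f * g \<in> mp k"
  using subring by (intro mpow_scale) (auto intro: maxid_scale)

lemma mp_cscale: "g \<in> mp k \<Longrightarrow> (\<lambda>x. c * g x) \<in> mp k"
  using mp_scale[OF const[of c], of g k] by (simp add: times_fun_def)

lemma mp_sum: "(\<And>i. i \<in> I \<Longrightarrow> f i \<in> mp k) \<Longrightarrow> (\<Sum>i\<in>I. f i) \<in> mp k"
  by (induction I rule: infinite_finite_induct) (auto intro: mp_zero mp_add)

lemma mp_mult: "f \<in> mp j \<Longrightarrow> g \<in> mp k \<Longrightarrow> f * g \<in> mp (j + k)"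
  using subring maxid_sub by (intro mpow_mult) (auto intro: maxid_scale)

lemma mp_1: "mp (Suc 0) = maxid"
  using subring maxid_sub by (intro mpow_1) (auto intro: maxid_scale maxid_zero maxid_add)

lemma mp_antimono: "mp (Suc k) \<subseteq> mp k"
proof
  fix x assume "x \<in> mp (Suc k)"
  then show "x \<in> mp k"
    unfolding mpow.simps
    by (rule ispan_subset) (use maxid_sub in \<open>auto intro: mp_zero mp_add mp_scale\<close>)
qed

end

locale germ_dynamics = function_germs Os e for Os :: "('p \<Rightarrow> 'a::field_char_0) set" and e +
  fixes \<phi> :: "'p \<Rightarrow> 'p"
  assumes fixpt: "\<phi> e = e" and comp: "f \<in> Os \<Longrightarrow> (\<lambda>x. f (\<phi> x)) \<in> Os"
begin

lemma mp_comp: "f \<in> mp k \<Longrightarrow> (\<lambda>x. f (\<phi> x)) \<in> mp k"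
proof (induction k arbitrary: f)
  case (Suc k)
  have "f \<in> {f. (\<lambda>x. f (\<phi> x)) \<in> mp (Suc k)}"
  proof (rule ispan_subset)
    show "f \<in> ispan maxid (mp k)" using Suc by simp
    fix r s assume rs: "r \<in> maxid" "s \<in> mp k"
    then have "(\<lambda>x. r (\<phi> x)) * (\<lambda>x. s (\<phi> x)) \<in> ispan maxid (mp k)"
      using Suc.IH by (intro ispan_base) (auto simp: maxid_def fixpt comp)
    then show "r * s \<in> {f. (\<lambda>x. f (\<phi> x)) \<in> mp (Suc k)}" by (simp add: times_fun_def)
  qed (use mp_zero[of "Suc k"] mp_add[of _ "Suc k"] in \<open>auto simp: plus_fun_def zero_fun_def\<close>)
  then show ?case by simp
qed (simp add: comp)

lemma mp_stable: "op_stable \<phi> (mp k)"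
  unfolding op_stable_def by (auto intro: mp_zero mp_add mp_cscale mp_comp)

text \<open>Modulo \<open>maxid\<close> only constants are left and the eigenvalue is 1, since
  \<open>e\<close> is fixed. The quotient of \<open>mp (Suc k)\<close> by the next power is spanned
  by products of \<open>maxid\<close> with \<open>mp k\<close>, so its eigenvalues are products too.
  Passing down the powers one at a time reaches every \<open>k\<close>.\<close>

lemma op_killed_mp:
  assumes \<Gamma>: "1 \<in> \<Gamma>" "\<And>a b. a \<in> \<Gamma> \<Longrightarrow> b \<in> \<Gamma> \<Longrightarrow> a * b \<in> \<Gamma>"
    and m: "\<And>f. f \<in> maxid \<Longrightarrow> op_killed \<phi> \<Gamma> (mp 2) f"
  shows "f \<in> Os \<Longrightarrow> op_killed \<phi> \<Gamma> (mp k) f"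
proof -
  have gr: "op_killed \<phi> \<Gamma> (mp (Suc k)) f" if "f \<in> mp k" for f k
    using that
  proof (induction k arbitrary: f)
    case 0
    then have "(\<lambda>x. f (\<phi> x)) - f \<in> maxid"
      using subring by (auto simp: maxid_def fixpt intro: comp subring_diff)
    then have "op_killed \<phi> \<Gamma> (mp (Suc 0)) (\<lambda>x. f (\<phi> x) - 1 * f x)"
      unfolding mp_1 by (intro op_killed_base) (simp add: fun_diff_def)
    then show ?case by (rule op_killed_step[OF _ \<Gamma>(1)])
  next
    case (Suc k)
    have "f \<in> {f. op_killed \<phi> \<Gamma> (mp (Suc (Suc k))) f}"
    proof (rule ispan_subset)
      show "f \<in> ispan maxid (mp k)" using Suc by simp
      fix r s assume rs: "r \<in> maxid" "s \<in> mp k"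
      have "op_killed \<phi> \<Gamma> (mp (Suc (Suc k))) (r * s)"
      proof (rule op_killed_mult[OF mp_stable mp_stable[of "Suc 0"] mp_stable[of k], of "mp 2" _ "mp (Suc k)"])
        show "f * g \<in> mp (Suc (Suc k))" if "f \<in> mp 2" "g \<in> mp k" for f g
          using mp_mult[OF that] by (simp add: numeral_2_eq_2 del: mpow.simps)
        show "f * g \<in> mp (Suc (Suc k))" if "f \<in> mp (Suc 0)" "g \<in> mp (Suc k)" for f g
          using mp_mult[OF that] by (simp del: mpow.simps)
      qed (use rs m Suc.IH \<Gamma> in \<open>auto simp: mp_1 simp del: mpow.simps\<close>)
      then show "r * s \<in> {f. op_killed \<phi> \<Gamma> (mp (Suc (Suc k))) f}" by simp
    qed (auto intro: op_killed_base mp_zero op_killed_add mp_stable simp del: mpow.simps)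
    then show ?case by simp
  qed
  assume f: "f \<in> Os"
  show ?thesis
  proof (induction k)
    case 0
    then show ?case using f by (intro op_killed_base) simp
  next
    case (Suc k)
    then show ?case by (rule op_killed_trans) (rule gr)
  qed
qed

text \<open>Up to a multiple of a polynomial that sends \<open>f\<close> into \<open>mp k\<close>,
  the operator of \<open>\<phi> ^^ n0\<close> is a polynomial in that of
  \<open>\<phi> ^^ (n0 * n)\<close>, and the latter preserves the functions vanishing on
  \<open>A\<close>. So only the part in \<open>mp k\<close> survives on \<open>A\<close>.\<close>

lemma periodic_vanishing:
  assumes \<Gamma>: "1 \<in> \<Gamma>" "0 \<notin> \<Gamma>" "\<And>a b. a \<in> \<Gamma> \<Longrightarrow> b \<in> \<Gamma> \<Longrightarrow> a * b \<in> \<Gamma>"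
    and m: "\<And>f. f \<in> maxid \<Longrightarrow> op_killed \<phi> \<Gamma> (mp 2) f"
    and n: "n \<ge> 1" "n0 \<ge> 1"
    and sep: "\<And>s t. s \<in> \<Gamma> \<Longrightarrow> t \<in> \<Gamma> \<Longrightarrow> s ^ (n0 * n) = t ^ (n0 * n) \<Longrightarrow> s ^ n0 = t ^ n0"
    and A: "(\<phi> ^^ (n0 * n)) ` A \<subseteq> A" and f: "f \<in> Os" "\<And>x. x \<in> A \<Longrightarrow> f x = 0"
  shows "\<exists>h \<in> mp k. \<forall>x\<in>A. f ((\<phi> ^^ n0) x) = h x"
proof -
  obtain gs where gs: "set gs \<subseteq> \<Gamma>" "act \<phi> (root_poly gs) f \<in> mp k"
    using op_killed_mp[OF \<Gamma>(1,3) m f(1)] unfolding op_killed_def by blast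
  have "0 \<notin> set gs" using gs(1) \<Gamma>(2) by auto
  moreover have "s ^ n0 = t ^ n0" if "s \<in> set gs" "t \<in> set gs" "s ^ (n0 * n) = t ^ (n0 * n)" for s t
    using sep[of s t] gs(1) that by auto
  ultimately obtain p r where pr: "monom 1 n0 = pcompose (pcompose p (monom 1 n)) (monom 1 n0) + root_poly gs * r"
    using power_poly_in_power[OF n] by blast
  let ?h = "act \<phi> r (act \<phi> (root_poly gs) f)"
  have "f ((\<phi> ^^ n0) x) = ?h x" if "x \<in> A" for x
  proof -
    have "f ((\<phi> ^^ n0) x) = act \<phi> (monom 1 n0) f x" by (simp add: act_monom)
    also have "\<dots> = act ((\<phi> ^^ n0) ^^ n) p f x + ?h x"
      by (subst pr) (simp add: act_add act_pcompose act_mult[symmetric] mult.commute)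
    also have "act ((\<phi> ^^ n0) ^^ n) p f x = 0"
    proof -
      have "op_stable ((\<phi> ^^ n0) ^^ n) {f. \<forall>x\<in>A. f x = 0}"
        using A by (auto simp: op_stable_def funpow_mult mult.commute)
      from op_stable_act[OF this] show ?thesis using f(2) that by auto
    qed
    finally show ?thesis by simp
  qed
  moreover have "?h \<in> mp k" by (rule op_stable_act[OF mp_stable gs(2)])
  ultimately show ?thesis by blast
qed

end

section \<open>Arithmetic: a uniform exponent for roots of unity of bounded degree\<close>

section \<open>Homogeneous linear systems\<close>

lemma linear_dependence:
  fixes a :: "nat \<Rightarrow> 'k \<Rightarrow> 'f::field"
  assumes "finite I" "m < card I"
  shows "\<exists>c. (\<exists>k\<in>I. c k \<noteq> 0) \<and> (\<forall>i<m. (\<Sum>k\<in>I. c k * a i k) = 0)"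
  using assms
proof (induction m arbitrary: I a)
  case 0
  then have "I \<noteq> {}" by auto
  then show ?case by (intro exI[of _ "\<lambda>_. 1"]) auto
next
  case (Suc m)
  show ?case
  proof (cases "\<forall>k\<in>I. a m k = 0")
    case True
    obtain c where "\<exists>k\<in>I. c k \<noteq> 0" "\<forall>i<m. (\<Sum>k\<in>I. c k * a i k) = 0"
      using Suc.IH[of I a] Suc.prems by auto
    then show ?thesis using True by (intro exI[of _ c]) (auto simp: less_Suc_eq)
  next
    case False
    then obtain k0 where k0: "k0 \<in> I" "a m k0 \<noteq> 0" by auto
    define I' where "I' = I - {k0}"
    have I': "finite I'" "m < card I'" "I = insert k0 I'" "k0 \<notin> I'"
      using Suc.prems k0 by (auto simp: I'_def)
    obtain c where c: "\<exists>k\<in>I'. c k \<noteq> 0"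
      "\<And>i. i < m \<Longrightarrow> (\<Sum>k\<in>I'. c k * (a i k - a i k0 * a m k / a m k0)) = 0"
      using Suc.IH[OF I'(1,2), of "\<lambda>i k. a i k - a i k0 * a m k / a m k0"] by blast
    define d where "d = c(k0 := - (\<Sum>k\<in>I'. c k * a m k) / a m k0)"
    have d: "(\<Sum>k\<in>I. d k * a i k) = (\<Sum>k\<in>I'. c k * a i k) - (\<Sum>k\<in>I'. c k * a m k) / a m k0 * a i k0" for i
    proof -
      have "(\<Sum>k\<in>I'. d k * a i k) = (\<Sum>k\<in>I'. c k * a i k)"
        using I'(4) by (intro sum.cong) (auto simp: d_def)
      then show ?thesis using I' by (simp add: d_def)
    qed
    have "(\<Sum>k\<in>I. d k * a i k) = 0" if "i < Suc m" for i
    proof (cases "i = m")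
      case True
      then show ?thesis using k0 by (simp add: d)
    next
      case False
      then have "(\<Sum>k\<in>I'. c k * a i k) = (\<Sum>k\<in>I'. c k * (a i k0 * a m k / a m k0))"
        using c(2)[of i] that by (simp add: right_diff_distrib sum_subtractf)
      also have "\<dots> = (\<Sum>k\<in>I'. c k * a m k) / a m k0 * a i k0"
        unfolding sum_distrib_right sum_divide_distrib by (intro sum.cong) (simp_all add: field_simps)
      finally show ?thesis by (simp add: d)
    qed
    moreover have "\<exists>k\<in>I. d k \<noteq> 0" using c(1) I' by (auto simp: d_def)
    ultimately show ?thesis by blast
  qed
qed

section \<open>Roots of unity of bounded degree\<close>

lemma map_poly_hom:
  fixes h :: "'b::comm_ring_1 \<Rightarrow> 'c::comm_ring_1"
  assumes h: "h 0 = 0" "\<And>x y. h (x + y) = h x + h y" "\<And>x y. h (x * y) = h x * h y"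
  shows "map_poly h (p + q) = map_poly h p + map_poly h q"
    and "map_poly h (smult c p) = smult (h c) (map_poly h p)"
    and "map_poly h (p * q) = map_poly h p * map_poly h q"
proof -
  show add: "map_poly h (p + q) = map_poly h p + map_poly h q" for p q
    by (rule poly_eqI) (simp add: coeff_map_poly h)
  show sm: "map_poly h (smult c p) = smult (h c) (map_poly h p)" for c p
    by (rule poly_eqI) (simp add: coeff_map_poly h)
  show "map_poly h (p * q) = map_poly h p * map_poly h q"
    by (induction p) (simp_all add: add sm map_poly_pCons h)
qed

abbreviation ipoly :: "int poly \<Rightarrow> 'a::comm_ring_1 poly" where
  "ipoly p \<equiv> map_poly of_int p"

lemma ipoly_add: "ipoly (p + q) = ipoly p + ipoly q"
  and ipoly_smult: "ipoly (smult c p) = smult (of_int c) (ipoly p)"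
  and ipoly_mult: "ipoly (p * q) = ipoly p * ipoly q"
  by (rule map_poly_hom; simp)+

lemma ipoly_eq_0_iff: "(ipoly p :: 'a::{ring_char_0,comm_ring_1} poly) = 0 \<longleftrightarrow> p = 0"
  by (auto simp: poly_eq_iff coeff_map_poly)

lemma ipoly_power_minus_1: "ipoly (monom 1 r - 1) = monom 1 r - 1"
  by (rule poly_eqI) (simp add: coeff_map_poly)

text \<open>Gauss: a primitive integral polynomial of least degree divides every integral
  polynomial with the same root.\<close>

lemma int_min_poly_of_root_of_unity:
  fixes z :: "'a::field_char_0" and p0 :: "int poly"
  assumes r: "r \<ge> 1" "z ^ r = 1" and p0: "p0 \<noteq> 0" "degree p0 \<le> D" "poly (ipoly p0) z = 0"
  shows "\<exists>p q. degree p \<le> D \<and> poly (ipoly p) z = 0 \<and> monom 1 r - 1 = p * q"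
proof -
  define P where "P p \<longleftrightarrow> p \<noteq> 0 \<and> poly (ipoly p) z = 0" for p
  obtain p1 where p1: "P p1" "\<And>q. P q \<Longrightarrow> degree p1 \<le> degree q"
    using ex_has_least_nat[of P p0 degree] p0 by (auto simp: P_def)
  define p where "p = primitive_part p1"
  have p1p: "smult (content p1) p = p1" by (simp add: p_def)
  have "(ipoly (smult (content p1) p) :: 'a poly) = smult (of_int (content p1)) (ipoly p)"
    by (rule ipoly_smult)
  then have "poly (ipoly p1) z = of_int (content p1) * poly (ipoly p) z"
    by (simp add: p1p)
  then have p: "p \<noteq> 0" "content p = 1" "poly (ipoly p) z = 0" "degree p = degree p1"
    using p1(1) by (auto simp: P_def p_def)
  let ?f = "monom 1 r - 1 :: int poly"
  have fr: "coeff ?f r = 1" using r by simp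
  then have f0: "?f \<noteq> 0" by fastforce
  have "content ?f dvd 1" using content_dvd_coeff[of ?f r] fr by simp
  then have cf: "content ?f = 1" using normalize_content[of ?f] by (metis is_unit_normalize)
  obtain a q where aq: "a \<noteq> 0" "smult a ?f = p * q + pseudo_mod ?f p"
    using pseudo_mod(1)[OF p(1)] by blast
  have "poly (ipoly (smult a ?f)) z = 0"
    unfolding ipoly_smult ipoly_power_minus_1 using r by (simp add: poly_monom)
  then have "poly (ipoly (pseudo_mod ?f p)) z = 0"
    unfolding aq(2) ipoly_add ipoly_mult using p(3) by simp
  then have "pseudo_mod ?f p = 0"
    using pseudo_mod(2)[OF p(1), of ?f] p1(2)[of "pseudo_mod ?f p"] p(4)
    by (force simp: P_def)
  then have "smult a ?f = p * q" using aq by simp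
  \<comment> \<open>Taking primitive parts removes \<open>a\<close> up to its sign, and the sign
    goes into the cofactor.\<close>
  then have "primitive_part (smult a ?f) = primitive_part (p * q)" by simp
  then have "smult (unit_factor a) ?f = p * primitive_part q"
    using cf p(2) by (simp only: primitive_part_smult primitive_part_mult primitive_part_prim)
  moreover have "unit_factor a * unit_factor a = 1" using aq(1) by (simp add: sgn_if)
  ultimately have "?f = p * smult (unit_factor a) (primitive_part q)"
    by (metis mult_smult_right smult_1_left smult_smult)
  then show ?thesis
    using p p1(2)[of p0] p0 by (intro exI[of _ p] exI[of _ "smult (unit_factor a) (primitive_part q)"]) (auto simp: P_def)
qed

text \<open>A linear factor with a root of modulus one at most doubles the bound.\<close>

lemma norm_coeff_prod_le:
  fixes A :: "complex multiset"
  assumes "\<forall>z\<in>#A. norm z = 1"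
  shows "norm (coeff (\<Prod>x\<in>#A. [:- x, 1:]) i) \<le> 2 ^ size A"
  using assms
proof (induction A arbitrary: i)
  case empty
  show ?case by (simp add: coeff_1)
next
  case (add z A)
  let ?p = "\<Prod>x\<in>#A. [:- x, 1:]"
  have p: "norm (coeff ?p i) \<le> 2 ^ size A" for i using add by simp
  have "norm (coeff ([:- z, 1:] * ?p) i) \<le> norm (coeff ?p i) + norm (if i = 0 then 0 else coeff ?p (i - 1))"
    using add.prems norm_triangle_ineq4[of "coeff (pCons 0 ?p) i" "z * coeff ?p i"]
    by (cases i) (simp_all add: norm_mult)
  also have "\<dots> \<le> 2 ^ size A + 2 ^ size A" using p[of i] p[of "i - 1"] by (intro add_mono) auto
  finally show ?case by simp
qed

lemma finite_bounded_int_polys: "finite {p :: int poly. degree p \<le> D \<and> (\<forall>i. \<bar>coeff p i\<bar> \<le> M)}"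
proof (rule finite_subset)
  show "{p :: int poly. degree p \<le> D \<and> (\<forall>i. \<bar>coeff p i\<bar> \<le> M)} \<subseteq> Poly ` {xs. set xs \<subseteq> {-M..M} \<and> length xs \<le> Suc D}"
  proof
    fix p :: "int poly" assume p: "p \<in> {p. degree p \<le> D \<and> (\<forall>i. \<bar>coeff p i\<bar> \<le> M)}"
    then have "set (coeffs p) \<subseteq> {-M..M}"
      by (auto simp: coeffs_def abs_le_iff minus_le_iff split: if_splits)
    moreover have "length (coeffs p) \<le> Suc D" using p by (simp add: length_coeffs_degree coeffs_def)
    ultimately show "p \<in> Poly ` {xs. set xs \<subseteq> {-M..M} \<and> length xs \<le> Suc D}"
      by (intro rev_image_eqI[of "coeffs p"]) auto
  qed
qed (intro finite_imageI finite_lists_length_le finite_atLeastAtMost_int)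

text \<open>The complex roots of \<open>p\<close> are roots of unity and its leading coefficient is
  a sign, so the bound involves the degree of \<open>p\<close> but not \<open>r\<close>. This leaves
  finitely many candidates for the polynomials of roots of unity of bounded degree.\<close>

lemma coeff_factor_le:
  fixes p q :: "int poly"
  assumes r: "r \<ge> 1" and pq: "monom 1 r - 1 = p * q"
  shows "\<bar>coeff p i\<bar> \<le> 2 ^ degree p"
proof -
  have fr: "coeff (monom 1 r - 1 :: int poly) r = 1" using r by simp
  then have f0: "(monom 1 r - 1 :: int poly) \<noteq> 0" by fastforce
  have "degree (monom 1 r - 1 :: int poly) = r"
    using r fr by (intro antisym le_degree degree_le) auto
  then have "lead_coeff p * lead_coeff q = 1"
    using fr unfolding pq by (simp add: lead_coeff_mult[symmetric])
  then have "lead_coeff p dvd 1" by (metis dvd_triv_left)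
  then have lc: "\<bar>lead_coeff p\<bar> = 1" by simp
  have p0: "p \<noteq> 0" using f0 pq by auto
  let ?p = "ipoly p :: complex poly"
  have deg: "degree ?p = degree p" by (rule degree_map_poly) (auto simp: p0)
  obtain A where A: "size A = degree p" "?p = smult (of_int (lead_coeff p)) (\<Prod>x\<in>#A. [:- x, 1:])"
    using alg_closed_imp_factorization[of ?p] p0 deg by (auto simp: ipoly_eq_0_iff coeff_map_poly)
  have "norm z = 1" if "z \<in># A" for z
  proof -
    have "[:- z, 1:] dvd (\<Prod>x\<in>#A. [:- x, 1:])" using that by (auto intro: dvd_prod_mset)
    then have "poly (\<Prod>x\<in>#A. [:- x, 1:]) z = 0" by (simp add: poly_eq_0_iff_dvd)
    then have "poly (?p * ipoly q) z = 0" using A(2) by simp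
    then have "poly (monom 1 r - 1) z = 0"
      unfolding ipoly_mult[symmetric] pq[symmetric] ipoly_power_minus_1 .
    then have "z ^ r = 1" by (simp add: poly_monom)
    then have "norm z ^ r = 1" by (metis norm_one norm_power)
    then show ?thesis using r power_eq_1_iff[of "norm z" r] by (auto simp: power_eq_iff_eq_base)
  qed
  then have "norm (coeff (\<Prod>x\<in>#A. [:- x, 1:]) i) \<le> 2 ^ degree p"
    using norm_coeff_prod_le A(1) by metis
  moreover have "norm (coeff ?p i) = norm (coeff (\<Prod>x\<in>#A. [:- x, 1:]) i)"
    unfolding A(2) using arg_cong[OF lc, of real_of_int] by (simp add: norm_mult)
  ultimately have "real_of_int \<bar>coeff p i\<bar> \<le> real_of_int (2 ^ degree p)"
    by (simp add: coeff_map_poly)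
  then show ?thesis by linarith
qed

text \<open>Only finitely many such \<open>z\<close> exist, being roots of finitely many integral
  polynomials with bounded degree and coefficients; the exponent is a product with one factor for
  each of them.\<close>

lemma roots_of_unity_bounded_degree:
  "\<exists>n0\<ge>1. \<forall>z::'a::field_char_0. (\<exists>r\<ge>1. z ^ r = 1) \<longrightarrow>
     (\<exists>p. p \<noteq> 0 \<and> degree p \<le> D \<and> poly (ipoly p) z = 0) \<longrightarrow> z ^ n0 = 1"
proof -
  define Z where "Z = {z::'a. (\<exists>r\<ge>1. z ^ r = 1) \<and> (\<exists>p. p \<noteq> 0 \<and> degree p \<le> D \<and> poly (ipoly p) z = 0)}"
  let ?S = "{p :: int poly. degree p \<le> D \<and> (\<forall>i. \<bar>coeff p i\<bar> \<le> 2 ^ D)} - {0}"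
  have "Z \<subseteq> (\<Union>p\<in>?S. {z. poly (ipoly p) z = 0})"
  proof
    fix z assume "z \<in> Z"
    then obtain r p0 where r: "r \<ge> 1" "z ^ r = 1" and p0: "p0 \<noteq> 0" "degree p0 \<le> D" "poly (ipoly p0) z = 0"
      by (auto simp: Z_def)
    obtain p q where p: "degree p \<le> D" "poly (ipoly p) z = 0" "monom 1 r - 1 = p * q"
      using int_min_poly_of_root_of_unity[OF r p0] by blast
    have "\<bar>coeff p i\<bar> \<le> 2 ^ D" for i
      using coeff_factor_le[OF r(1) p(3), of i] power_increasing[OF p(1), of "2::int"] by linarith
    moreover have "p \<noteq> 0"
    proof
      assume "p = 0"
      then have "coeff (monom 1 r - 1 :: int poly) r = 0" using p(3) by simp
      then show False using r by simp
    qed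
    ultimately show "z \<in> (\<Union>p\<in>?S. {z. poly (ipoly p) z = 0})" using p by auto
  qed
  moreover have "finite (\<Union>p\<in>?S. {z::'a. poly (ipoly p) z = 0})"
  proof (rule finite_UN_I)
    show "finite ?S" by (rule finite_Diff[OF finite_bounded_int_polys])
    show "finite {z::'a. poly (ipoly p) z = 0}" if "p \<in> ?S" for p
      using that by (intro poly_roots_finite) (simp add: ipoly_eq_0_iff)
  qed
  ultimately have "finite Z" by (rule finite_subset)
  have "\<forall>z\<in>Z. \<exists>r\<ge>1. z ^ r = 1" by (auto simp: Z_def)
  from bchoice[OF this] obtain r :: "'a \<Rightarrow> nat" where r: "\<And>z. z \<in> Z \<Longrightarrow> r z \<ge> 1 \<and> z ^ r z = 1"
    by blast
  have "z ^ (\<Prod>z\<in>Z. r z) = 1" if "z \<in> Z" for z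
  proof -
    have "r z dvd (\<Prod>z\<in>Z. r z)" using \<open>finite Z\<close> that by (rule dvd_prodI)
    then obtain k where "(\<Prod>z\<in>Z. r z) = r z * k" by (auto elim: dvdE)
    then show ?thesis using r[OF that] by (simp add: power_mult)
  qed
  moreover have "(\<Prod>z\<in>Z. r z) \<ge> 1"
    using r by (intro prod_ge_1) (metis)
  ultimately show ?thesis unfolding Z_def by (intro exI[of _ "\<Prod>z\<in>Z. r z"]) (auto simp: Z_def)
qed

section \<open>Rings of finite rank over the rationals\<close>

lemma additive_zero_sum:
  fixes h :: "'b::ab_group_add \<Rightarrow> 'c::ab_group_add"
  assumes h: "\<And>x y. h (x + y) = h x + h y"
  shows "h 0 = 0" and "h (sum f I) = (\<Sum>i\<in>I. h (f i))"
proof -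
  show h0: "h 0 = 0" using h[of 0 0] by simp
  show "h (sum f I) = (\<Sum>i\<in>I. h (f i))"
    by (induction I rule: infinite_finite_induct) (auto simp: h h0)
qed

text \<open>The family \<open>s\<close> may be dependent and may leave the ring in question:
  \<open>D\<close> serves only as an upper bound for a rank over the rationals.\<close>

definition qspan :: "nat \<Rightarrow> (nat \<Rightarrow> 'a::field_char_0) \<Rightarrow> 'a set" where
  "qspan D s = {\<Sum>i<D. of_rat (c i) * s i | c. True}"

lemma qspan_mono:
  assumes "D \<le> D'"
  shows "qspan D s \<subseteq> qspan D' s"
proof
  fix x assume "x \<in> qspan D s"
  then obtain c where "x = (\<Sum>i<D. of_rat (c i) * s i)" by (auto simp: qspan_def)
  also have "\<dots> = (\<Sum>i<D'. of_rat (if i < D then c i else 0) * s i)"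
    using assms by (intro sum.mono_neutral_cong_left) auto
  finally show "x \<in> qspan D' s" unfolding qspan_def by (intro CollectI exI conjI) auto
qed

lemma qspan_dependence:
  assumes "\<And>k. k \<le> D \<Longrightarrow> u k \<in> qspan D s"
  shows "\<exists>c :: nat \<Rightarrow> rat. (\<exists>k\<le>D. c k \<noteq> 0) \<and> (\<Sum>k\<le>D. of_rat (c k) * u k) = 0"
proof -
  have "\<exists>a. \<forall>k\<le>D. u k = (\<Sum>i<D. of_rat (a i k) * s i)"
  proof -
    have "\<forall>k. \<exists>c. k \<le> D \<longrightarrow> u k = (\<Sum>i<D. of_rat (c i) * s i)"
      using assms by (auto simp: qspan_def)
    then obtain c where "\<forall>k. k \<le> D \<longrightarrow> u k = (\<Sum>i<D. of_rat (c k i) * s i)" by metis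
    then show ?thesis by (intro exI[of _ "\<lambda>i k. c k i"]) auto
  qed
  then obtain a where a: "\<And>k. k \<le> D \<Longrightarrow> u k = (\<Sum>i<D. of_rat (a i k) * s i)" by blast
  obtain c where c: "\<exists>k\<in>{..D}. c k \<noteq> 0" "\<And>i. i < D \<Longrightarrow> (\<Sum>k\<le>D. c k * a i k) = 0"
    using linear_dependence[of "{..D}" D a] by auto
  have "(\<Sum>k\<le>D. of_rat (c k) * u k) = (\<Sum>k\<le>D. \<Sum>i<D. of_rat (c k * a i k) * s i)"
    by (intro sum.cong) (auto simp: a sum_distrib_left of_rat_mult mult.assoc)
  also have "\<dots> = (\<Sum>i<D. of_rat (\<Sum>k\<le>D. c k * a i k) * s i)"
    by (subst sum.swap) (simp add: of_rat_sum sum_distrib_right)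
  also have "\<dots> = 0" using c(2) by simp
  finally show ?thesis using c(1) by auto
qed

lemma common_denominator:
  fixes c :: "nat \<Rightarrow> rat"
  shows "\<exists>b::int. b \<noteq> 0 \<and> (\<forall>k\<le>D. \<exists>a::int. of_int b * c k = of_int a)"
proof (induction D)
  case 0
  obtain a d where "quotient_of (c 0) = (a, d)" by fastforce
  then have "d \<noteq> 0" "of_int d * c 0 = of_int a"
    using quotient_of_div[of "c 0" a d] quotient_of_denom_pos[of "c 0" a d] by auto
  then show ?case by (intro exI[of _ d]) auto
next
  case (Suc D)
  then obtain b where b: "b \<noteq> 0" "\<forall>k\<le>D. \<exists>a::int. of_int b * c k = of_int a" by blast
  obtain a d where "quotient_of (c (Suc D)) = (a, d)" by fastforce
  then have d: "d \<noteq> 0" "of_int d * c (Suc D) = of_int a"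
    using quotient_of_div[of "c (Suc D)" a d] quotient_of_denom_pos[of "c (Suc D)" a d] by auto
  have "\<exists>a::int. of_int (b * d) * c k = of_int a" if k: "k \<le> Suc D" for k
  proof (cases "k = Suc D")
    case True
    then show ?thesis using d by (intro exI[of _ "b * a"]) (simp add: mult.assoc)
  next
    case False
    then obtain a' :: int where "of_int b * c k = of_int a'" using b k by (auto simp: le_Suc_eq)
    then have "of_int (b * d) * c k = of_int (d * a')" by (simp add: mult.left_commute mult.commute)
    then show ?thesis by blast
  qed
  then show ?case using b d by (intro exI[of _ "b * d"]) auto
qed

text \<open>The \<open>D + 1\<close> elements \<open>a^k b^(D-k)\<close> of \<open>L\<close> satisfy
  a rational relation, and dividing it by \<open>b^D\<close> gives an equation for the quotient.
  Homogeneous monomials are used because the ring \<open>L\<close> may lack the inverse of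
  \<open>b\<close>.\<close>

lemma quotient_algebraic:
  fixes L :: "'a::field_char_0 set"
  assumes L: "is_subring L" "L \<subseteq> qspan D s" and ab: "a \<in> L" "b \<in> L" "b \<noteq> 0"
  shows "\<exists>p. p \<noteq> 0 \<and> degree p \<le> D \<and> poly (ipoly p) (a / b) = 0"
proof -
  have "a ^ k * b ^ (D - k) \<in> qspan D s" for k
    using L ab by (auto intro!: subsetD[OF L(2)] subring_mult subring_power)
  then obtain c :: "nat \<Rightarrow> rat" where c: "\<exists>k\<le>D. c k \<noteq> 0" "(\<Sum>k\<le>D. of_rat (c k) * (a ^ k * b ^ (D - k))) = 0"
    using qspan_dependence[of D "\<lambda>k. a ^ k * b ^ (D - k)"] by blast
  obtain d :: int where d: "d \<noteq> 0" "\<forall>k\<le>D. \<exists>a::int. of_int d * c k = of_int a"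
    using common_denominator by blast
  then obtain z :: "nat \<Rightarrow> int" where z: "\<And>k. k \<le> D \<Longrightarrow> of_int d * c k = of_int (z k)" by metis
  define p where "p = (\<Sum>k\<le>D. monom (z k) k)"
  have cp: "coeff p k = (if k \<le> D then z k else 0)" for k
    by (simp add: p_def coeff_sum)
  have "degree p \<le> D" by (rule degree_le) (simp add: cp)
  moreover have "p \<noteq> 0"
  proof
    assume "p = 0"
    then have "z k = 0" if "k \<le> D" for k using cp[of k] that by simp
    then show False using c(1) z d(1) by auto
  qed
  moreover have "poly (ipoly p) (a / b) = 0"
  proof -
    have "poly (ipoly p) (a / b) = (\<Sum>k\<le>D. of_int (z k) * (a / b) ^ k)"
      unfolding poly_altdef
    proof (rule sum.mono_neutral_cong_left)
      have "degree (ipoly p :: 'a poly) \<le> degree p" by (intro degree_le) (auto simp: coeff_map_poly coeff_eq_0)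
      then show "{..degree (ipoly p :: 'a poly)} \<subseteq> {..D}" using \<open>degree p \<le> D\<close> by auto
      show "\<forall>i\<in>{..D} - {..degree (ipoly p :: 'a poly)}. of_int (z i) * (a / b) ^ i = 0"
      proof
        fix i assume i: "i \<in> {..D} - {..degree (ipoly p :: 'a poly)}"
        then have "coeff (ipoly p :: 'a poly) i = 0" by (intro coeff_eq_0) auto
        then show "of_int (z i) * (a / b) ^ i = 0" using i by (simp add: coeff_map_poly cp)
      qed
      show "coeff (ipoly p) i * (a / b) ^ i = of_int (z i) * (a / b) ^ i"
        if "i \<in> {..degree (ipoly p :: 'a poly)}" for i
        using that \<open>degree (ipoly p :: 'a poly) \<le> degree p\<close> \<open>degree p \<le> D\<close> by (simp add: coeff_map_poly cp)
    qed simp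
    also have "\<dots> = (\<Sum>k\<le>D. of_int d / b ^ D * (of_rat (c k) * (a ^ k * b ^ (D - k))))"
    proof (rule sum.cong)
      fix k assume k: "k \<in> {..D}"
      have "of_int (z k) = (of_int d * of_rat (c k) :: 'a)"
        using z[of k] k by (metis atMost_iff of_rat_mult of_rat_of_int_eq)
      moreover have "b ^ D = b ^ (D - k) * b ^ k" using k by (simp flip: power_add)
      ultimately show "of_int (z k) * (a / b) ^ k = of_int d / b ^ D * (of_rat (c k) * (a ^ k * b ^ (D - k)))"
        using ab(3) by (simp add: power_divide field_simps)
    qed simp
    also have "\<dots> = 0" using c(2) unfolding sum_distrib_left[symmetric] by simp
    finally show ?thesis .
  qed
  ultimately show ?thesis by blast
qed

text \<open>\<open>L[z]\<close> is spanned over \<open>L\<close> by the powers of \<open>z\<close>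
  below the degree of \<open>p\<close>. The leading coefficient can be inverted inside
  \<open>L\<close> since it lies in \<open>K\<close>, which is closed under inverses.\<close>

lemma adjoin_root:
  fixes L K :: "'a::field_char_0 set"
  assumes L: "is_subring L" "L \<subseteq> qspan D s" and K: "K \<subseteq> L" "\<And>x. x \<in> K \<Longrightarrow> inverse x \<in> K"
    and p: "p \<noteq> 0" "\<And>i. coeff p i \<in> K" "degree p \<le> N" "poly p z = 0"
  shows "\<exists>L' s'. is_subring L' \<and> L \<subseteq> L' \<and> z \<in> L' \<and> L' \<subseteq> qspan (D * N) s'"
proof -
  define d where "d = degree p"
  have d: "d \<ge> 1"
  proof (rule ccontr)
    assume "\<not> d \<ge> 1"
    then obtain c where "p = [:c:]" using degree_eq_zeroE[of p] by (auto simp: d_def)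
    then show False using p by simp
  qed
  define L' where "L' = {\<Sum>j<d. l j * z ^ j | l. \<forall>j. l j \<in> L}"
  have incl: "l * z ^ j \<in> L'" if "l \<in> L" "j < d" for l j
  proof -
    have "l * z ^ j = (\<Sum>i<d. (if i = j then l else 0) * z ^ i)"
      using that(2) by (simp add: if_distrib[of "\<lambda>x. x * _"] cong: if_cong)
    then show ?thesis
      unfolding L'_def using that subring_zero[OF L(1)] by (intro CollectI exI conjI) auto
  qed
  have add: "x + y \<in> L'" if "x \<in> L'" "y \<in> L'" for x y
  proof -
    obtain l where "x = (\<Sum>j<d. l j * z ^ j)" "\<forall>j. l j \<in> L"
      using \<open>x \<in> L'\<close> by (auto simp: L'_def)
    moreover obtain m where "y = (\<Sum>j<d. m j * z ^ j)" "\<forall>j. m j \<in> L"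
      using \<open>y \<in> L'\<close> by (auto simp: L'_def)
    ultimately show ?thesis
      unfolding L'_def using L(1)
      by (intro CollectI exI[of _ "\<lambda>j. l j + m j"]) (auto simp: distrib_right sum.distrib intro: subring_add)
  qed
  have scale: "c * x \<in> L'" if "x \<in> L'" "c \<in> L" for x c
  proof -
    obtain l where "x = (\<Sum>j<d. l j * z ^ j)" "\<forall>j. l j \<in> L"
      using \<open>x \<in> L'\<close> by (auto simp: L'_def)
    then show ?thesis
      unfolding L'_def using L(1) that
      by (intro CollectI exI[of _ "\<lambda>j. c * l j"]) (auto simp: sum_distrib_left mult.assoc intro: subring_mult)
  qed
  have zero: "0 \<in> L'" using incl[of 0 0] d subring_zero[OF L(1)] by simp
  have sum: "sum f I \<in> L'" if "\<And>i. i \<in> I \<Longrightarrow> f i \<in> L'" for f and I :: "nat set"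
    using that by (induction I rule: infinite_finite_induct) (auto intro: zero add)
  have LL': "L \<subseteq> L'" using incl[of _ 0] d by auto
  have zd: "z ^ d \<in> L'"
  proof -
    have "0 = (\<Sum>j\<le>d. coeff p j * z ^ j)" using p by (simp add: poly_altdef d_def)
    also have "\<dots> = (\<Sum>j<d. coeff p j * z ^ j) + lead_coeff p * z ^ d"
      unfolding lessThan_Suc_atMost[symmetric] by (simp add: d_def)
    finally have "z ^ d = (- inverse (lead_coeff p)) * (\<Sum>j<d. coeff p j * z ^ j)"
      using p(1) by (simp add: field_simps eq_neg_iff_add_eq_0)
    moreover have "(\<Sum>j<d. coeff p j * z ^ j) \<in> L'" using p K by (intro sum incl) auto
    moreover have "- inverse (lead_coeff p) \<in> L" using p K L(1) by (intro subring_minus) auto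
    ultimately show ?thesis using scale by metis
  qed
  have zx: "z * x \<in> L'" if x: "x \<in> L'" for x
  proof -
    obtain l where l: "x = (\<Sum>j<d. l j * z ^ j)" "\<And>j. l j \<in> L"
      using x by (auto simp: L'_def)
    have "z * x = (\<Sum>j<d. l j * z ^ Suc j)" by (simp add: l(1) sum_distrib_left mult_ac)
    moreover have "l j * z ^ Suc j \<in> L'" if "j < d" for j
    proof (cases "Suc j = d")
      case True
      then show ?thesis using scale[OF zd l(2)] by (simp only:)
    next
      case False
      then show ?thesis using that l by (intro incl) auto
    qed
    ultimately show ?thesis by (auto intro: sum)
  qed
  have zpx: "z ^ j * x \<in> L'" if "x \<in> L'" for x j
    using that by (induction j) (auto simp: mult.assoc intro: zx)
  have mult: "x * y \<in> L'" if xy: "x \<in> L'" "y \<in> L'" for x y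
  proof -
    obtain l where l: "x = (\<Sum>j<d. l j * z ^ j)" "\<And>j. l j \<in> L"
      using xy by (auto simp: L'_def)
    have "x * y = (\<Sum>j<d. l j * (z ^ j * y))" by (simp add: l(1) sum_distrib_right mult.assoc)
    moreover have "l j * (z ^ j * y) \<in> L'" for j by (rule scale[OF zpx[OF xy(2)] l(2)])
    ultimately show ?thesis by (auto intro: sum)
  qed
  have one: "1 \<in> L'" using LL' L(1) subring_one by blast
  have "is_subring L'"
    unfolding is_subring_def
  proof (intro conjI ballI one mult)
    fix x y assume "x \<in> L'" "y \<in> L'"
    then show "x - y \<in> L'"
      using add[of x "- 1 * y"] scale[of y "- 1"] L(1) by (simp add: subring_minus subring_one)
  qed
  moreover have "z \<in> L'" using zx[OF one] by simp
  \<comment> \<open>The products \<open>s i * z ^ j\<close> are listed in one sequence through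
    \<open>k = j * D + i\<close>.\<close>
  moreover have "L' \<subseteq> qspan (d * D) (\<lambda>k. s (k mod D) * z ^ (k div D))"
  proof
    fix x assume "x \<in> L'"
    then obtain l where l: "x = (\<Sum>j<d. l j * z ^ j)" "\<forall>j. l j \<in> L" by (auto simp: L'_def)
    then have "\<forall>j. \<exists>c. l j = (\<Sum>i<D. of_rat (c i) * s i)" using L(2) by (auto simp: qspan_def)
    then obtain c where c: "\<And>j. l j = (\<Sum>i<D. of_rat (c j i) * s i)" by metis
    let ?f = "\<lambda>k. of_rat (c (k div D) (k mod D)) * (s (k mod D) * z ^ (k div D))"
    have "x = (\<Sum>j<d. \<Sum>i<D. of_rat (c j i) * (s i * z ^ j))"
      by (simp add: l(1) c sum_distrib_right mult.assoc)
    also have "\<dots> = (\<Sum>j<d. sum ?f {j * D..<j * D + D})"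
    proof (rule sum.cong)
      fix j
      have "sum ?f {j * D..<j * D + D} = (\<Sum>i=0..<D. ?f (i + j * D))"
        using sum.shift_bounds_nat_ivl[of ?f 0 "j * D" D] by (simp add: add.commute)
      also have "\<dots> = (\<Sum>i<D. of_rat (c j i) * (s i * z ^ j))"
        by (auto simp: atLeast0LessThan intro!: sum.cong)
      finally show "(\<Sum>i<D. of_rat (c j i) * (s i * z ^ j)) = sum ?f {j * D..<j * D + D}" by simp
    qed simp
    also have "\<dots> = sum ?f {..<d * D}" by (rule sum.nat_group)
    finally show "x \<in> qspan (d * D) (\<lambda>k. s (k mod D) * z ^ (k div D))"
      unfolding qspan_def by (intro CollectI exI[of _ "\<lambda>k. c (k div D) (k mod D)"]) auto
  qed
  moreover have "d * D \<le> D * N" using p(3) by (simp add: d_def mult.commute)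
  ultimately show ?thesis
    using LL' qspan_mono by (meson order_trans)
qed

lemma adjoin_roots:
  fixes K :: "'a::field_char_0 set"
  assumes K: "is_subring K" "K \<subseteq> qspan D s" "\<And>x. x \<in> K \<Longrightarrow> inverse x \<in> K"
    and \<Lambda>: "finite \<Lambda>" "\<And>z. z \<in> \<Lambda> \<Longrightarrow> \<exists>p. p \<noteq> 0 \<and> (\<forall>i. coeff p i \<in> K) \<and> degree p \<le> N \<and> poly p z = 0"
  shows "\<exists>L s. is_subring L \<and> K \<subseteq> L \<and> \<Lambda> \<subseteq> L \<and> L \<subseteq> qspan (D * N ^ card \<Lambda>) s"
  using \<Lambda>
proof (induction rule: finite_induct)
  case empty
  then show ?case using K by auto
next
  case (insert z \<Lambda>)
  then obtain L s where L: "is_subring L" "K \<subseteq> L" "\<Lambda> \<subseteq> L" "L \<subseteq> qspan (D * N ^ card \<Lambda>) s" by auto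
  obtain p where "p \<noteq> 0" "\<And>i. coeff p i \<in> K" "degree p \<le> N" "poly p z = 0"
    using insert.prems by blast
  then obtain L' s' where "is_subring L'" "L \<subseteq> L'" "z \<in> L'" "L' \<subseteq> qspan (D * N ^ card \<Lambda> * N) s'"
    using adjoin_root[OF L(1,4,2) K(3)] by blast
  then show ?case using L insert.hyps by (intro exI[of _ L'] exI[of _ s']) (auto simp: mult_ac)
qed

lemma number_field_image_qspan:
  fixes h :: "'k::field_char_0 \<Rightarrow> 'a::field_char_0"
  assumes nf: "number_field TYPE('k)"
    and h: "h 1 = 1" "\<And>x y. h (x + y) = h x + h y" "\<And>x y. h (x * y) = h x * h y"
  shows "\<exists>D s. range h \<subseteq> qspan D s"
proof -
  interpret Q: vector_space "\<lambda>(q::rat) x::'k. of_rat q * x"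
    by unfold_locales (auto simp: of_rat_add of_rat_mult algebra_simps)
  obtain B :: "'k set" where B: "finite B" "Q.span B = UNIV" using nf by (auto simp: number_field_def)
  obtain b where b: "bij_betw b {0..<card B} B" using ex_bij_betw_nat_finite[OF B(1)] by blast
  note h0 = additive_zero_sum(1)[of h, OF h(2)]
  have hm: "h (- x) = - h x" for x using h(2)[of x "- x"] h0 by (simp add: eq_neg_iff_add_eq_0 add.commute)
  have hn: "h (of_nat n) = of_nat n" for n by (induction n) (auto simp: h h0)
  have hi: "h (of_int i) = of_int i" for i
    by (cases i rule: int_cases2) (auto simp: hn hm)
  have hq: "h (of_rat q) = of_rat q" for q
  proof (cases q)
    case (Fract m n)
    then have "of_rat q * of_int n = (of_int m :: 'k)" "of_rat q * of_int n = (of_int m :: 'a)"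
      by (simp_all add: of_rat_rat)
    then have "h (of_rat q) * of_int n = of_rat q * of_int n" using h(3) hi by metis
    then show ?thesis using Fract by simp
  qed
  note hs = additive_zero_sum(2)[of h, OF h(2)]
  have "h x \<in> qspan (card B) (\<lambda>i. h (b i))" for x
  proof -
    have "x \<in> Q.span B" using B by simp
    then obtain u where "x = (\<Sum>v\<in>B. of_rat (u v) * v)" unfolding Q.span_finite[OF B(1)] by auto
    also have "\<dots> = (\<Sum>i<card B. of_rat (u (b i)) * b i)"
      using sum.reindex_bij_betw[OF b, of "\<lambda>v. of_rat (u v) * v"] by (simp add: atLeast0LessThan)
    finally have "h x = (\<Sum>i<card B. of_rat (u (b i)) * h (b i))" by (simp add: hs h hq)
    then show ?thesis unfolding qspan_def by (intro CollectI exI[of _ "\<lambda>i. u (b i)"]) auto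
  qed
  then show ?thesis by blast
qed

lemma range_hom_subring:
  fixes h :: "'k::field \<Rightarrow> 'a::field"
  assumes h: "h 1 = 1" "\<And>x y. h (x + y) = h x + h y" "\<And>x y. h (x * y) = h x * h y"
  shows "is_subring (range h)"
proof -
  have hm: "h (x - y) = h x - h y" for x y using h(2)[of "x - y" y] by simp
  show ?thesis
    unfolding is_subring_def by (auto simp flip: h hm intro!: rev_image_eqI[of 1])
qed

lemma range_hom_inverse:
  fixes h :: "'k::field \<Rightarrow> 'a::field"
  assumes h: "h 1 = 1" "\<And>x y. h (x + y) = h x + h y" "\<And>x y. h (x * y) = h x * h y"
    and "x \<in> range h"
  shows "inverse x \<in> range h"
proof -
  note h0 = additive_zero_sum(1)[of h, OF h(2)]
  obtain y where y: "x = h y" using \<open>x \<in> range h\<close> by auto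
  show ?thesis
  proof (cases "y = 0")
    case True
    then show ?thesis using h0 y by (auto intro: rev_image_eqI)
  next
    case False
    then have "h y * h (inverse y) = 1" by (simp flip: h)
    then have "inverse x = h (inverse y)" unfolding y by (rule inverse_unique)
    then show ?thesis by simp
  qed
qed

definition mult_closure :: "'a::comm_monoid_mult set \<Rightarrow> 'a set" where
  "mult_closure \<Lambda> = {prod_list xs | xs. set xs \<subseteq> \<Lambda>}"

text \<open>Products of arbitrary length all lie in one ring \<open>L\<close> containing \<Lambda>,
  of rank at most \<open>E\<close> over the rationals, and \<open>E\<close> is given by the number
  field, \<open>M\<close> and \<open>N\<close>. If two products have equal \<open>r\<close>-th
  powers, their quotient is a root of unity of degree at most \<open>E\<close>, whatever
  \<open>r\<close> is.\<close>

lemma uniform_exponent: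
  fixes h :: "'k::field_char_0 \<Rightarrow> 'a::field_char_0"
  assumes nf: "number_field TYPE('k)"
    and h: "h 1 = 1" "\<And>x y. h (x + y) = h x + h y" "\<And>x y. h (x * y) = h x * h y"
  shows "\<exists>n0\<ge>1. \<forall>\<Lambda>::'a set. finite \<Lambda> \<and> card \<Lambda> \<le> M \<and> 0 \<notin> \<Lambda> \<and>
      (\<forall>z\<in>\<Lambda>. \<exists>p. p \<noteq> 0 \<and> (\<forall>i. coeff p i \<in> range h) \<and> degree p \<le> N \<and> poly p z = 0) \<longrightarrow>
      (\<forall>a\<in>mult_closure \<Lambda>. \<forall>b\<in>mult_closure \<Lambda>. \<forall>r\<ge>1. a ^ r = b ^ r \<longrightarrow> a ^ n0 = b ^ n0)"
proof -
  obtain D s where D: "range h \<subseteq> qspan D s" using number_field_image_qspan[of h, OF nf h] by blast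
  \<comment> \<open>\<open>Suc N\<close> in place of \<open>N\<close> keeps the base positive, so
    that the power is monotone in the number of roots.\<close>
  define E where "E = D * (Suc N) ^ M"
  obtain n0 where n0: "n0 \<ge> 1" "\<And>z::'a. \<exists>r\<ge>1. z ^ r = 1 \<Longrightarrow> \<exists>p. p \<noteq> 0 \<and> degree p \<le> E \<and> poly (ipoly p) z = 0 \<Longrightarrow> z ^ n0 = 1"
    using roots_of_unity_bounded_degree[of E, where ?'a = 'a] by metis
  note K = range_hom_subring[OF h] and Ki = range_hom_inverse[OF h]
  have "a ^ n0 = b ^ n0"
    if \<Lambda>: "finite \<Lambda>" "card \<Lambda> \<le> M" "0 \<notin> \<Lambda>"
      "\<And>z. z \<in> \<Lambda> \<Longrightarrow> \<exists>p. p \<noteq> 0 \<and> (\<forall>i. coeff p i \<in> range h) \<and> degree p \<le> N \<and> poly p z = 0"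
      and ab: "a \<in> mult_closure \<Lambda>" "b \<in> mult_closure \<Lambda>" and r: "r \<ge> 1" "a ^ r = b ^ r" for \<Lambda> a b r
  proof -
    have \<Lambda>': "\<exists>p. p \<noteq> 0 \<and> (\<forall>i. coeff p i \<in> range h) \<and> degree p \<le> Suc N \<and> poly p z = 0" if "z \<in> \<Lambda>" for z
      using \<Lambda>(4)[OF that] by (auto intro: le_SucI)
    obtain L s' where L: "is_subring L" "\<Lambda> \<subseteq> L" "L \<subseteq> qspan (D * Suc N ^ card \<Lambda>) s'"
      using adjoin_roots[OF K D Ki \<Lambda>(1) \<Lambda>'] by blast
    have "D * Suc N ^ card \<Lambda> \<le> E" unfolding E_def using \<Lambda>(2) by (intro mult_left_mono power_increasing) auto
    then have LE: "L \<subseteq> qspan E s'" using L(3) qspan_mono by blast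
    have mc: "x \<in> L" if "x \<in> mult_closure \<Lambda>" for x
    proof -
      have "set xs \<subseteq> \<Lambda> \<Longrightarrow> prod_list xs \<in> L" for xs
        using L(1,2) by (induction xs) (auto intro: subring_one subring_mult)
      then show ?thesis using that by (auto simp: mult_closure_def)
    qed
    have b0: "b \<noteq> 0" using ab(2) \<Lambda>(3) by (auto simp: mult_closure_def prod_list_zero_iff)
    have "(a / b) ^ r = 1" using r b0 by (simp add: power_divide)
    moreover have "\<exists>p. p \<noteq> 0 \<and> degree p \<le> E \<and> poly (ipoly p) (a / b) = 0"
      using quotient_algebraic[OF L(1) LE mc[OF ab(1)] mc[OF ab(2)] b0] .
    ultimately have "(a / b) ^ n0 = 1" using n0(2) r(1) by blast
    then show ?thesis using b0 by (simp add: power_divide)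
  qed
  then show ?thesis using n0(1) by blast
qed

section \<open>Projective geometry: forms as functions, regular functions and regular maps\<close>

section \<open>Forms as functions on homogeneous coordinates\<close>

definition hform :: "'a set \<Rightarrow> nat \<Rightarrow> (('i::finite \<Rightarrow> 'a::field) \<Rightarrow> 'a) set" where
  "hform C d = eval_mpoly ` forms C d"

definition mon :: "('i::finite \<Rightarrow> nat) \<Rightarrow> ('i \<Rightarrow> 'a::field) \<Rightarrow> 'a" where
  "mon m x = (\<Prod>i\<in>UNIV. x i ^ m i)"

lemma eval_mpoly_superset:
  assumes "finite S" "Poly_Mapping.keys F \<subseteq> S"
  shows "eval_mpoly F x = (\<Sum>m\<in>S. Poly_Mapping.lookup F m * mon (Poly_Mapping.lookup m) x)"
  unfolding eval_mpoly_def mon_def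
  using assms by (intro sum.mono_neutral_left) (auto simp: in_keys_iff)

lemma hform_zero: "is_subring C \<Longrightarrow> (\<lambda>_. 0) \<in> hform C d"
  unfolding hform_def
  by (rule rev_image_eqI[of 0]) (auto simp: forms_def eval_mpoly_def fun_eq_iff subring_zero)

lemma hform_add:
  assumes C: "is_subring C" and f: "f \<in> hform C d" and g: "g \<in> hform C d"
  shows "(\<lambda>x. f x + g x) \<in> hform C d"
proof -
  obtain F G where F: "F \<in> forms C d" "f = eval_mpoly F" and G: "G \<in> forms C d" "g = eval_mpoly G"
    using f g by (auto simp: hform_def)
  have k: "Poly_Mapping.keys (F + G) \<subseteq> Poly_Mapping.keys F \<union> Poly_Mapping.keys G"
    by (rule Poly_Mapping.keys_add)
  have "F + G \<in> forms C d"
    using F G k C by (auto simp: forms_def lookup_add image_subset_iff intro: subring_add)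
  moreover have "(\<lambda>x. f x + g x) = eval_mpoly (F + G)"
    using k unfolding F(2) G(2)
    by (simp add: fun_eq_iff lookup_add distrib_right sum.distrib
        eval_mpoly_superset[of "Poly_Mapping.keys F \<union> Poly_Mapping.keys G"])
  ultimately show ?thesis by (auto simp: hform_def)
qed

lemma hform_mon:
  assumes C: "is_subring C" and "c \<in> C" "sum m UNIV = d"
  shows "(\<lambda>x. c * mon m x) \<in> hform C d"
proof -
  let ?m = "Poly_Mapping.Abs_poly_mapping m"
  have m: "Poly_Mapping.lookup ?m = m" by (simp add: lookup_Abs_poly_mapping)
  let ?F = "Poly_Mapping.single ?m c"
  have "?F \<in> forms C d"
    using assms subring_zero[OF C] by (auto simp: forms_def lookup_single when_def m split: if_splits)
  moreover have "eval_mpoly ?F = (\<lambda>x. c * mon m x)"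
    by (simp add: fun_eq_iff eval_mpoly_superset[of "{?m}"] m)
  ultimately show ?thesis unfolding hform_def by (metis image_eqI)
qed

lemma hform_induct [consumes 1, case_names zero add]:
  assumes f: "f \<in> hform C d"
    and 0: "P (\<lambda>_. 0)" and
    step: "\<And>c m g. c \<in> C \<Longrightarrow> sum m UNIV = d \<Longrightarrow> P g \<Longrightarrow> P (\<lambda>x. c * mon m x + g x)"
  shows "P f"
proof -
  obtain F where F: "F \<in> forms C d" "f = eval_mpoly F"
    using f by (auto simp: hform_def)
  have "P (\<lambda>x. \<Sum>m\<in>S. Poly_Mapping.lookup F m * mon (Poly_Mapping.lookup m) x)"
    if "finite S" "S \<subseteq> Poly_Mapping.keys F" for S
    using that
  proof (induction rule: finite_induct)
    case (insert m S)
    then have "P (\<lambda>x. Poly_Mapping.lookup F m * mon (Poly_Mapping.lookup m) x +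
        (\<Sum>m\<in>S. Poly_Mapping.lookup F m * mon (Poly_Mapping.lookup m) x))"
      using F(1) by (intro step) (auto simp: forms_def)
    then show ?case using insert by simp
  qed (simp add: 0)
  moreover have "eval_mpoly F = (\<lambda>x. \<Sum>m\<in>Poly_Mapping.keys F. Poly_Mapping.lookup F m * mon (Poly_Mapping.lookup m) x)"
    by (rule ext) (rule eval_mpoly_superset[OF finite_keys order_refl])
  ultimately show ?thesis
    unfolding F(2) by simp
qed

lemma mon_mult: "mon m x * mon n x = mon (\<lambda>i. m i + n i) x"
  by (simp add: mon_def power_add prod.distrib)

lemma hform_mult:
  assumes C: "is_subring C" and f: "f \<in> hform C d" and g: "g \<in> hform C e"
  shows "(\<lambda>x. f x * g x) \<in> hform C (d + e)"
  using f
proof (induction rule: hform_induct)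
  case zero
  show ?case using hform_zero[OF C] by simp
next
  case (add c m f)
  have "(\<lambda>x. (c * mon m x) * g x) \<in> hform C (d + e)"
    using g
  proof (induction rule: hform_induct)
    case zero
    show ?case using hform_zero[OF C] by simp
  next
    case (add c' m' g)
    have "(\<lambda>x. (c * c') * mon (\<lambda>i. m i + m' i) x) \<in> hform C (d + e)"
      using \<open>c \<in> C\<close> \<open>sum m UNIV = d\<close> add C
      by (intro hform_mon) (auto simp: sum.distrib intro: subring_mult)
    from hform_add[OF C this add(3)] show ?case
      by (simp add: mon_mult[symmetric] algebra_simps)
  qed
  from hform_add[OF C this add(3)] show ?case by (simp add: algebra_simps)
qed

lemma hform_const: "is_subring C \<Longrightarrow> c \<in> C \<Longrightarrow> (\<lambda>_. c) \<in> hform C 0"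
  using hform_mon[of C c "\<lambda>_. 0" 0] by (simp add: mon_def)

lemma hform_coord:
  assumes "is_subring C"
  shows "(\<lambda>x. x i) \<in> hform C 1"
proof -
  have *: "mon (\<lambda>j. if j = i then 1 else 0) = (\<lambda>x. x i :: 'a)"
    by (simp add: mon_def fun_eq_iff if_distrib[of "\<lambda>k. _ ^ k"] cong: if_cong)
  then show ?thesis
    using hform_mon[OF assms subring_one[OF assms], of "\<lambda>j. if j = i then 1 else 0" 1]
    unfolding * by simp
qed

lemma hform_scale: "is_subring C \<Longrightarrow> c \<in> C \<Longrightarrow> f \<in> hform C d \<Longrightarrow> (\<lambda>x. c * f x) \<in> hform C d"
  using hform_mult[OF _ hform_const, of C c f d] by simp

lemma hform_diff:
  assumes C: "is_subring C" and f: "f \<in> hform C d" and g: "g \<in> hform C d"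
  shows "(\<lambda>x. f x - g x) \<in> hform C d"
  using hform_add[OF C f hform_scale[OF C _ g, of "- 1"]] C by (simp add: subring_minus subring_one)

lemma hform_power: "is_subring C \<Longrightarrow> f \<in> hform C d \<Longrightarrow> (\<lambda>x. f x ^ n) \<in> hform C (d * n)"
proof (induction n)
  case 0
  then show ?case using hform_const[OF _ subring_one] by simp
next
  case (Suc n)
  from hform_mult[OF Suc.prems Suc.IH[OF Suc.prems]] show ?case by (simp add: algebra_simps)
qed

lemma hform_prod:
  assumes C: "is_subring C" and "finite J" "\<And>j. j \<in> J \<Longrightarrow> f j \<in> hform C (d j)"
  shows "(\<lambda>x. \<Prod>j\<in>J. f j x) \<in> hform C (\<Sum>j\<in>J. d j)"
  using assms(2,3)
proof (induction rule: finite_induct)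
  case empty
  then show ?case using hform_const[OF C subring_one[OF C]] by simp
next
  case (insert j J)
  then show ?case using hform_mult[OF C, of "f j" "d j"] by simp
qed

lemma hform_sum:
  assumes C: "is_subring C" and "\<And>j. j \<in> J \<Longrightarrow> f j \<in> hform C d"
  shows "(\<lambda>x. \<Sum>j\<in>J. f j x) \<in> hform C d"
  using assms(2)
  by (induction J rule: infinite_finite_induct) (auto intro: hform_zero[OF C] hform_add[OF C])

lemma hform_comp:
  assumes C: "is_subring C" and f: "f \<in> hform C d" and g: "\<And>j. g j \<in> hform C e"
  shows "(\<lambda>x. f (\<lambda>j. g j x)) \<in> hform C (e * d)"
  using f
proof (induction rule: hform_induct)
  case zero
  show ?case by (rule hform_zero[OF C])
next
  case (add c m f)
  have "(\<lambda>x. \<Prod>j\<in>UNIV. g j x ^ m j) \<in> hform C (\<Sum>j\<in>UNIV. e * m j)"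
    by (intro hform_prod C hform_power g) auto
  then have "(\<lambda>x. mon m (\<lambda>j. g j x)) \<in> hform C (e * d)"
    using add by (simp add: mon_def flip: sum_distrib_left)
  from hform_add[OF C hform_scale[OF C add(1) this] add(3)] show ?case .
qed

lemma hform_homogeneous: "f \<in> hform C d \<Longrightarrow> f (\<lambda>i. c * x i) = c ^ d * f x"
proof (induction rule: hform_induct)
  case (add b m g)
  have "mon m (\<lambda>i. c * x i) = c ^ d * mon m x"
    using add(2) by (simp add: mon_def power_mult_distrib prod.distrib flip: power_sum)
  then show ?case using add(3) by (simp add: algebra_simps)
qed simp

lemma hform_mono: "C \<subseteq> C' \<Longrightarrow> f \<in> hform C d \<Longrightarrow> f \<in> hform C' d"
  unfolding hform_def forms_def by blast

lemma subring_UNIV: "is_subring UNIV"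
  by (simp add: is_subring_def)

lemma sum_fun_apply: "(\<Sum>i\<in>I. f i) x = (\<Sum>i\<in>I. f i x)"
  by (induction I rule: infinite_finite_induct) auto

lemma power_fun_apply: "(f ^ n) x = f x ^ n"
  by (induction n) auto

lemma prod_fun_apply: "(\<Prod>i\<in>I. f i) x = (\<Prod>i\<in>I. f i x)"
  by (induction I rule: infinite_finite_induct) auto

text \<open>The vectors \<open>u Q\<close> may be any coordinates depending on \<open>Q\<close>, so
  this serves representatives of \<open>Q\<close> as well as of its image under a map. The expansion
  into ratios survives \<open>u Q l = 0\<close>: each term is then 0 if
  \<open>d > 0\<close>.\<close>

lemma dehomogenized_form:
  assumes S: "is_subring S" and y: "\<And>i. (\<lambda>Q. u Q i / u Q l) \<in> S"
    and const: "\<And>c. c \<in> C \<Longrightarrow> (\<lambda>_. c) \<in> S" and F: "F \<in> hform C d"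
  shows "(\<lambda>Q. F (u Q) / u Q l ^ d) \<in> S"
  using F
proof (induction rule: hform_induct)
  case zero
  show ?case using subring_zero[OF S] by (simp add: zero_fun_def)
next
  case (add a n F)
  let ?f = "(\<lambda>_. a) * (\<Prod>i\<in>UNIV. (\<lambda>Q. u Q i / u Q l) ^ n i) + (\<lambda>Q. F (u Q) / u Q l ^ d)"
  have "?f \<in> S"
    by (intro subring_add[OF S] subring_mult[OF S] subring_prod[OF S] subring_power[OF S] y add const)
  moreover have "?f = (\<lambda>Q. (a * mon n (u Q) + F (u Q)) / u Q l ^ d)"
  proof
    fix Q
    have "(\<Prod>i\<in>UNIV. (\<lambda>Q. u Q i / u Q l) ^ n i) Q = mon n (u Q) / u Q l ^ d"
      by (simp add: prod_fun_apply power_fun_apply mon_def power_divide prod_dividef power_sum[symmetric] add(2))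
    then show "?f Q = (a * mon n (u Q) + F (u Q)) / u Q l ^ d"
      by (simp add: add_divide_distrib)
  qed
  ultimately show ?case by simp
qed

section \<open>Representatives of projective points\<close>

definition rep :: "('i, 'a::field) proj \<Rightarrow> 'i \<Rightarrow> 'a" where
  "rep P = (SOME x. x \<in> coords P)"

lemma coords_nonempty: "\<exists>x. x \<in> coords P"
proof -
  have "\<exists>i. rep_proj P i \<noteq> 0" "abs_proj (rep_proj P) = P"
    using Quotient_rep_reflp[OF Quotient_proj, of P] Quotient_abs_rep[OF Quotient_proj, of P] by auto
  then show ?thesis by (auto simp: coords_def point_def)
qed

lemma rep_coords: "rep P \<in> coords P"
  unfolding rep_def using coords_nonempty by (rule someI_ex)

lemma rep_nonzero: "\<exists>i. rep P i \<noteq> 0" and point_rep [simp]: "point (rep P) = P"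
  using rep_coords[of P] by (auto simp: coords_def)

lemma point_eq_iff:
  fixes x y :: "'i \<Rightarrow> 'a::field"
  assumes "x i \<noteq> 0" "y j \<noteq> 0"
  shows "point x = point y \<longleftrightarrow> (\<exists>c. c \<noteq> 0 \<and> y = (\<lambda>i. c * x i))"
proof -
  have r: "(\<exists>i. z i \<noteq> 0) \<and> (\<exists>c. c \<noteq> 0 \<and> z = (\<lambda>i. c * z i))" if "z k \<noteq> 0" for z :: "'i \<Rightarrow> 'a" and k
    using that by (intro conjI exI[of _ 1]) auto
  show ?thesis
    using Quotient_rel[OF Quotient_proj, of x y] r[of x i, OF assms(1)] r[of y j, OF assms(2)] assms
    unfolding point_def by blast
qed

lemma rep_point:
  assumes "x i \<noteq> 0"
  shows "\<exists>c. c \<noteq> 0 \<and> rep (point x) = (\<lambda>i. c * x i)"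
  using point_eq_iff[of x i "rep (point x)"] rep_nonzero[of "point x"] assms by auto

lemma coords_scale: "x \<in> coords P \<Longrightarrow> \<exists>c. c \<noteq> 0 \<and> x = (\<lambda>i. c * rep P i)"
  using point_eq_iff[of "rep P" _ x] rep_nonzero[of P] by (auto simp: coords_def)

lemma hform_coords_zero_iff:
  assumes "f \<in> hform C d" "x \<in> coords P"
  shows "f x = 0 \<longleftrightarrow> f (rep P) = 0"
  using coords_scale[OF assms(2)] hform_homogeneous[OF assms(1)] by auto

lemma vanishes_at_iff: "F \<in> forms C d \<Longrightarrow> vanishes_at F P \<longleftrightarrow> eval_mpoly F (rep P) = 0"
  using hform_coords_zero_iff[of "eval_mpoly F" C d] rep_coords[of P]
  unfolding vanishes_at_def hform_def by blast

lemma closed_over_hform: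
  fixes f :: "('i::finite \<Rightarrow> 'a::alg_closed_field) \<Rightarrow> 'a"
  assumes "f \<in> hform C d"
  shows "closed_over C {P. f (rep P) = 0}"
proof -
  obtain F where "F \<in> forms C d" "f = eval_mpoly F" using assms by (auto simp: hform_def)
  then show ?thesis
    unfolding closed_over_def by (intro exI[of _ "{F}"]) (auto simp: vanishes_at_iff)
qed

lemma closed_overD:
  assumes "closed_over C V" "P \<notin> V"
  shows "\<exists>d f. f \<in> hform C d \<and> (\<forall>Q\<in>V. f (rep Q) = 0) \<and> f (rep P) \<noteq> 0"
proof -
  obtain S where S: "S \<subseteq> (\<Union>d. forms C d)" "V = {P. \<forall>F\<in>S. vanishes_at F P}"
    using assms by (auto simp: closed_over_def)
  then obtain F d where F: "F \<in> S" "F \<in> forms C d" "\<not> vanishes_at F P" using assms(2) by auto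
  then show ?thesis
    using S by (intro exI[of _ d] exI[of _ "eval_mpoly F"]) (auto simp: hform_def vanishes_at_iff)
qed

text \<open>The homogeneous coordinate ring of an irreducible set has no zero divisors;
  irreducibility is used below mostly in this form.\<close>

lemma irreducible_hform:
  assumes "irreducible_set V" "f \<in> hform UNIV d" "g \<in> hform UNIV e"
    and "\<And>P. P \<in> V \<Longrightarrow> f (rep P) * g (rep P) = 0" "P \<in> V" "f (rep P) \<noteq> 0" "Q \<in> V"
  shows "g (rep Q) = 0"
proof -
  have "V \<subseteq> {P. f (rep P) = 0} \<union> {P. g (rep P) = 0}" using assms(4) by auto
  then have "V \<subseteq> {P. f (rep P) = 0} \<or> V \<subseteq> {P. g (rep P) = 0}"
    using assms(1) closed_over_hform[OF assms(2)] closed_over_hform[OF assms(3)]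
    by (auto simp: irreducible_set_def)
  then show ?thesis using assms(5-7) by auto
qed

section \<open>Regular functions and maps\<close>

text \<open>The values of a member outside \<open>V\<close>, and away from a neighbourhood of \<open>P\<close>, are arbitrary.\<close>

definition local_ring :: "('i::finite, 'a::field) proj set \<Rightarrow> ('i, 'a) proj \<Rightarrow> (('i, 'a) proj \<Rightarrow> 'a) set" where
  "local_ring V P = {h. \<exists>d. \<exists>F\<in>hform UNIV d. \<exists>G\<in>hform UNIV d. G (rep P) \<noteq> 0 \<and>
     (\<forall>Q\<in>V. G (rep Q) \<noteq> 0 \<longrightarrow> h Q = F (rep Q) / G (rep Q))}"

lemma local_ringI:
  assumes "F \<in> hform UNIV d" "G \<in> hform UNIV d" "G (rep P) \<noteq> 0"
    "\<And>Q. Q \<in> V \<Longrightarrow> G (rep Q) \<noteq> 0 \<Longrightarrow> h Q = F (rep Q) / G (rep Q)"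
  shows "h \<in> local_ring V P"
  using assms unfolding local_ring_def by blast

lemma local_ringE:
  assumes "h \<in> local_ring V P"
  obtains d F G where "F \<in> hform UNIV d" "G \<in> hform UNIV d" "G (rep P) \<noteq> 0"
    "\<And>Q. Q \<in> V \<Longrightarrow> G (rep Q) \<noteq> 0 \<Longrightarrow> h Q = F (rep Q) / G (rep Q)"
  using assms unfolding local_ring_def by blast

lemma local_ring_const: "(\<lambda>_. c) \<in> local_ring V P"
  by (rule local_ringI[of "\<lambda>_. c" 0 "\<lambda>_. 1"]) (auto intro: hform_const subring_UNIV)

lemma local_ring_subring: "is_subring (local_ring V P)"
proof -
  note U = subring_UNIV
  have "f - g \<in> local_ring V P \<and> f * g \<in> local_ring V P"
    if f: "f \<in> local_ring V P" and g: "g \<in> local_ring V P" for f g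
  proof -
    obtain d F G where F: "F \<in> hform UNIV d" "G \<in> hform UNIV d" "G (rep P) \<noteq> 0"
      "\<And>Q. Q \<in> V \<Longrightarrow> G (rep Q) \<noteq> 0 \<Longrightarrow> f Q = F (rep Q) / G (rep Q)"
      using f by (rule local_ringE) metis
    obtain e F' G' where F': "F' \<in> hform UNIV e" "G' \<in> hform UNIV e" "G' (rep P) \<noteq> 0"
      "\<And>Q. Q \<in> V \<Longrightarrow> G' (rep Q) \<noteq> 0 \<Longrightarrow> g Q = F' (rep Q) / G' (rep Q)"
      using g by (rule local_ringE) metis
    have "f - g \<in> local_ring V P"
    proof (rule local_ringI)
      show "(\<lambda>x. F x * G' x - G x * F' x) \<in> hform UNIV (d + e)"
        by (intro hform_diff hform_mult U F F')
      show "(\<lambda>x. G x * G' x) \<in> hform UNIV (d + e)" by (intro hform_mult U F F')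
    qed (use F F' in \<open>auto simp: diff_frac_eq mult.commute\<close>)
    moreover have "f * g \<in> local_ring V P"
    proof (rule local_ringI)
      show "(\<lambda>x. F x * F' x) \<in> hform UNIV (d + e)" by (intro hform_mult U F F')
      show "(\<lambda>x. G x * G' x) \<in> hform UNIV (d + e)" by (intro hform_mult U F F')
    qed (use F F' in auto)
    ultimately show ?thesis by blast
  qed
  then show ?thesis
    unfolding is_subring_def using local_ring_const[of 1 V P] by (auto simp: one_fun_def)
qed

lemma local_ring_quotient:
  assumes "F \<in> hform UNIV d" "G \<in> hform UNIV d" "G (rep P) \<noteq> 0"
  shows "(\<lambda>Q. F (rep Q) / G (rep Q)) \<in> local_ring V P"
  by (rule local_ringI[OF assms]) simp

lemma local_ring_subset: "V' \<subseteq> V \<Longrightarrow> h \<in> local_ring V P \<Longrightarrow> h \<in> local_ring V' P"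
  unfolding local_ring_def by blast

text \<open>The product of \<open>B\<close> with the denominator and numerator of \<open>h\<close>
  vanishes on all of \<open>V\<close>; irreducibility cancels \<open>B\<close>, and at
  \<open>P\<close> itself the denominator is nonzero.\<close>

lemma regular_identity:
  assumes V: "irreducible_set V" and h: "h \<in> local_ring V P" "P \<in> V"
    and B: "B \<in> hform UNIV d" "R \<in> V" "B (rep R) \<noteq> 0"
    and 0: "\<And>Q. Q \<in> V \<Longrightarrow> B (rep Q) \<noteq> 0 \<Longrightarrow> h Q = 0"
  shows "h P = 0"
proof -
  obtain e F G where F: "F \<in> hform UNIV e" "G \<in> hform UNIV e" "G (rep P) \<noteq> 0"
    "\<And>Q. Q \<in> V \<Longrightarrow> G (rep Q) \<noteq> 0 \<Longrightarrow> h Q = F (rep Q) / G (rep Q)"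
    using h(1) by (rule local_ringE) metis
  have GF: "(\<lambda>x. G x * F x) \<in> hform UNIV (e + e)" by (intro hform_mult subring_UNIV F)
  have "B (rep Q) * (G (rep Q) * F (rep Q)) = 0" if "Q \<in> V" for Q
    using 0[OF that] F(4)[OF that] by (cases "B (rep Q) = 0"; cases "G (rep Q) = 0") auto
  then have "G (rep P) * F (rep P) = 0"
    using irreducible_hform[OF V B(1) GF] B h(2) by blast
  then show ?thesis using F(3,4) h(2) by simp
qed

definition regular_map_at ::
  "'a set \<Rightarrow> ('i::finite, 'a::field) proj set \<Rightarrow> ('i, 'a) proj \<Rightarrow> (('i, 'a) proj \<Rightarrow> ('j::finite, 'a) proj) \<Rightarrow> bool" where
  "regular_map_at C V P \<psi> \<longleftrightarrow> (\<exists>d E. (\<forall>j. E j \<in> hform C d) \<and> (\<exists>j. E j (rep P) \<noteq> 0) \<and>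
     (\<forall>Q\<in>V. (\<exists>j. E j (rep Q) \<noteq> 0) \<longrightarrow> \<psi> Q = point (\<lambda>j. E j (rep Q))))"

lemma morphism_over_regular:
  assumes "morphism_over C V W \<psi>" "P \<in> V"
  shows "regular_map_at C V P \<psi>"
proof -
  obtain d F where F: "\<And>j. F j \<in> forms C d" "\<exists>j. \<not> vanishes_at (F j) P"
    "\<forall>Q\<in>V. \<forall>x\<in>coords Q. (\<exists>j. eval_mpoly (F j) x \<noteq> 0) \<longrightarrow> \<psi> Q = point (\<lambda>j. eval_mpoly (F j) x)"
    using assms unfolding morphism_over_def by blast
  show ?thesis
    unfolding regular_map_at_def
    by (intro exI[of _ d] exI[of _ "\<lambda>j. eval_mpoly (F j)"])
       (use F rep_coords in \<open>auto simp: hform_def vanishes_at_iff[OF F(1)]\<close>)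
qed

lemma rep_regular_map:
  assumes "\<exists>j. E j (rep Q) \<noteq> 0" "\<psi> Q = point (\<lambda>j. E j (rep Q))" "F \<in> hform C d"
  shows "\<exists>c. c \<noteq> 0 \<and> rep (\<psi> Q) = (\<lambda>j. c * E j (rep Q)) \<and> F (rep (\<psi> Q)) = c ^ d * F (\<lambda>j. E j (rep Q))"
proof -
  obtain j where "E j (rep Q) \<noteq> 0" using assms(1) by blast
  then obtain c where c: "c \<noteq> 0" "rep (\<psi> Q) = (\<lambda>j. c * E j (rep Q))"
    using rep_point[of "\<lambda>j. E j (rep Q)" j] unfolding assms(2) by blast
  have "F (rep (\<psi> Q)) = c ^ d * F (\<lambda>j. E j (rep Q))"
    unfolding c(2) using hform_homogeneous[OF assms(3)] .
  then show ?thesis using c by blast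
qed

lemma regular_comp:
  assumes \<psi>: "regular_map_at UNIV V P \<psi>" and h: "h \<in> local_ring W (\<psi> P)"
    and VW: "\<psi> ` V \<subseteq> W" and P: "P \<in> V"
  shows "(\<lambda>Q. h (\<psi> Q)) \<in> local_ring V P"
proof -
  obtain e E where E: "\<And>j. E j \<in> hform UNIV e" "\<exists>j. E j (rep P) \<noteq> 0"
    "\<And>Q. Q \<in> V \<Longrightarrow> \<exists>j. E j (rep Q) \<noteq> 0 \<Longrightarrow> \<psi> Q = point (\<lambda>j. E j (rep Q))"
    using \<psi> unfolding regular_map_at_def by blast
  obtain j0 where j0: "E j0 (rep P) \<noteq> 0" using E(2) by blast
  obtain d F G where F: "F \<in> hform UNIV d" "G \<in> hform UNIV d" "G (rep (\<psi> P)) \<noteq> 0"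
    "\<And>Q. Q \<in> W \<Longrightarrow> G (rep Q) \<noteq> 0 \<Longrightarrow> h Q = F (rep Q) / G (rep Q)"
    using h by (rule local_ringE) metis
  show ?thesis
  proof (rule local_ringI)
    \<comment> \<open>The extra factor \<open>E j0\<close> makes the formula for \<psi> valid
      wherever the new denominator is nonzero; for \<open>d = 0\<close> the form \<open>G\<close> is
      constant and would not detect this.\<close>
    show "(\<lambda>x. F (\<lambda>j. E j x) * E j0 x) \<in> hform UNIV (e * d + e)"
      by (intro hform_mult hform_comp subring_UNIV F E)
    show "(\<lambda>x. G (\<lambda>j. E j x) * E j0 x) \<in> hform UNIV (e * d + e)"
      by (intro hform_mult hform_comp subring_UNIV F E)
    show "G (\<lambda>j. E j (rep P)) * E j0 (rep P) \<noteq> 0"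
      using rep_regular_map[of E P \<psi> G UNIV d, OF E(2) E(3)[OF P E(2)] F(2)] F(3) j0 by auto
    fix Q assume Q: "Q \<in> V" "G (\<lambda>j. E j (rep Q)) * E j0 (rep Q) \<noteq> 0"
    then have ex: "\<exists>j. E j (rep Q) \<noteq> 0" by auto
    obtain c where c: "c \<noteq> 0" "rep (\<psi> Q) = (\<lambda>j. c * E j (rep Q))"
      "F (rep (\<psi> Q)) = c ^ d * F (\<lambda>j. E j (rep Q))"
      using rep_regular_map[of E Q \<psi> F UNIV d, OF ex E(3)[OF Q(1) ex] F(1)] by blast
    have G: "G (rep (\<psi> Q)) = c ^ d * G (\<lambda>j. E j (rep Q))"
      unfolding c(2) using hform_homogeneous[OF F(2)] .
    show "h (\<psi> Q) = F (\<lambda>j. E j (rep Q)) * E j0 (rep Q) / (G (\<lambda>j. E j (rep Q)) * E j0 (rep Q))"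
      using F(4)[of "\<psi> Q"] Q VW c G by auto
  qed
qed

lemma regular_iterate:
  assumes \<psi>: "\<And>P. P \<in> V \<Longrightarrow> regular_map_at UNIV V P \<psi>" "\<psi> ` V \<subseteq> V"
    and "P \<in> V" "h \<in> local_ring V ((\<psi> ^^ n) P)"
  shows "(\<lambda>Q. h ((\<psi> ^^ n) Q)) \<in> local_ring V P"
  using assms(3,4)
proof (induction n arbitrary: P)
  case (Suc n)
  have "(\<lambda>Q. h ((\<psi> ^^ n) Q)) \<in> local_ring V (\<psi> P)"
    using Suc \<psi>(2) by (intro Suc.IH) (auto simp: funpow_swap1)
  from regular_comp[OF \<psi>(1)[OF Suc.prems(1)] this \<psi>(2) Suc.prems(1)]
  show ?case by (simp add: funpow_swap1)
qed simp

section \<open>Local algebra at a point: first-order jets and Krull's theorem for germs\<close>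

section \<open>First-order expansions\<close>

context function_germs
begin

lemma mp_2_sub: "mp 2 \<subseteq> maxid"
  using mp_antimono[of 1] mp_1 by (simp add: numeral_2_eq_2)

lemma maxid_mult: "f \<in> maxid \<Longrightarrow> g \<in> maxid \<Longrightarrow> f * g \<in> mp 2"
  using mp_mult[of f 1 g 1] by (simp add: mp_1 numeral_2_eq_2 del: mpow.simps)

lemma Os_cscale: "f \<in> Os \<Longrightarrow> (\<lambda>x. c * f x) \<in> Os"
  using subring_mult[OF subring const[of c]] by (simp add: times_fun_def)

lemma maxid_cscale: "f \<in> maxid \<Longrightarrow> (\<lambda>x. c * f x) \<in> maxid"
  by (auto simp: maxid_def Os_cscale)

lemma sub_value: "f \<in> Os \<Longrightarrow> (\<lambda>x. f x - f e) \<in> maxid"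
  using subring_diff[OF subring _ const[of "f e"]] by (auto simp: maxid_def fun_diff_def)

text \<open>Containing \<open>mp 2\<close> makes membership depend only on the class modulo
  \<open>mp 2\<close>. Two instances occur: the image of the cotangent map, with \<open>C\<close>
  the whole field, and the \<open>C\<close>-span of the coordinate functions.\<close>

definition germ_module :: "'a set \<Rightarrow> ('p \<Rightarrow> 'a) set \<Rightarrow> bool" where
  "germ_module C N \<longleftrightarrow> mp 2 \<subseteq> N \<and> (\<forall>f\<in>N. \<forall>g\<in>N. (\<lambda>x. f x + g x) \<in> N) \<and> (\<forall>c\<in>C. \<forall>f\<in>N. (\<lambda>x. c * f x) \<in> N)"

text \<open>First-order jets with value in \<open>C\<close> and differential in \<open>N\<close>.
  The lemmas below carry membership along sums, products, inverses and, over the whole field, simple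
  roots of polynomials.\<close>

definition first_order :: "'a set \<Rightarrow> ('p \<Rightarrow> 'a) set \<Rightarrow> ('p \<Rightarrow> 'a) set" where
  "first_order C N = {f \<in> Os. f e \<in> C \<and> (\<lambda>x. f x - f e) \<in> N}"

lemma germ_moduleD:
  assumes "germ_module C N"
  shows "f \<in> mp 2 \<Longrightarrow> f \<in> N" "f \<in> N \<Longrightarrow> g \<in> N \<Longrightarrow> (\<lambda>x. f x + g x) \<in> N"
    "c \<in> C \<Longrightarrow> f \<in> N \<Longrightarrow> (\<lambda>x. c * f x) \<in> N"
  using assms by (auto simp: germ_module_def)

lemma germ_module_cong:
  assumes N: "germ_module C N" and "f \<in> N" "(\<lambda>x. g x - f x) \<in> mp 2"
  shows "g \<in> N"
  using germ_moduleD(2)[OF N assms(2) germ_moduleD(1)[OF N assms(3)]] by simp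

lemma first_order_cong:
  assumes N: "germ_module C N" and f: "f \<in> first_order C N" and g: "g \<in> Os" "(\<lambda>x. g x - f x) \<in> mp 2"
  shows "g \<in> first_order C N"
proof -
  have ge: "g e = f e" using g(2) mp_2_sub by (auto simp: maxid_def)
  have "(\<lambda>x. g x - g e) \<in> N"
    by (rule germ_module_cong[OF N]) (use f g ge in \<open>auto simp: first_order_def\<close>)
  then show ?thesis using f g ge by (simp add: first_order_def)
qed

lemma first_order_const:
  assumes N: "germ_module C N" and "c \<in> C"
  shows "(\<lambda>_. c) \<in> first_order C N"
  using assms germ_moduleD(1)[OF N mp_zero] const[of c] by (simp add: first_order_def zero_fun_def)

lemma first_order_subring:
  assumes C: "is_subring C" and N: "germ_module C N"
  shows "is_subring (first_order C N)"
  unfolding is_subring_def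
proof (intro conjI ballI)
  show "1 \<in> first_order C N"
    using first_order_const[OF N subring_one[OF C]] by (simp add: one_fun_def)
  fix f g assume f: "f \<in> first_order C N" and g: "g \<in> first_order C N"
  let ?f = "\<lambda>x. f x - f e" and ?g = "\<lambda>x. g x - g e"
  have fg: "?f \<in> N" "?g \<in> N" "f e \<in> C" "g e \<in> C" "f \<in> Os" "g \<in> Os"
    using f g by (auto simp: first_order_def)
  have "(\<lambda>x. ?f x + (- 1) * ?g x) \<in> N"
    using fg C subring_minus[OF C subring_one[OF C]] by (intro germ_moduleD(2,3)[OF N]) (auto intro: germ_moduleD(1)[OF N])
  then have "(\<lambda>x. (f - g) x - (f - g) e) \<in> N" by (simp add: algebra_simps)
  then show "f - g \<in> first_order C N"
    using fg C subring by (auto simp: first_order_def intro: subring_diff)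
  have "?f * ?g \<in> mp 2" using fg by (intro maxid_mult sub_value)
  then have "(\<lambda>x. (?f * ?g) x) \<in> N" using germ_moduleD(1)[OF N] by blast
  then have "(\<lambda>x. (f e * ?g x + g e * ?f x) + (?f * ?g) x) \<in> N"
    using fg by (intro germ_moduleD(2,3)[OF N])
  then have "(\<lambda>x. (f * g) x - (f * g) e) \<in> N" by (simp add: algebra_simps)
  then show "f * g \<in> first_order C N"
    using fg C subring by (auto simp: first_order_def intro: subring_mult)
qed

text \<open>The differential of \<open>1/f\<close> at \<open>e\<close> is
  \<open>-(f - a) / a^2\<close> with \<open>a = f e\<close>, and the rest is the second-order error
  \<open>q\<close>. As functions are total, \<open>v\<close> is asked to invert \<open>f\<close>
  only modulo \<open>mp 2\<close>.\<close>

lemma first_order_inverse: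
  assumes C: "is_subring C" "\<And>c. c \<in> C \<Longrightarrow> inverse c \<in> C" and N: "germ_module C N"
    and f: "f \<in> first_order C N" and v: "v \<in> Os" "(\<lambda>x. v x * f x - 1) \<in> mp 2"
  shows "v \<in> first_order C N"
proof -
  define a where "a = f e"
  define z where "z = (\<lambda>x. v x * f x - 1)"
  have f': "f \<in> Os" "a \<in> C" "(\<lambda>x. f x - a) \<in> N" using f by (auto simp: first_order_def a_def)
  have z: "z \<in> mp 2" using v by (simp add: z_def)
  then have "z e = 0" using mp_2_sub by (auto simp: maxid_def)
  then have va: "v e * a = 1" by (simp add: z_def a_def)
  then have a0: "a \<noteq> 0" by auto
  have ve: "v e = inverse a" using va a0 by (simp add: field_simps)
  have ff: "(\<lambda>x. f x - a) \<in> maxid" unfolding a_def by (rule sub_value[OF f'(1)])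
  define q where "q = (\<lambda>x. inverse (a\<^sup>2) * (v * ((\<lambda>x. f x - a) * (\<lambda>x. f x - a)) + ((\<lambda>x. a + (a - f x)) * z)) x)"
  have "(\<lambda>x. a - f x) = - (\<lambda>x. f x - a)" by (simp add: fun_eq_iff)
  then have "(\<lambda>x. a - f x) \<in> Os"
    using ff maxid_sub subring_minus[OF subring] by (metis subsetD)
  from subring_add[OF subring const[of a] this] have "(\<lambda>x. a + (a - f x)) \<in> Os" by (simp add: plus_fun_def)
  then have "q \<in> mp 2" unfolding q_def using v ff z by (intro mp_cscale mp_add mp_scale maxid_mult) auto
  moreover have "- inverse (a\<^sup>2) \<in> C"
    using C(1) f'(2) by (intro subring_minus C(2)) (auto simp: power2_eq_square intro: subring_mult)
  ultimately have "(\<lambda>x. (- inverse (a\<^sup>2)) * (f x - a) + q x) \<in> N"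
    using f' by (intro germ_moduleD(2,3)[OF N]) (auto intro: germ_moduleD(1)[OF N])
  moreover have "(- inverse (a\<^sup>2)) * (f x - a) + q x = v x - v e" for x
  proof -
    have "(- inverse (a\<^sup>2)) * (f x - a) + q x
      = inverse (a\<^sup>2) * (v x * (f x - a) * (f x - a) + (2 * a - f x) * (v x * f x - 1) - (f x - a))"
      by (simp add: q_def z_def algebra_simps)
    also have "v x * (f x - a) * (f x - a) + (2 * a - f x) * (v x * f x - 1) - (f x - a) = a\<^sup>2 * v x - a"
      by (simp add: algebra_simps power2_eq_square)
    also have "inverse (a\<^sup>2) * (a\<^sup>2 * v x - a) = v x - inverse a"
      using a0 by (simp add: field_simps power2_eq_square)
    finally show ?thesis by (simp add: ve)
  qed
  ultimately have "(\<lambda>x. v x - v e) \<in> N" by simp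
  then show ?thesis using v ve C(2) f'(2) by (simp add: first_order_def)
qed

lemma power_first_order:
  assumes "y \<in> Os"
  shows "(\<lambda>x. y x ^ j - y e ^ j - of_nat j * y e ^ (j - 1) * (y x - y e)) \<in> mp 2"
proof (induction j)
  case 0
  then show ?case using mp_zero[of 2] by (simp add: zero_fun_def)
next
  case (Suc j)
  let ?w = "\<lambda>x. y x - y e"
  let ?r = "\<lambda>x. y x ^ j - y e ^ j - of_nat j * y e ^ (j - 1) * (y x - y e)"
  have w: "?w \<in> maxid" by (rule sub_value[OF assms])
  have "y * ?r + (\<lambda>x. (of_nat j * y e ^ (j - 1)) * (?w * ?w) x) \<in> mp 2"
    using Suc assms w by (intro mp_add mp_scale mp_cscale maxid_mult)
  moreover have "y x * ?r x + (of_nat j * y e ^ (j - 1)) * (?w x * ?w x)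
     = y x ^ Suc j - y e ^ Suc j - of_nat (Suc j) * y e ^ (Suc j - 1) * ?w x" for x
    by (cases j) (simp_all add: algebra_simps)
  ultimately show ?case by (simp add: plus_fun_def times_fun_def)
qed

text \<open>Implicit differentiation: expanding the relation to first order expresses
  \<open>y - y e\<close>, multiplied by the nonzero derivative \<open>d\<close>, through the
  differentials of the coefficients.\<close>

lemma first_order_root:
  assumes N: "germ_module UNIV N" and a: "\<And>j. j \<le> D \<Longrightarrow> a j \<in> first_order UNIV N" and y: "y \<in> Os"
    and rel: "(\<lambda>x. \<Sum>j\<le>D. a j x * y x ^ j) \<in> mp 2"
    and der: "(\<Sum>j\<le>D. of_nat j * a j e * y e ^ (j - 1)) \<noteq> 0"
  shows "y \<in> first_order UNIV N"
proof -
  define d where "d = (\<Sum>j\<le>D. of_nat j * a j e * y e ^ (j - 1))"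
  let ?w = "\<lambda>x. y x - y e"
  let ?A = "\<lambda>j x. a j x - a j e"
  let ?r = "\<lambda>j x. y x ^ j - y e ^ j - of_nat j * y e ^ (j - 1) * ?w x"
  let ?u = "\<lambda>j x. of_nat j * y e ^ (j - 1) * ?w x"
  have a': "a j \<in> Os" "?A j \<in> N" if "j \<le> D" for j using a[OF that] by (auto simp: first_order_def)
  have r0: "(\<Sum>j\<le>D. a j e * y e ^ j) = 0" using rel mp_2_sub by (auto simp: maxid_def)
  have w: "?w \<in> maxid" by (rule sub_value[OF y])
  \<comment> \<open>All second-order terms: Taylor remainders of the powers and products of two
    differentials.\<close>
  have q: "(\<Sum>j\<le>D. a j * ?r j + ?A j * ?u j) \<in> mp 2"
    using a' y w by (intro mp_sum mp_add mp_scale power_first_order maxid_mult sub_value maxid_cscale) auto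
  have s: "(\<lambda>x. \<Sum>j\<in>I. y e ^ j * ?A j x) \<in> N" if "I \<subseteq> {..D}" for I
  proof -
    have "finite I" using that finite_subset by blast
    then show ?thesis using that
    proof (induction rule: finite_induct)
      case empty
      then show ?case using germ_moduleD(1)[OF N mp_zero] by (simp add: zero_fun_def)
    next
      case (insert j I)
      have "(\<lambda>x. y e ^ j * ?A j x + (\<Sum>j\<in>I. y e ^ j * ?A j x)) \<in> N"
        using insert a' by (intro germ_moduleD(2,3)[OF N]) (auto intro: germ_moduleD(1)[OF N])
      then show ?case using insert by simp
    qed
  qed
  have "d * ?w x = (\<Sum>j\<le>D. a j x * y x ^ j) + (- 1) * ((\<Sum>j\<le>D. y e ^ j * ?A j x)
      + (\<Sum>j\<le>D. a j * ?r j + ?A j * ?u j) x)" for x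
  proof -
    have "(\<Sum>j\<le>D. a j x * y x ^ j) = (\<Sum>j\<le>D. a j e * y e ^ j + y e ^ j * ?A j x
        + of_nat j * a j e * y e ^ (j - 1) * ?w x + (a j x * ?r j x + ?A j x * ?u j x))"
      by (intro sum.cong) (simp_all add: algebra_simps)
    also have "\<dots> = (\<Sum>j\<le>D. y e ^ j * ?A j x) + d * ?w x + (\<Sum>j\<le>D. a j * ?r j + ?A j * ?u j) x"
      by (simp add: sum.distrib r0 d_def sum_distrib_right sum_fun_apply)
    finally show ?thesis by simp
  qed
  moreover have "(\<lambda>x. (\<Sum>j\<le>D. a j x * y x ^ j) + (- 1) * ((\<Sum>j\<le>D. y e ^ j * ?A j x)
      + (\<Sum>j\<le>D. a j * ?r j + ?A j * ?u j) x)) \<in> N"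
    using rel s[of "{..D}"] q by (intro germ_moduleD(2,3)[OF N] UNIV_I) (auto intro: germ_moduleD(1)[OF N])
  ultimately have "(\<lambda>x. d * ?w x) \<in> N" by presburger
  from germ_moduleD(3)[OF N UNIV_I[of "inverse d"] this]
  have "(\<lambda>x. inverse d * d * ?w x) \<in> N" by (simp only: mult.assoc)
  moreover have "inverse d * d = 1" using der by (simp add: d_def)
  ultimately have "?w \<in> N" by simp
  then show ?thesis using y by (simp add: first_order_def)
qed

end

section \<open>The local ring of a projective set at a point\<close>

lemma local_ring_germs: "function_germs (local_ring V P)"
  by unfold_locales (auto intro: local_ring_subring local_ring_const)

lemma local_ring_zero:
  assumes "B \<in> hform UNIV d" "B (rep P) \<noteq> 0" "\<And>Q. Q \<in> V \<Longrightarrow> B (rep Q) \<noteq> 0 \<Longrightarrow> z Q = 0"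
  shows "z \<in> local_ring V P"
  by (rule local_ringI[of "\<lambda>_. 0" d B]) (use assms in \<open>auto intro: hform_zero subring_UNIV\<close>)

lemma nonvanishing_form:
  assumes "v \<in> local_ring V P" "P \<in> V" "v P \<noteq> 0"
  shows "\<exists>d. \<exists>B\<in>hform UNIV d. B (rep P) \<noteq> 0 \<and> (\<forall>Q\<in>V. B (rep Q) \<noteq> 0 \<longrightarrow> v Q \<noteq> 0)"
proof -
  obtain d F G where F: "F \<in> hform UNIV d" "G \<in> hform UNIV d" "G (rep P) \<noteq> 0"
    "\<And>Q. Q \<in> V \<Longrightarrow> G (rep Q) \<noteq> 0 \<Longrightarrow> v Q = F (rep Q) / G (rep Q)"
    using assms(1) by (rule local_ringE) metis
  have "F (rep P) \<noteq> 0" using F(3,4) assms by auto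
  moreover have "(\<lambda>x. F x * G x) \<in> hform UNIV (d + d)" by (intro hform_mult subring_UNIV F)
  ultimately show ?thesis
    using F by (intro exI[of _ "d + d"] bexI[of _ "\<lambda>x. F x * G x"]) auto
qed

text \<open>Since division by zero gives 0, \<open>B / B\<close> is the indicator of the set where
  \<open>B\<close> is nonzero, and it is regular at the image of \<open>P\<close>. Its pullback is
  regular at \<open>P\<close>, and \<open>nonvanishing_form\<close> applies to it.\<close>

lemma pullback_nonvanishing:
  assumes \<psi>: "regular_map_at UNIV V P \<psi>" "P \<in> V" and B: "B \<in> hform UNIV d" "B (rep (\<psi> P)) \<noteq> 0"
  shows "\<exists>e. \<exists>B'\<in>hform UNIV e. B' (rep P) \<noteq> 0 \<and> (\<forall>Q\<in>V. B' (rep Q) \<noteq> 0 \<longrightarrow> B (rep (\<psi> Q)) \<noteq> 0)"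
proof -
  have "(\<lambda>Q. B (rep Q) / B (rep Q)) \<in> local_ring UNIV (\<psi> P)"
    by (rule local_ring_quotient[OF B(1) B(1) B(2)])
  from regular_comp[OF \<psi>(1) this _ \<psi>(2)]
  have "(\<lambda>Q. B (rep (\<psi> Q)) / B (rep (\<psi> Q))) \<in> local_ring V P" by simp
  from nonvanishing_form[OF this \<psi>(2)] obtain e B' where B': "B' \<in> hform UNIV e" "B' (rep P) \<noteq> 0"
    "\<And>Q. Q \<in> V \<Longrightarrow> B' (rep Q) \<noteq> 0 \<Longrightarrow> B (rep (\<psi> Q)) / B (rep (\<psi> Q)) \<noteq> 0"
    using B(2) by auto
  have "B (rep (\<psi> Q)) \<noteq> 0" if "Q \<in> V" "B' (rep Q) \<noteq> 0" for Q
    using B'(3)[OF that] by auto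
  then show ?thesis using B'(1,2) by blast
qed

abbreviation germ_max :: "('i::finite, 'a::field_char_0) proj set \<Rightarrow> ('i, 'a) proj \<Rightarrow> (('i, 'a) proj \<Rightarrow> 'a) set" where
  "germ_max V P \<equiv> function_germs.maxid (local_ring V P) P"

abbreviation germ_pow where
  "germ_pow V P k \<equiv> mpow (local_ring V P) (germ_max V P) k"

text \<open>With \<open>u\<close> the indicator of \<open>z \<noteq> 0\<close> one has
  \<open>z = u * z\<close>, and \<open>u\<close> lies in the maximal ideal because it vanishes near
  \<open>e\<close> and at \<open>e\<close>. Iterating puts \<open>z\<close> into every
  power.\<close>

lemma germ_zero_mp:
  assumes B: "B \<in> hform UNIV d" "B (rep e) \<noteq> 0" "\<And>Q. Q \<in> V \<Longrightarrow> B (rep Q) \<noteq> 0 \<Longrightarrow> z Q = 0" and "z e = 0"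
  shows "z \<in> germ_pow V e k"
proof (induction k)
  case 0
  then show ?case using local_ring_zero[OF B(1-3)] by simp
next
  case (Suc k)
  interpret function_germs "local_ring V e" e by (rule local_ring_germs)
  define u where "u Q = (if z Q = 0 then 0 else 1 :: 'b)" for Q
  have "u \<in> maxid"
    using local_ring_zero[OF B(1,2), of V u] B(3) \<open>z e = 0\<close> by (auto simp: maxid_def u_def)
  then have "u * z \<in> mp (Suc k)" using Suc by (auto intro: ispan_base)
  moreover have "u * z = z" by (auto simp: fun_eq_iff u_def)
  ultimately show ?case by simp
qed

section \<open>Krull's theorem for germs\<close>

text \<open>The local ring is replaced by the finitely generated ring \<open>B\<close> of polynomial
  functions on an affine chart of \<open>A\<close>. After clearing denominators,
  \<open>b = s0 * g\<close> lies in every power of the ideal at \<open>e\<close>, so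
  \<open>b = w * b\<close> with \<open>w\<close> vanishing at \<open>e\<close>; on the chart
  \<open>g\<close> is then 0 wherever \<open>s0 * (1 - w)\<close> is not.\<close>

lemma local_krull:
  fixes A :: "('i::finite, 'a::field_char_0) proj set"
  assumes e: "e \<in> A" and AX: "A \<subseteq> V"
    and g: "\<And>k. \<exists>h\<in>germ_pow V e k. \<forall>Q\<in>A. g Q = h Q"
  shows "\<exists>d. \<exists>B\<in>hform UNIV d. B (rep e) \<noteq> 0 \<and> (\<forall>Q\<in>A. B (rep Q) \<noteq> 0 \<longrightarrow> g Q = 0)"
proof -
  interpret function_germs "local_ring V e" e by (rule local_ring_germs)
  obtain l where l: "rep e l \<noteq> 0" using rep_nonzero[of e] by blast
  define Al where "Al = {Q\<in>A. rep Q l \<noteq> 0}"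
  have eAl: "e \<in> Al" using e l by (simp add: Al_def)
  \<comment> \<open>Off the affine chart every polynomial in \<open>t\<close> takes its value at \<open>e\<close>, so such polynomials are
    determined by their values on \<open>Al\<close>.\<close>
  define t where "t i Q = (if Q \<in> Al then rep Q i / rep Q l - rep e i / rep e l else 0)" for i Q
  define c :: "'a \<Rightarrow> ('i, 'a) proj \<Rightarrow> 'a" where "c a = (\<lambda>_. a)" for a
  define B where "B = ring_gen (range c) (range t)"
  define m where "m = ispan B (range t)"
  have c: "c 1 = 1" "c (x * y) = c x * c y" "c (x - y) = c x - c y" for x y
    by (auto simp: c_def fun_eq_iff)
  have cs: "is_subring (range c)"
    unfolding is_subring_def using c(1) by (auto simp flip: c(2,3) intro: range_eqI[of _ c 1])
  have B: "is_subring B" unfolding B_def by (rule ring_gen_subring[OF cs])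
  have cB: "c a \<in> B" for a unfolding B_def by (auto intro: ring_gen.base)
  have tB: "t i \<in> B" for i unfolding B_def by (auto intro: ring_gen.gen)
  have te: "t i e = 0" for i by (simp add: t_def)
  have mB: "m \<subseteq> B"
    unfolding m_def using tB B by (auto elim!: ispan_subset intro: subring_zero subring_add subring_mult)
  have m_scale: "x * y \<in> m" if "x \<in> B" "y \<in> m" for x y
    using that B unfolding m_def by (auto intro: ispan_scale subring_mult)
  note pow_add = mpow_add[OF B, of _ m]
  have pow_scale: "x * y \<in> mpow B m k" if "x \<in> B" "y \<in> mpow B m k" for x y k
    using that m_scale by (intro mpow_scale B)
  have off: "f Q = f e" if "f \<in> B" "Q \<notin> Al" for f Q
    using that(1) unfolding B_def
  proof induction
    case (gen x)
    then show ?case using that(2) by (auto simp: te) (simp add: t_def)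
  qed (auto simp: c_def)
  have ext: "f = f'" if "f \<in> B" "f' \<in> B" "\<And>Q. Q \<in> Al \<Longrightarrow> f Q = f' Q" for f f'
    using off[OF that(1)] off[OF that(2)] that(3) eAl by (metis ext)
  have mmem: "f \<in> m" if "f \<in> B" "f e = 0" for f
  proof -
    have "f - c (f e) \<in> m"
      using that(1) unfolding B_def
    proof (induction)
      case (base x)
      then have "x - c (x e) = 0" by (auto simp: c_def fun_eq_iff)
      then show ?case unfolding m_def by (metis ispan.zero)
    next
      case (gen x)
      then have "x e = 0" "x \<in> m" using te B by (auto simp: m_def intro: ispan_incl)
      then show ?case by (simp add: c_def fun_diff_def)
    next
      case (diff x y)
      have "x - y - c ((x - y) e) = (x - c (x e)) - (y - c (y e))" by (simp add: c_def fun_eq_iff)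
      moreover have "(x - c (x e)) - (y - c (y e)) \<in> m"
        using diff.IH unfolding m_def by (rule ispan_diff[OF B])
      ultimately show ?case by (simp only:)
    next
      case (mult x y)
      have "x * y - c ((x * y) e) = x * (y - c (y e)) + c (y e) * (x - c (x e))"
        by (simp add: c_def fun_eq_iff algebra_simps)
      moreover have "x * (y - c (y e)) \<in> m" "c (y e) * (x - c (x e)) \<in> m"
        using mult.hyps m_scale[OF _ mult.IH(2)] m_scale[OF cB mult.IH(1)] by (simp_all only: B_def)
      ultimately show ?case unfolding m_def by (metis ispan_add)
    qed
    then show ?thesis using that(2) by (simp add: c_def fun_diff_def)
  qed
  have deh: "\<exists>f\<in>B. \<forall>Q\<in>Al. f Q = F (rep Q) / rep Q l ^ d" if "F \<in> hform UNIV d" for F d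
  proof -
    define u where "u Q = (if Q \<in> Al then rep Q else rep e)" for Q
    have "(\<lambda>Q. u Q i / u Q l) = t i + c (rep e i / rep e l)" for i
      by (simp add: fun_eq_iff u_def t_def c_def)
    then have "(\<lambda>Q. u Q i / u Q l) \<in> B" for i using subring_add[OF B tB cB] by simp
    from dehomogenized_form[where u = u, OF B this _ that] show ?thesis
      using cB unfolding c_def by (intro bexI[of _ "\<lambda>Q. F (u Q) / u Q l ^ d"]) (auto simp: u_def)
  qed
  have clear0: "\<exists>s\<in>B. s e \<noteq> 0 \<and> (\<exists>h'\<in>B. \<forall>Q\<in>Al. s Q * h Q = h' Q)"
    if hO: "h \<in> local_ring V e" for h
  proof -
    obtain d F G where F: "F \<in> hform UNIV d" "G \<in> hform UNIV d" "G (rep e) \<noteq> 0"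
      "\<And>Q. Q \<in> V \<Longrightarrow> G (rep Q) \<noteq> 0 \<Longrightarrow> h Q = F (rep Q) / G (rep Q)"
      using hO by (rule local_ringE) metis
    obtain f f' where f: "f \<in> B" "\<forall>Q\<in>Al. f Q = F (rep Q) / rep Q l ^ d"
      and f': "f' \<in> B" "\<forall>Q\<in>Al. f' Q = G (rep Q) / rep Q l ^ d"
      using deh[OF F(1)] deh[OF F(2)] by blast
    \<comment> \<open>Where the denominator \<open>G\<close> vanishes the value of \<open>h\<close>
      is unknown; the second factor \<open>f'\<close> makes both sides 0 there.\<close>
    have "(f' * f') Q * h Q = (f' * f) Q" if "Q \<in> Al" for Q
      using F(4)[of Q] that f(2) f'(2) AX by (cases "G (rep Q) = 0") (auto simp: Al_def)
    moreover have "(f' * f') e \<noteq> 0" using f'(2) eAl F(3) l by simp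
    ultimately show ?thesis
      using f(1) f'(1) by (intro bexI[of _ "f' * f'"] conjI bexI[of _ "f' * f"] subring_mult[OF B]) auto
  qed
  have clear: "\<exists>s\<in>B. s e \<noteq> 0 \<and> (\<exists>h'\<in>mpow B m k. \<forall>Q\<in>Al. s Q * h Q = h' Q)"
    if "h \<in> mp k" for h k
    using that
  proof (induction k arbitrary: h)
    case 0
    then show ?case using clear0 by simp
  next
    case (Suc k)
    then have "h \<in> ispan maxid (mp k)" by simp
    then show ?case
    proof induction
      case zero
      show ?case
        using mpow_zero[OF B, of m "Suc k"] subring_one[OF B] by (intro bexI[of _ 1]) (auto intro: bexI[of _ 0] simp del: mpow.simps)
    next
      case (step r x y)
      obtain s1 r' where 1: "s1 \<in> B" "s1 e \<noteq> 0" "r' \<in> B" "\<And>Q. Q \<in> Al \<Longrightarrow> s1 Q * r Q = r' Q"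
        using clear0[of r] step(1) by (auto simp: maxid_def)
      obtain s2 x' where 2: "s2 \<in> B" "s2 e \<noteq> 0" "x' \<in> mpow B m k" "\<And>Q. Q \<in> Al \<Longrightarrow> s2 Q * x Q = x' Q"
        using Suc.IH[OF step(2)] by auto
      obtain s3 y' where 3: "s3 \<in> B" "s3 e \<noteq> 0" "y' \<in> mpow B m (Suc k)" "\<And>Q. Q \<in> Al \<Longrightarrow> s3 Q * y Q = y' Q"
        using step.IH by auto
      have "r' e = 0" using 1(4)[OF eAl] step(1) by (simp add: maxid_def)
      then have "r' \<in> m" using mmem 1(3) by blast
      then have rx: "r' * x' \<in> mpow B m (Suc k)" using 2(3) by (auto intro: ispan_base)
      have "s3 * (r' * x') + (s1 * s2) * y' \<in> mpow B m (Suc k)"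
        by (rule pow_add[OF pow_scale[OF 3(1) rx] pow_scale[OF subring_mult[OF B 1(1) 2(1)] 3(3)]])
      moreover have "(s1 * s2 * s3) Q * (r * x + y) Q = (s3 * (r' * x') + (s1 * s2) * y') Q" if "Q \<in> Al" for Q
        using 1(4)[OF that] 2(4)[OF that] 3(4)[OF that]
        by (simp add: algebra_simps flip: 1(4)[OF that] 2(4)[OF that] 3(4)[OF that])
      moreover have "s1 * s2 * s3 \<in> B" "(s1 * s2 * s3) e \<noteq> 0"
        using 1 2 3 by (auto intro: subring_mult[OF B])
      ultimately show ?case by blast
    qed
  qed
  obtain h0 where h0: "h0 \<in> local_ring V e" "\<forall>Q\<in>A. g Q = h0 Q" using g[of 0] by auto
  obtain s0 b where s0: "s0 \<in> B" "s0 e \<noteq> 0" "b \<in> B" "\<And>Q. Q \<in> Al \<Longrightarrow> s0 Q * g Q = b Q"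
    using clear0[OF h0(1)] h0(2) by (auto simp: Al_def)
  have b_pow: "b \<in> mpow B m k" for k
  proof -
    obtain h where h: "h \<in> mp k" "\<forall>Q\<in>A. g Q = h Q" using g by blast
    obtain s h' where s: "s \<in> B" "s e \<noteq> 0" "h' \<in> mpow B m k" "\<And>Q. Q \<in> Al \<Longrightarrow> s Q * h Q = h' Q"
      using clear[OF h(1)] by blast
    have powB: "mpow B m k \<subseteq> B" for k
    proof (induction k)
      case (Suc k)
      then show ?case
        using mB B by (auto elim!: ispan_subset intro: subring_zero subring_add subring_mult)
    qed simp
    have sb: "s * b = s0 * h'"
    proof (rule ext)
      show "s * b \<in> B" "s0 * h' \<in> B" using s s0 subsetD[OF powB s(3)] by (auto intro: subring_mult[OF B])
      show "(s * b) Q = (s0 * h') Q" if "Q \<in> Al" for Q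
        using s(4)[OF that] s0(4)[OF that] h(2) that
        by (simp add: Al_def flip: s(4)[OF that] s0(4)[OF that])
    qed
    \<comment> \<open>\<open>s\<close> acts as a unit near \<open>e\<close>:
      \<open>u = 1 - s / s(e)\<close> lies in \<open>m\<close> and \<open>b - u * b\<close> in the
      \<open>k\<close>-th power, so \<open>b\<close> moves up one power at a time. This takes the
      place of localizing.\<close>
    define u where "u = 1 - c (inverse (s e)) * s"
    have uB: "u \<in> B" unfolding u_def using s by (intro subring_diff[OF B] subring_one[OF B] subring_mult[OF B] cB)
    then have um: "u \<in> m" using s(2) by (intro mmem) (auto simp: u_def c_def)
    have "b - u * b = c (inverse (s e)) * (s0 * h')"
      unfolding sb[symmetric] by (simp add: u_def algebra_simps)
    then have ub: "b - u * b \<in> mpow B m k" using s s0 cB by (auto intro: pow_scale)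
    have mono: "mpow B m (Suc j) \<subseteq> mpow B m j" for j
    proof
      fix x assume "x \<in> mpow B m (Suc j)"
      then have "x \<in> ispan m (mpow B m j)" by simp
      then show "x \<in> mpow B m j"
        by (rule ispan_subset) (use mB in \<open>auto intro: mpow_zero[OF B] pow_add pow_scale\<close>)
    qed
    have ub': "b - u * b \<in> mpow B m j" if "j \<le> k" for j
      using lift_Suc_antimono_le[of "mpow B m", OF _ that] mono ub by blast
    have "j \<le> k \<Longrightarrow> b \<in> mpow B m j" for j
    proof (induction j)
      case (Suc j)
      then have "u * b \<in> mpow B m (Suc j)" using um by (auto intro: ispan_base)
      from pow_add[OF ub'[OF Suc.prems] this] show ?case by simp
    qed (simp add: s0)
    then show ?thesis by simp
  qed
  obtain w where w: "w \<in> m" "b = w * b"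
    using krull_intersection[of c "range t" b] c b_pow unfolding B_def m_def by auto
  have BA: "B \<subseteq> local_ring A e"
    unfolding B_def
  proof (rule ring_gen_least[OF local_ring_subring])
    show "range c \<subseteq> local_ring A e" by (auto simp: c_def local_ring_const)
    have "t i \<in> local_ring A e" for i
    proof (rule local_ringI)
      show "(\<lambda>x. x i * rep e l - rep e i * x l) \<in> hform UNIV (1 + 0)"
        using hform_mult[OF subring_UNIV hform_coord[OF subring_UNIV] hform_const[OF subring_UNIV, of "rep e l"], of i]
          hform_scale[OF subring_UNIV _ hform_coord[OF subring_UNIV], of "rep e i" l]
        by (intro hform_diff subring_UNIV) auto
      show "(\<lambda>x. rep e l * x l) \<in> hform UNIV (1 + 0)"
        using hform_scale[OF subring_UNIV _ hform_coord[OF subring_UNIV], of "rep e l" l] by simp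
      show "t i Q = (rep Q i * rep e l - rep e i * rep Q l) / (rep e l * rep Q l)"
        if "Q \<in> A" "rep e l * rep Q l \<noteq> 0" for Q
        using that by (simp add: t_def Al_def field_simps)
    qed (use l in auto)
    then show "range t \<subseteq> local_ring A e" by auto
  qed
  define v where "v = s0 * (1 - w)"
  have wB: "w \<in> B" using w mB by blast
  have "v \<in> B" unfolding v_def using wB s0 by (intro subring_mult[OF B] subring_diff[OF B] subring_one[OF B])
  then have vA: "v \<in> local_ring A e" using BA by blast
  have "w e = 0"
    using w(1) unfolding m_def by (induction rule: ispan.induct) (auto simp: te)
  then have "v e \<noteq> 0" using s0(2) by (simp add: v_def)
  from nonvanishing_form[OF vA e this] obtain d G where G: "G \<in> hform UNIV d" "G (rep e) \<noteq> 0"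
    "\<And>Q. Q \<in> A \<Longrightarrow> G (rep Q) \<noteq> 0 \<Longrightarrow> v Q \<noteq> 0" by blast
  show ?thesis
  proof (intro exI bexI conjI ballI impI)
    show "(\<lambda>x. G x * x l) \<in> hform UNIV (d + 1)"
      by (intro hform_mult subring_UNIV G hform_coord)
    show "G (rep e) * rep e l \<noteq> 0" using G l by simp
    fix Q assume Q: "Q \<in> A" "G (rep Q) * rep Q l \<noteq> 0"
    then have "Q \<in> Al" "v Q \<noteq> 0" using G by (auto simp: Al_def)
    moreover have "b Q = w Q * b Q" using fun_cong[OF w(2), of Q] by simp
    ultimately show "g Q = 0" using s0(4)[of Q] by (auto simp: v_def)
  qed
qed

section \<open>Unramifiedness: algebraic relations from counting forms, and the cotangent
  map\<close>

section \<open>Counting independent forms\<close>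

lemma finite_exponents: "finite {m :: 'i::finite \<Rightarrow> nat. sum m UNIV = N}"
  and card_exponents: "card {m :: 'i::finite \<Rightarrow> nat. sum m UNIV = N} \<le> Suc N ^ card (UNIV :: 'i set)"
proof -
  have sub: "{m :: 'i \<Rightarrow> nat. sum m UNIV = N} \<subseteq> PiE UNIV (\<lambda>_. {..N})"
  proof
    fix m :: "'i \<Rightarrow> nat" assume "m \<in> {m. sum m UNIV = N}"
    then have "m i \<le> N" for i using member_le_sum[of i UNIV m] by auto
    then show "m \<in> PiE UNIV (\<lambda>_. {..N})" by auto
  qed
  have fin: "finite (PiE (UNIV :: 'i set) (\<lambda>_. {..N}))" by (intro finite_PiE) auto
  show "finite {m :: 'i \<Rightarrow> nat. sum m UNIV = N}" using finite_subset[OF sub fin] .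
  have "card (PiE (UNIV :: 'i set) (\<lambda>_. {..N})) = Suc N ^ card (UNIV :: 'i set)" by (simp add: card_PiE)
  then show "card {m :: 'i \<Rightarrow> nat. sum m UNIV = N} \<le> Suc N ^ card (UNIV :: 'i set)"
    using card_mono[OF fin sub] by simp
qed

lemma hform_expansion:
  assumes "f \<in> hform C N"
  shows "\<exists>a. \<forall>x. f x = (\<Sum>m\<in>{m. sum m UNIV = N}. a m * mon m x)"
  using assms
proof (induction rule: hform_induct)
  case zero
  show ?case by (rule exI[of _ "\<lambda>_. 0"]) simp
next
  case (add c m g)
  then obtain a where a: "\<And>x. g x = (\<Sum>m\<in>{m. sum m UNIV = N}. a m * mon m x)" by blast
  have "c * mon m x + g x = (\<Sum>k\<in>{m. sum m UNIV = N}. (a k + (if k = m then c else 0)) * mon k x)" for x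
  proof -
    have "(\<Sum>k\<in>{m. sum m UNIV = N}. (if k = m then c else 0) * mon k x) = c * mon m x"
      using add(2) by (simp add: finite_exponents if_distrib[of "\<lambda>z. z * _"] cong: if_cong)
    then show ?thesis by (simp add: a distrib_right sum.distrib)
  qed
  then show ?case by (intro exI[of _ "\<lambda>k. a k + (if k = m then c else 0)"]) blast
qed

text \<open>\<open>r\<close> is a lower bound for the Hilbert function of \<open>V\<close> in degree
  \<open>N\<close>, the substitute for dimension.\<close>

definition indep_forms :: "('i::finite, 'a::field) proj set \<Rightarrow> nat \<Rightarrow> nat \<Rightarrow> bool" where
  "indep_forms V N r \<longleftrightarrow> (\<exists>b :: nat \<Rightarrow> ('i \<Rightarrow> 'a) \<Rightarrow> 'a. (\<forall>k<r. b k \<in> hform UNIV N) \<and>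
     (\<forall>c. (\<forall>Q\<in>V. (\<Sum>k<r. c k * b k (rep Q)) = 0) \<longrightarrow> (\<forall>k<r. c k = 0)))"

lemma indep_forms_bound:
  fixes V :: "('i::finite, 'a::field) proj set"
  assumes "indep_forms V N r"
  shows "r \<le> Suc N ^ card (UNIV :: 'i set)"
proof (rule ccontr)
  assume r: "\<not> r \<le> Suc N ^ card (UNIV :: 'i set)"
  let ?M = "{m :: 'i \<Rightarrow> nat. sum m UNIV = N}"
  obtain b :: "nat \<Rightarrow> ('i \<Rightarrow> 'a) \<Rightarrow> 'a" where b: "\<And>k. k < r \<Longrightarrow> b k \<in> hform UNIV N"
    "\<And>c. (\<forall>Q\<in>V. (\<Sum>k<r. c k * b k (rep Q)) = 0) \<Longrightarrow> \<forall>k<r. c k = 0"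
    using assms unfolding indep_forms_def by blast
  have "\<forall>k. \<exists>a. k < r \<longrightarrow> (\<forall>x. b k x = (\<Sum>m\<in>?M. a m * mon m x))"
    using hform_expansion[OF b(1)] by blast
  from choice[OF this] obtain a where a: "\<And>k x. k < r \<Longrightarrow> b k x = (\<Sum>m\<in>?M. a k m * mon m x)"
    by blast
  obtain g where g: "bij_betw g {0..<card ?M} ?M" using ex_bij_betw_nat_finite[OF finite_exponents] by blast
  have "card ?M < card {..<r}" using r card_exponents[of N, where ?'i = 'i] by simp
  then obtain c where c: "\<exists>k\<in>{..<r}. c k \<noteq> 0" "\<And>i. i < card ?M \<Longrightarrow> (\<Sum>k<r. c k * a k (g i)) = 0"
    using linear_dependence[of "{..<r}" "card ?M" "\<lambda>i k. a k (g i)"] by auto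
  have c': "(\<Sum>k<r. c k * a k m) = 0" if "m \<in> ?M" for m
  proof -
    have "m \<in> g ` {0..<card ?M}" using g that by (simp add: bij_betw_def)
    then obtain i where "i < card ?M" "m = g i" by auto
    then show ?thesis using c(2) by simp
  qed
  have "(\<Sum>k<r. c k * b k x) = 0" for x
  proof -
    have "(\<Sum>k<r. c k * b k x) = (\<Sum>k<r. \<Sum>m\<in>?M. c k * a k m * mon m x)"
      by (intro sum.cong) (auto simp: a sum_distrib_left mult.assoc)
    also have "\<dots> = (\<Sum>m\<in>?M. (\<Sum>k<r. c k * a k m) * mon m x)"
      by (subst sum.swap) (simp add: sum_distrib_right)
    also have "\<dots> = 0" by (intro sum.neutral ballI) (simp only: c' mult_zero_left)
    finally show ?thesis .
  qed
  then show False using b(2)[of c] c(1) by auto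
qed

text \<open>If no relation as below existed, composing with \<open>E\<close> and multiplying by the monomials
  \<open>x\<^sub>i\<^sup>j x\<^sub>l\<^sup>N\<^sup>-\<^sup>j\<close> would multiply the number of independent forms by \<open>N + 1\<close> while the degree
  only grows by a constant factor; iterating contradicts the polynomial bound.\<close>

lemma algebraic_relation:
  fixes V :: "('i::finite, 'a::field) proj set"
  assumes E: "\<And>j. E j \<in> hform UNIV \<delta>" and l: "P0 \<in> V" "rep P0 l \<noteq> 0"
  shows "\<exists>N\<ge>1. \<exists>b :: nat \<Rightarrow> ('i \<Rightarrow> 'a) \<Rightarrow> 'a. (\<forall>j\<le>N. b j \<in> hform UNIV N) \<and>
    (\<exists>j\<le>N. \<exists>Q\<in>V. b j (rep Q) \<noteq> 0) \<and>
    (\<forall>Q\<in>V. (\<Sum>j\<le>N. b j (\<lambda>m. E m (rep Q)) * (rep Q i ^ j * rep Q l ^ (N - j))) = 0)"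
proof (rule ccontr)
  assume "\<not> ?thesis"
  then have none: "b j (rep Q) = 0"
    if "N \<ge> 1" "\<And>j. j \<le> N \<Longrightarrow> b j \<in> hform UNIV N"
      "\<And>Q. Q \<in> V \<Longrightarrow> (\<Sum>j\<le>N. b j (\<lambda>m. E m (rep Q)) * (rep Q i ^ j * rep Q l ^ (N - j))) = 0" "j \<le> N" "Q \<in> V"
    for N and b :: "nat \<Rightarrow> ('i \<Rightarrow> 'a) \<Rightarrow> 'a" and j Q
    using that by blast
  note U = subring_UNIV
  have step: "indep_forms V (\<delta> * N + N) (Suc N * r)" if ind: "indep_forms V N r" and N: "N \<ge> 1" for N r
  proof -
    obtain b :: "nat \<Rightarrow> ('i \<Rightarrow> 'a) \<Rightarrow> 'a" where b: "\<And>k. k < r \<Longrightarrow> b k \<in> hform UNIV N"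
      "\<And>c. (\<forall>Q\<in>V. (\<Sum>k<r. c k * b k (rep Q)) = 0) \<Longrightarrow> \<forall>k<r. c k = 0"
      using ind unfolding indep_forms_def by blast
    \<comment> \<open>\<open>k\<close> encodes a pair: the number \<open>k mod r\<close> of a form
      and the exponent \<open>k div r\<close> of \<open>x i\<close>.\<close>
    define b' where "b' k x = b (k mod r) (\<lambda>m. E m x) * (x i ^ (k div r) * x l ^ (N - k div r))" for k x
    have b'h: "b' k \<in> hform UNIV (\<delta> * N + N)" if "k < Suc N * r" for k
    proof -
      have "k div r < Suc N" using that by (metis less_mult_imp_div_less)
      moreover have "0 < r" using that by (cases r) auto
      then have "k mod r < r" by simp
      ultimately have "(\<lambda>x. b (k mod r) (\<lambda>m. E m x)) \<in> hform UNIV (\<delta> * N)"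
        by (intro hform_comp[OF U b(1) E])
      moreover have "(\<lambda>x. x i ^ (k div r) * x l ^ (N - k div r)) \<in> hform UNIV (1 * (k div r) + 1 * (N - k div r))"
        by (intro hform_mult hform_power hform_coord U)
      moreover have "1 * (k div r) + 1 * (N - k div r) = N" using \<open>k div r < Suc N\<close> by simp
      ultimately show ?thesis
        unfolding b'_def using hform_mult[OF U, of "\<lambda>x. b (k mod r) (\<lambda>m. E m x)"] by simp
    qed
    have "\<forall>k<Suc N * r. c k = 0" if c: "\<forall>Q\<in>V. (\<Sum>k<Suc N * r. c k * b' k (rep Q)) = 0" for c
    proof -
      define B where "B j x = (\<Sum>k<r. c (k + j * r) * b k x)" for j x
      have Bh: "B j \<in> hform UNIV N" for j
        unfolding B_def by (intro hform_sum hform_scale U b) auto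
      have sumB: "(\<Sum>k<Suc N * r. c k * b' k x) = (\<Sum>j\<le>N. B j (\<lambda>m. E m x) * (x i ^ j * x l ^ (N - j)))" for x
      proof -
        let ?f = "\<lambda>k. c k * b' k x"
        have "(\<Sum>k<Suc N * r. ?f k) = (\<Sum>j<Suc N. sum ?f {j * r..<j * r + r})"
          by (rule sum.nat_group[symmetric])
        also have "\<dots> = (\<Sum>j<Suc N. B j (\<lambda>m. E m x) * (x i ^ j * x l ^ (N - j)))"
        proof (rule sum.cong)
          fix j
          have "sum ?f {j * r..<j * r + r} = (\<Sum>k=0..<r. ?f (k + j * r))"
            using sum.shift_bounds_nat_ivl[of ?f 0 "j * r" r] by (simp add: add.commute)
          also have "\<dots> = (\<Sum>k<r. c (k + j * r) * b k (\<lambda>m. E m x) * (x i ^ j * x l ^ (N - j)))"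
            by (auto simp: atLeast0LessThan b'_def mult.assoc intro!: sum.cong)
          finally show "sum ?f {j * r..<j * r + r} = B j (\<lambda>m. E m x) * (x i ^ j * x l ^ (N - j))"
            by (simp add: B_def sum_distrib_right)
        qed simp
        finally show ?thesis by (simp only: lessThan_Suc_atMost)
      qed
      have B0: "B j (rep Q) = 0" if "j \<le> N" "Q \<in> V" for j Q
      proof (rule none[OF N Bh _ that])
        fix Q assume "Q \<in> V"
        then show "(\<Sum>j\<le>N. B j (\<lambda>m. E m (rep Q)) * (rep Q i ^ j * rep Q l ^ (N - j))) = 0"
          using c unfolding sumB by blast
      qed
      show ?thesis
      proof (intro allI impI)
        fix k assume k: "k < Suc N * r"
        then have r: "0 < r" by (cases r) auto
        have kd: "k div r \<le> N" using k by (metis less_Suc_eq_le less_mult_imp_div_less)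
        have "\<forall>Q\<in>V. (\<Sum>k'<r. c (k' + (k div r) * r) * b k' (rep Q)) = 0"
          using B0[OF kd] by (simp add: B_def)
        from b(2)[OF this] have "c (k mod r + (k div r) * r) = 0" using r mod_less_divisor by blast
        then show "c k = 0" by simp
      qed
    qed
    then show ?thesis unfolding indep_forms_def using b'h by blast
  qed
  let ?D = "Suc \<delta>" and ?n = "card (UNIV :: 'i set)"
  have base: "indep_forms V N 1" for N
    unfolding indep_forms_def
  proof (intro exI[of _ "\<lambda>_ x. x l ^ N"] conjI allI impI)
    show "(\<lambda>x. x l ^ N) \<in> hform UNIV N" for k :: nat
      using hform_power[OF U hform_coord[OF U], of l N] by simp
    show "c k = 0" if "\<forall>Q\<in>V. (\<Sum>k<1. c k * rep Q l ^ N) = 0" "k < 1" for c :: "nat \<Rightarrow> 'a" and k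
    proof -
      have "(\<Sum>k<1. c k * rep P0 l ^ N) = 0" using that(1) l(1) by blast
      then have "c 0 = 0" using l(2) by (simp add: lessThan_Suc)
      then show ?thesis using that(2) by simp
    qed
  qed
  \<comment> \<open>One step multiplies the degree \<open>N\<close> by \<open>\<delta> + 1\<close>
    and the number of forms by \<open>N + 1\<close>. The starting exponent \<open>Suc ?n\<close>
    makes \<open>N + 1\<close> at least \<open>2 * ?D ^ ?n\<close>, whereas the polynomial bound
    grows by only about \<open>?D ^ ?n\<close> per step.\<close>
  have grow: "\<exists>r \<ge> 2 ^ t * ?D ^ (?n * t). indep_forms V (?D ^ (Suc ?n + t)) r" for t
  proof (induction t)
    case 0
    then show ?case using base by auto
  next
    case (Suc t)
    then obtain r where r: "r \<ge> 2 ^ t * ?D ^ (?n * t)" "indep_forms V (?D ^ (Suc ?n + t)) r" by blast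
    let ?N = "?D ^ (Suc ?n + t)"
    have "indep_forms V (\<delta> * ?N + ?N) (Suc ?N * r)" by (rule step[OF r(2)]) (rule one_le_power, simp)
    moreover have "\<delta> * ?N + ?N = ?D ^ (Suc ?n + Suc t)" by simp
    moreover have "2 ^ Suc t * ?D ^ (?n * Suc t) \<le> Suc ?N * r"
    proof -
      have "2 * ?D ^ ?n \<le> Suc ?N"
      proof (cases "\<delta> = 0")
        case False
        then have "2 * ?D ^ ?n \<le> ?D ^ Suc ?n" by simp
        also have "\<dots> \<le> ?N" by (intro power_increasing) auto
        finally show ?thesis by simp
      qed simp
      then have "(2 * ?D ^ ?n) * (2 ^ t * ?D ^ (?n * t)) \<le> Suc ?N * r" using r(1) by (rule mult_le_mono)
      then show ?thesis by (simp add: power_add mult_ac)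
    qed
    ultimately show ?case by metis
  qed
  \<comment> \<open>\<open>q\<close> is the polynomial bound at \<open>t = 0\<close>; the surplus
    factor \<open>2 ^ t\<close> eventually exceeds it.\<close>
  define q where "q = Suc (?D ^ Suc ?n) ^ ?n"
  obtain t where t: "q < 2 ^ t" by (metis less_exp)
  obtain r where r: "r \<ge> 2 ^ t * ?D ^ (?n * t)" "indep_forms V (?D ^ (Suc ?n + t)) r" using grow by blast
  have "Suc (?D ^ (Suc ?n + t)) \<le> Suc (?D ^ Suc ?n) * ?D ^ t"
  proof -
    have "1 \<le> ?D ^ t" by (rule one_le_power) simp
    then show ?thesis unfolding power_add mult_Suc by linarith
  qed
  then have "Suc (?D ^ (Suc ?n + t)) ^ ?n \<le> (Suc (?D ^ Suc ?n) * ?D ^ t) ^ ?n" by (rule power_mono) simp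
  also have "\<dots> = q * ?D ^ (?n * t)" by (simp only: q_def power_mult_distrib power_mult[symmetric] mult.commute[of t])
  also have "\<dots> < 2 ^ t * ?D ^ (?n * t)" using t by simp
  also have "\<dots> \<le> r" by (rule r)
  also have "\<dots> \<le> Suc (?D ^ (Suc ?n + t)) ^ ?n" by (rule indep_forms_bound[OF r(2)])
  finally show False by simp
qed

text \<open>A relation of least degree in \<open>x i\<close> is taken. Its formal derivative has
  smaller degree and, in characteristic 0, a nonzero top coefficient, so it cannot be a relation
  again. Degree 0 is ruled out by \<open>dom\<close>, as the only coefficient would have to vanish
  on \<open>V\<close>.\<close>

lemma separable_relation:
  fixes V :: "('i::finite, 'a::{alg_closed_field,field_char_0}) proj set"
  assumes V: "irreducible_set V" and E: "\<And>j. E j \<in> hform UNIV \<delta>" and l: "P0 \<in> V" "rep P0 l \<noteq> 0"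
    and EV: "\<And>Q. Q \<in> V \<Longrightarrow> \<exists>j. E j (rep Q) \<noteq> 0 \<Longrightarrow> point (\<lambda>j. E j (rep Q)) \<in> V"
    and dom: "\<And>N b Q. b \<in> hform UNIV N \<Longrightarrow> (\<And>Q. Q \<in> V \<Longrightarrow> b (\<lambda>j. E j (rep Q)) = 0) \<Longrightarrow> Q \<in> V \<Longrightarrow> b (rep Q) = 0"
  shows "\<exists>N D. \<exists>b :: nat \<Rightarrow> ('i \<Rightarrow> 'a) \<Rightarrow> 'a. D \<le> N \<and> (\<forall>j\<le>D. b j \<in> hform UNIV N) \<and>
    (\<forall>Q\<in>V. (\<Sum>j\<le>D. b j (\<lambda>m. E m (rep Q)) * (rep Q i ^ j * rep Q l ^ (N - j))) = 0) \<and>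
    (\<exists>Q\<in>V. (\<Sum>j<D. of_nat (Suc j) * b (Suc j) (\<lambda>m. E m (rep Q)) * (rep Q i ^ j * rep Q l ^ (N - j))) \<noteq> 0)"
proof -
  obtain N b where N: "N \<ge> 1" and b: "\<And>j. j \<le> N \<Longrightarrow> b j \<in> hform UNIV N" "\<exists>j\<le>N. \<exists>Q\<in>V. b j (rep Q) \<noteq> 0"
    "\<And>Q. Q \<in> V \<Longrightarrow> (\<Sum>j\<le>N. b j (\<lambda>m. E m (rep Q)) * (rep Q i ^ j * rep Q l ^ (N - j))) = 0"
    using algebraic_relation[of E \<delta> P0 V l i, OF E l] by blast
  define rel where "rel D b \<longleftrightarrow> D \<le> N \<and> (\<forall>j\<le>D. b j \<in> hform UNIV N) \<and> (\<exists>Q\<in>V. b D (rep Q) \<noteq> 0) \<and>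
    (\<forall>Q\<in>V. (\<Sum>j\<le>D. b j (\<lambda>m. E m (rep Q)) * (rep Q i ^ j * rep Q l ^ (N - j))) = 0)"
    for D and b :: "nat \<Rightarrow> ('i \<Rightarrow> 'a) \<Rightarrow> 'a"
  \<comment> \<open>Converse of \<open>dom\<close>: a form vanishing on \<open>V\<close> still
    vanishes after substituting \<open>E\<close>. Where all \<open>E j\<close> are zero this holds
    because \<open>N \<ge> 1\<close> makes the form 0 at the origin.\<close>
  have vanish: "f (\<lambda>m. E m (rep Q)) = 0"
    if f: "f \<in> hform UNIV N" "\<And>Q. Q \<in> V \<Longrightarrow> f (rep Q) = 0" and Q: "Q \<in> V" for f Q
  proof (cases "\<exists>j. E j (rep Q) \<noteq> 0")
    case True
    then obtain j where j: "E j (rep Q) \<noteq> 0" by blast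
    obtain c where c: "c \<noteq> 0" "rep (point (\<lambda>j. E j (rep Q))) = (\<lambda>i. c * E i (rep Q))"
      using rep_point[of "\<lambda>j. E j (rep Q)", OF j] by blast
    have "f (rep (point (\<lambda>j. E j (rep Q)))) = 0" using f(2) EV[OF Q True] by blast
    then show ?thesis unfolding c(2) hform_homogeneous[OF f(1)] using c(1) by simp
  next
    case False
    then have "(\<lambda>m. E m (rep Q)) = (\<lambda>m. 0 * rep Q m)" by auto
    then show ?thesis using hform_homogeneous[OF f(1), of 0 "rep Q"] N by simp
  qed
  have "\<exists>D b. rel D b"
  proof -
    define D where "D = Max {j. j \<le> N \<and> (\<exists>Q\<in>V. b j (rep Q) \<noteq> 0)}"
    have fin: "finite {j. j \<le> N \<and> (\<exists>Q\<in>V. b j (rep Q) \<noteq> 0)}" by simp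
    have "D \<in> {j. j \<le> N \<and> (\<exists>Q\<in>V. b j (rep Q) \<noteq> 0)}"
      unfolding D_def using b(2) by (intro Max_in[OF fin]) auto
    then have D: "D \<le> N" "\<exists>Q\<in>V. b D (rep Q) \<noteq> 0" by auto
    have big: "b j (\<lambda>m. E m (rep Q)) = 0" if "j \<le> N" "j > D" "Q \<in> V" for j Q
    proof (rule vanish[OF b(1)[OF that(1)] _ that(3)])
      fix Q assume "Q \<in> V"
      then show "b j (rep Q) = 0"
        using Max_ge[OF fin, of j] that D_def by fastforce
    qed
    have "(\<Sum>j\<le>D. b j (\<lambda>m. E m (rep Q)) * (rep Q i ^ j * rep Q l ^ (N - j))) = 0" if "Q \<in> V" for Q
    proof -
      have "(\<Sum>j\<le>D. b j (\<lambda>m. E m (rep Q)) * (rep Q i ^ j * rep Q l ^ (N - j)))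
        = (\<Sum>j\<le>N. b j (\<lambda>m. E m (rep Q)) * (rep Q i ^ j * rep Q l ^ (N - j)))"
        using D(1) big that by (intro sum.mono_neutral_left) auto
      then show ?thesis using b(3)[OF that] by simp
    qed
    then have "rel D b" unfolding rel_def using D b(1) by auto
    then show ?thesis by blast
  qed
  then have "\<exists>D. (\<exists>b. rel D b) \<and> (\<forall>D'<D. \<not> (\<exists>b. rel D' b))"
    using exists_least_iff[of "\<lambda>D. \<exists>b. rel D b"] by blast
  then obtain D b where D: "rel D b" "\<And>D' b'. D' < D \<Longrightarrow> \<not> rel D' b'" by blast
  have "\<exists>Q\<in>V. (\<Sum>j<D. of_nat (Suc j) * b (Suc j) (\<lambda>m. E m (rep Q)) * (rep Q i ^ j * rep Q l ^ (N - j))) \<noteq> 0"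
  proof (rule ccontr)
    assume "\<not> ?thesis"
    then have z: "(\<Sum>j<D. of_nat (Suc j) * b (Suc j) (\<lambda>m. E m (rep Q)) * (rep Q i ^ j * rep Q l ^ (N - j))) = 0"
      if "Q \<in> V" for Q using that by blast
    show False
    proof (cases D)
      case 0
      have "rep Q l ^ N * b 0 (\<lambda>m. E m (rep Q)) = 0" if "Q \<in> V" for Q
        using D(1) that by (simp add: rel_def 0 mult.commute)
      moreover have "(\<lambda>x. x l ^ N) \<in> hform UNIV (1 * N)" by (intro hform_power hform_coord subring_UNIV)
      moreover have "(\<lambda>x. b 0 (\<lambda>m. E m x)) \<in> hform UNIV (\<delta> * N)"
        using D(1) by (intro hform_comp subring_UNIV E) (auto simp: rel_def)
      ultimately have "b 0 (\<lambda>m. E m (rep Q)) = 0" if "Q \<in> V" for Q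
        using irreducible_hform[OF V, of "\<lambda>x. x l ^ N" _ "\<lambda>x. b 0 (\<lambda>m. E m x)"] l that by (metis power_not_zero)
      then have "b 0 (rep Q) = 0" if "Q \<in> V" for Q
        using dom[of "b 0" N] D(1) that by (auto simp: rel_def)
      then show False using D(1) by (auto simp: rel_def 0)
    next
      case (Suc D')
      \<comment> \<open>The derivative is multiplied by \<open>x l\<close>, so the exponent of
        \<open>x l\<close> is \<open>N - j\<close> and the total degree remains
        \<open>N\<close>.\<close>
      have "rel D' (\<lambda>j x. of_nat (Suc j) * b (Suc j) x)"
        unfolding rel_def
      proof (intro conjI allI impI ballI)
        show "D' \<le> N" using D(1) Suc by (simp add: rel_def)
        show "(\<lambda>x. of_nat (Suc j) * b (Suc j) x) \<in> hform UNIV N" if "j \<le> D'" for j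
          using D(1) Suc that by (intro hform_scale subring_UNIV) (auto simp: rel_def)
        obtain Q where "Q \<in> V" "b D (rep Q) \<noteq> 0" using D(1) by (auto simp: rel_def)
        then show "\<exists>Q\<in>V. of_nat (Suc D') * b (Suc D') (rep Q) \<noteq> 0"
          using Suc of_nat_neq_0[of D', where ?'a = 'a] by (intro bexI[of _ Q]) auto
        show "(\<Sum>j\<le>D'. of_nat (Suc j) * b (Suc j) (\<lambda>m. E m (rep Q)) * (rep Q i ^ j * rep Q l ^ (N - j))) = 0"
          if "Q \<in> V" for Q using z[OF that] by (simp only: Suc lessThan_Suc_atMost)
      qed
      then show False using D(2)[of D'] Suc by blast
    qed
  qed
  then show ?thesis using D(1) unfolding rel_def by blast
qed

lemma common_nonvanishing:
  assumes V: "irreducible_set V" and "finite S"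
    and "\<And>F. F \<in> S \<Longrightarrow> (\<exists>d. F \<in> hform UNIV d) \<and> (\<exists>Q\<in>V. F (rep Q) \<noteq> 0)"
  shows "\<exists>P\<in>V. \<forall>F\<in>S. F (rep P) \<noteq> 0"
proof -
  have "\<exists>d. \<exists>G\<in>hform UNIV d. (\<exists>P\<in>V. G (rep P) \<noteq> 0) \<and> (\<forall>P. G (rep P) \<noteq> 0 \<longrightarrow> (\<forall>F\<in>S. F (rep P) \<noteq> 0))"
    using assms(2,3)
  proof (induction rule: finite_induct)
    case empty
    have "(\<lambda>_. 1) \<in> hform UNIV 0" by (intro hform_const subring_UNIV UNIV_I)
    moreover have "\<exists>P. P \<in> V" using V by (auto simp: irreducible_set_def)
    ultimately show ?case by (intro exI[of _ 0] bexI[of _ "\<lambda>_. 1"]) auto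
  next
    case (insert F S)
    have "\<exists>d. \<exists>G\<in>hform UNIV d. (\<exists>P\<in>V. G (rep P) \<noteq> 0) \<and> (\<forall>P. G (rep P) \<noteq> 0 \<longrightarrow> (\<forall>F\<in>S. F (rep P) \<noteq> 0))"
      by (rule insert.IH) (rule insert.prems, simp)
    then obtain d G where G: "G \<in> hform UNIV d" "\<exists>P\<in>V. G (rep P) \<noteq> 0" "\<And>P F. G (rep P) \<noteq> 0 \<Longrightarrow> F \<in> S \<Longrightarrow> F (rep P) \<noteq> 0"
      by blast
    obtain e where F: "F \<in> hform UNIV e" "\<exists>P\<in>V. F (rep P) \<noteq> 0" using insert.prems[of F] by auto
    have "\<exists>P\<in>V. F (rep P) * G (rep P) \<noteq> 0"
      using irreducible_hform[OF V F(1) G(1)] F(2) G(2) by blast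
    moreover have "(\<lambda>x. F x * G x) \<in> hform UNIV (e + d)" by (intro hform_mult subring_UNIV F G)
    ultimately show ?case using G(3) by (intro exI[of _ "e + d"] bexI[of _ "\<lambda>x. F x * G x"]) auto
  qed
  then show ?thesis by blast
qed

section \<open>Surjectivity on the cotangent space\<close>

text \<open>Dividing by powers of coordinate \<open>l\<close> turns \<open>F\<close> and
  \<open>G\<close> into polynomials over \<open>C\<close> in the coordinate ratios, and the jets in
  question are closed under ring operations and inverses. It is applied to a translation over the
  whole field, and to the identity map over smaller \<open>C\<close>.\<close>

lemma quotient_first_order:
  fixes V :: "('i::finite, 'a::field_char_0) proj set"
  assumes C: "is_subring C" "\<And>c. c \<in> C \<Longrightarrow> inverse c \<in> C"
    and N: "function_germs.germ_module (local_ring V e) e C N"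
    and \<psi>: "regular_map_at UNIV V e \<psi>" "e \<in> V" "\<psi> ` V \<subseteq> V" "rep (\<psi> e) l \<noteq> 0"
    and y: "\<And>i. (\<lambda>Q. rep (\<psi> Q) i / rep (\<psi> Q) l) \<in> function_germs.first_order (local_ring V e) e C N"
    and F: "F \<in> hform C d" "G \<in> hform C d" "G (rep (\<psi> e)) \<noteq> 0"
  shows "(\<lambda>Q. F (rep (\<psi> Q)) / G (rep (\<psi> Q))) \<in> function_germs.first_order (local_ring V e) e C N"
proof -
  interpret function_germs "local_ring V e" e by (rule local_ring_germs)
  note S = first_order_subring[OF C(1) N]
  have deh: "(\<lambda>Q. F (rep (\<psi> Q)) / rep (\<psi> Q) l ^ d) \<in> first_order C N" if "F \<in> hform C d" for F d
    by (rule dehomogenized_form[where u = "\<lambda>Q. rep (\<psi> Q)", OF S y _ that]) (rule first_order_const[OF N])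
  have FU: "F \<in> hform UNIV d" "G \<in> hform UNIV d" using F hform_mono[of C UNIV] by auto
  have ld: "(\<lambda>x. x l ^ d) \<in> hform UNIV d"
    using hform_power[OF subring_UNIV hform_coord[OF subring_UNIV], of l d] by simp
  let ?v = "\<lambda>Q. rep (\<psi> Q) l ^ d / G (rep (\<psi> Q))"
  let ?u = "\<lambda>Q. G (rep (\<psi> Q)) / rep (\<psi> Q) l ^ d"
  have v: "?v \<in> local_ring V e"
    using regular_comp[OF \<psi>(1) local_ring_quotient[OF ld FU(2) F(3)] \<psi>(3,2)] .
  have Gl: "(\<lambda>x. G x * x l ^ d) \<in> hform UNIV (d + d)" by (intro hform_mult subring_UNIV FU ld)
  have "G (rep (\<psi> e)) * rep (\<psi> e) l ^ d \<noteq> 0" using F(3) \<psi>(4) by simp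
  from pullback_nonvanishing[OF \<psi>(1,2) Gl this]
  obtain k B where B: "B \<in> hform UNIV k" "B (rep e) \<noteq> 0"
    "\<And>Q. Q \<in> V \<Longrightarrow> B (rep Q) \<noteq> 0 \<Longrightarrow> G (rep (\<psi> Q)) * rep (\<psi> Q) l ^ d \<noteq> 0" by blast
  have "(\<lambda>Q. ?v Q * ?u Q - 1) \<in> mp 2"
  proof (rule germ_zero_mp[OF B(1,2)])
    show "?v Q * ?u Q - 1 = 0" if "Q \<in> V" "B (rep Q) \<noteq> 0" for Q using B(3)[OF that] by simp
    then show "?v e * ?u e - 1 = 0" using \<psi>(2) B(2) by blast
  qed
  from first_order_inverse[OF C N deh[OF F(2)] v this] have "?v \<in> first_order C N" .
  from subring_mult[OF S deh[OF F(1)] this]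
  have fo: "(\<lambda>Q. F (rep (\<psi> Q)) / rep (\<psi> Q) l ^ d) * ?v \<in> first_order C N" .
  show ?thesis
  proof (rule first_order_cong[OF N fo])
    show "(\<lambda>Q. F (rep (\<psi> Q)) / G (rep (\<psi> Q))) \<in> local_ring V e"
      using regular_comp[OF \<psi>(1) local_ring_quotient[OF FU F(3)] \<psi>(3,2)] .
    show "(\<lambda>Q. F (rep (\<psi> Q)) / G (rep (\<psi> Q)) - ((\<lambda>Q. F (rep (\<psi> Q)) / rep (\<psi> Q) l ^ d) * ?v) Q) \<in> mp 2"
    proof (rule germ_zero_mp[OF B(1,2)])
      show z: "F (rep (\<psi> Q)) / G (rep (\<psi> Q)) - ((\<lambda>Q. F (rep (\<psi> Q)) / rep (\<psi> Q) l ^ d) * ?v) Q = 0"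
        if "Q \<in> V" "B (rep Q) \<noteq> 0" for Q using B(3)[OF that] by simp
      show "F (rep (\<psi> e)) / G (rep (\<psi> e)) - ((\<lambda>Q. F (rep (\<psi> Q)) / rep (\<psi> Q) l ^ d) * ?v) e = 0"
        using z[OF \<psi>(2) B(2)] .
    qed
  qed
qed

text \<open>\<open>L P\<close> stands for left translation by \<open>P\<close>, and \<phi> for a
  homomorphism. Translations relate a general point, where \<phi> is unramified, to
  \<open>e\<close>.\<close>

locale homogeneous_endo =
  fixes V :: "('i::finite, 'a::{alg_closed_field,field_char_0}) proj set"
    and \<phi> :: "('i, 'a) proj \<Rightarrow> ('i, 'a) proj" and e :: "('i, 'a) proj"
    and L :: "('i, 'a) proj \<Rightarrow> ('i, 'a) proj \<Rightarrow> ('i, 'a) proj"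
  assumes irreducible: "irreducible_set V" and eV: "e \<in> V"
    and \<phi>_regular: "P \<in> V \<Longrightarrow> regular_map_at UNIV V P \<phi>" and \<phi>_surj: "\<phi> ` V = V" and \<phi>_e: "\<phi> e = e"
    and L_regular: "P \<in> V \<Longrightarrow> Q \<in> V \<Longrightarrow> regular_map_at UNIV V Q (L P)"
    and L_closed: "P \<in> V \<Longrightarrow> L P ` V \<subseteq> V" and L_e: "P \<in> V \<Longrightarrow> L P e = P"
    and \<phi>_L: "P \<in> V \<Longrightarrow> Q \<in> V \<Longrightarrow> \<phi> (L P Q) = L (\<phi> P) (\<phi> Q)"
    and L_inv: "P \<in> V \<Longrightarrow> \<exists>P'\<in>V. \<forall>Q\<in>V. L P' (L P Q) = Q"
begin

sublocale germ_dynamics "local_ring V e" e \<phi>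
proof
  show "is_subring (local_ring V e)" by (rule local_ring_subring)
  show "(\<lambda>_. c) \<in> local_ring V e" for c by (rule local_ring_const)
  show "\<phi> e = e" by (rule \<phi>_e)
  show "(\<lambda>x. f (\<phi> x)) \<in> local_ring V e" if "f \<in> local_ring V e" for f
    using regular_comp[OF \<phi>_regular[OF eV], of f V] that \<phi>_surj eV by (simp add: \<phi>_e)
qed

lemma pull_L: "P \<in> V \<Longrightarrow> h \<in> local_ring V P \<Longrightarrow> (\<lambda>Q. h (L P Q)) \<in> local_ring V e"
  using regular_comp[OF L_regular[OF _ eV], of P h V] L_closed[of P] eV by (simp add: L_e)

text \<open>The image of the cotangent map of \<phi>, taken as a set of functions; surjectivity at
  \<open>e\<close> says that it contains \<open>maxid\<close>.\<close>

definition image_module :: "(('i, 'a) proj \<Rightarrow> 'a) set" where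
  "image_module = {f. \<exists>g\<in>maxid. (\<lambda>Q. f Q - g (\<phi> Q)) \<in> mp 2}"

lemma image_module: "germ_module UNIV image_module"
  unfolding germ_module_def
proof (intro conjI ballI subsetI)
  fix f assume "f \<in> mp 2"
  then show "f \<in> image_module"
    unfolding image_module_def using maxid_zero by (auto intro!: bexI[of _ 0])
next
  fix f f' assume "f \<in> image_module" "f' \<in> image_module"
  then obtain g g' where g: "g \<in> maxid" "(\<lambda>Q. f Q - g (\<phi> Q)) \<in> mp 2" "g' \<in> maxid" "(\<lambda>Q. f' Q - g' (\<phi> Q)) \<in> mp 2"
    by (auto simp: image_module_def)
  have "(\<lambda>Q. (f Q + f' Q) - (g + g') (\<phi> Q)) \<in> mp 2"
    using mp_add[OF g(2,4)] by (simp add: plus_fun_def algebra_simps)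
  then show "(\<lambda>Q. f Q + f' Q) \<in> image_module"
    unfolding image_module_def using maxid_add[OF g(1,3)] by blast
next
  fix c f assume "f \<in> image_module"
  then obtain g where g: "g \<in> maxid" "(\<lambda>Q. f Q - g (\<phi> Q)) \<in> mp 2" by (auto simp: image_module_def)
  have "(\<lambda>Q. c * f Q - c * g (\<phi> Q)) \<in> mp 2"
    using mp_cscale[OF g(2), of c] by (simp add: algebra_simps)
  then show "(\<lambda>Q. c * f Q) \<in> image_module"
    unfolding image_module_def using maxid_cscale[OF g(1), of c] by (auto intro: bexI[of _ "\<lambda>Q. c * g Q"])
qed

lemma pullback_first_order:
  assumes "g \<in> local_ring V e"
  shows "(\<lambda>Q. g (\<phi> Q)) \<in> first_order UNIV image_module"
proof -
  have "(\<lambda>Q. (g (\<phi> Q) - g (\<phi> e)) - (g (\<phi> Q) - g e)) = 0" by (simp add: fun_eq_iff fixpt)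
  then have "(\<lambda>Q. g (\<phi> Q) - g (\<phi> e)) \<in> image_module"
    unfolding image_module_def using sub_value[OF assms] mp_zero by (auto intro!: bexI[of _ "\<lambda>x. g x - g e"])
  then show ?thesis using comp[OF assms] by (simp add: first_order_def)
qed

text \<open>In characteristic zero the coordinate functions are separably algebraic over the pulled
  back functions, so \<open>\<phi>\<close> is unramified at a general point, hence by homogeneity at \<open>e\<close>.\<close>

theorem cotangent_surjective:
  assumes f: "f \<in> maxid"
  shows "\<exists>g\<in>maxid. (\<lambda>Q. f Q - g (\<phi> Q)) \<in> mp 2"
proof -
  note U = subring_UNIV
  obtain o' where o': "rep e o' \<noteq> 0" using rep_nonzero[of e] by blast
  obtain \<delta> E where E: "\<And>j. E j \<in> hform UNIV \<delta>" "\<exists>j. E j (rep e) \<noteq> 0"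
    "\<And>Q. Q \<in> V \<Longrightarrow> \<exists>j. E j (rep Q) \<noteq> 0 \<Longrightarrow> \<phi> Q = point (\<lambda>j. E j (rep Q))"
    using \<phi>_regular[OF eV] unfolding regular_map_at_def by blast
  obtain l where l: "E l (rep e) \<noteq> 0" using E(2) by blast
  have rep\<phi>: "\<exists>c. c \<noteq> 0 \<and> rep (\<phi> Q) = (\<lambda>j. c * E j (rep Q))" if "Q \<in> V" "E j (rep Q) \<noteq> 0" for Q j
  proof -
    have "\<phi> Q = point (\<lambda>j. E j (rep Q))" using E(3) that by blast
    then show ?thesis using rep_point[of "\<lambda>j. E j (rep Q)", OF that(2)] by (simp only:)
  qed
  \<comment> \<open>The identity theorem extends the vanishing of the pulled-back form from the open
    set where \<open>E l\<close> is nonzero to all of \<open>V\<close>, and \<phi> is onto.\<close>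
  have dom: "b (rep R) = 0"
    if b: "b \<in> hform UNIV N" "\<And>Q. Q \<in> V \<Longrightarrow> b (\<lambda>j. E j (rep Q)) = 0" and R: "R \<in> V" for N b R
  proof -
    obtain Q where Q: "Q \<in> V" "R = \<phi> Q" using R \<phi>_surj by blast
    obtain k where k: "rep R k \<noteq> 0" using rep_nonzero[of R] by blast
    have kN: "(\<lambda>x. x k ^ N) \<in> hform UNIV N" using hform_power[OF U hform_coord[OF U], of k N] by simp
    have "(\<lambda>S. b (rep S) / rep S k ^ N) \<in> local_ring V (\<phi> Q)"
      using local_ring_quotient[OF b(1) kN] k Q by simp
    from regular_comp[OF \<phi>_regular[OF Q(1)] this _ Q(1)] \<phi>_surj
    have "(\<lambda>S. b (rep (\<phi> S)) / rep (\<phi> S) k ^ N) \<in> local_ring V Q" by simp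
    moreover have "b (rep (\<phi> S)) / rep (\<phi> S) k ^ N = 0" if S: "S \<in> V" "E l (rep S) \<noteq> 0" for S
    proof -
      obtain c where c: "rep (\<phi> S) = (\<lambda>j. c * E j (rep S))" using rep\<phi>[OF S] by blast
      show ?thesis
        unfolding c hform_homogeneous[OF b(1)] using b(2)[OF S(1)] by simp
    qed
    ultimately have "b (rep (\<phi> Q)) / rep (\<phi> Q) k ^ N = 0"
      using regular_identity[OF irreducible _ Q(1) E(1)[of l] eV l] by blast
    then show ?thesis using k Q by simp
  qed
  have EV: "point (\<lambda>j. E j (rep Q)) \<in> V" if "Q \<in> V" "\<exists>j. E j (rep Q) \<noteq> 0" for Q
    using E(3)[OF that] that(1) \<phi>_surj by (metis imageI)
  define sep where "sep i N D b \<longleftrightarrow> D \<le> N \<and> (\<forall>j\<le>D. b j \<in> hform UNIV N) \<and>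
    (\<forall>Q\<in>V. (\<Sum>j\<le>D. b j (\<lambda>m. E m (rep Q)) * (rep Q i ^ j * rep Q o' ^ (N - j))) = 0) \<and>
    (\<exists>Q\<in>V. (\<Sum>j<D. of_nat (Suc j) * b (Suc j) (\<lambda>m. E m (rep Q)) * (rep Q i ^ j * rep Q o' ^ (N - j))) \<noteq> 0)"
    for i N D and b :: "nat \<Rightarrow> ('i \<Rightarrow> 'a) \<Rightarrow> 'a"
  have "\<exists>N D b. sep i N D b" for i
    unfolding sep_def
    by (rule separable_relation[of V E \<delta> e o', OF irreducible E(1) eV o' EV])
       (auto intro: dom)
  then obtain N D b where sep: "\<And>i. sep i (N i) (D i) (b i)" by metis
  have D: "D i \<le> N i" for i using sep[of i] unfolding sep_def by blast
  have b: "b i j \<in> hform UNIV (N i)" if "j \<le> D i" for i j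
    using sep[of i] that unfolding sep_def by blast
  have rel: "(\<Sum>j\<le>D i. b i j (\<lambda>m. E m (rep Q)) * (rep Q i ^ j * rep Q o' ^ (N i - j))) = 0" if "Q \<in> V" for i Q
    using sep[of i] that unfolding sep_def by blast
  have der: "\<exists>Q\<in>V. (\<Sum>j<D i. of_nat (Suc j) * b i (Suc j) (\<lambda>m. E m (rep Q)) * (rep Q i ^ j * rep Q o' ^ (N i - j))) \<noteq> 0" for i
    using sep[of i] unfolding sep_def by blast
  define Df where "Df i x = (\<Sum>j<D i. of_nat (Suc j) * b i (Suc j) (\<lambda>m. E m x) * (x i ^ j * x o' ^ (N i - j)))" for i x
  have Df: "Df i \<in> hform UNIV (\<delta> * N i + N i)" for i
    unfolding Df_def
  proof (intro hform_sum U)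
    fix j assume j: "j \<in> {..<D i}"
    have "(\<lambda>x. of_nat (Suc j) * b i (Suc j) (\<lambda>m. E m x)) \<in> hform UNIV (\<delta> * N i)"
      using j by (intro hform_scale hform_comp U E b) auto
    moreover have "(\<lambda>x. x i ^ j * x o' ^ (N i - j)) \<in> hform UNIV (1 * j + 1 * (N i - j))"
      by (intro hform_mult hform_power hform_coord U)
    moreover have "1 * j + 1 * (N i - j) = N i" using j D[of i] by simp
    ultimately show "(\<lambda>x. of_nat (Suc j) * b i (Suc j) (\<lambda>m. E m x) * (x i ^ j * x o' ^ (N i - j))) \<in> hform UNIV (\<delta> * N i + N i)"
      using hform_mult[OF U, of "\<lambda>x. of_nat (Suc j) * b i (Suc j) (\<lambda>m. E m x)"] by simp
  qed
  \<comment> \<open>A general point: the chart coordinate, the form \<open>E l\<close> and, for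
    every coordinate, the derivative of its relation are all nonzero there.\<close>
  have "\<exists>P\<in>V. \<forall>F \<in> {\<lambda>x. x o', E l} \<union> range Df. F (rep P) \<noteq> 0"
  proof (rule common_nonvanishing[OF irreducible])
    fix F assume "F \<in> {\<lambda>x. x o', E l} \<union> range Df"
    moreover have "\<exists>Q\<in>V. Df i (rep Q) \<noteq> 0" for i using der[of i] unfolding Df_def .
    moreover have "(\<lambda>x. x o') \<in> hform UNIV 1" by (rule hform_coord[OF U])
    ultimately show "(\<exists>d. F \<in> hform UNIV d) \<and> (\<exists>Q\<in>V. F (rep Q) \<noteq> 0)"
      using Df E(1)[of l] l o' eV by blast
  qed simp
  then obtain P where P: "P \<in> V" "rep P o' \<noteq> 0" "E l (rep P) \<noteq> 0" "\<And>i. Df i (rep P) \<noteq> 0" by auto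
  have \<phi>P: "\<phi> P \<in> V" using P(1) \<phi>_surj by blast
  have \<phi>Pl: "rep (\<phi> P) l \<noteq> 0" using rep\<phi>[OF P(1,3)] P(3) by auto
  have LP: "L P Q \<in> V" if "Q \<in> V" for Q using L_closed[OF P(1)] that by blast
  let ?N = image_module
  \<comment> \<open>Coordinate ratios near \<open>P\<close>, translated to \<open>e\<close>. Because
    \<open>\<phi> (L P Q) = L (\<phi> P) (\<phi> Q)\<close>, the coefficients of their relations
    become \<open>\<alpha> j (\<phi> Q)\<close>; these are pulled back by \<phi>, so their
    differentials lie in the image.\<close>
  have y: "(\<lambda>Q. rep (L P Q) i / rep (L P Q) o') \<in> first_order UNIV ?N" for i
  proof -
    define y where "y = (\<lambda>Q. rep (L P Q) i / rep (L P Q) o')"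
    define a where "a j R = b i j (rep R) / rep R l ^ N i" for j R
    define \<alpha> where "\<alpha> j Q = a j (L (\<phi> P) Q)" for j Q
    have lN: "(\<lambda>x. x l ^ N i) \<in> hform UNIV (N i)" using hform_power[OF U hform_coord[OF U], of l "N i"] by simp
    have "a j \<in> local_ring V (\<phi> P)" if "j \<le> D i" for j
      unfolding a_def using local_ring_quotient[OF b[OF that] lN] \<phi>Pl by simp
    then have \<alpha>: "\<alpha> j \<in> local_ring V e" if "j \<le> D i" for j
      unfolding \<alpha>_def using pull_L[OF \<phi>P] that by blast
    have \<alpha>_val: "\<alpha> j (\<phi> Q) = b i j (\<lambda>m. E m (rep (L P Q))) / E l (rep (L P Q)) ^ N i"
      if Q: "Q \<in> V" "E l (rep (L P Q)) \<noteq> 0" "j \<le> D i" for Q j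
    proof -
      obtain c where c: "c \<noteq> 0" "rep (\<phi> (L P Q)) = (\<lambda>j. c * E j (rep (L P Q)))"
        using rep\<phi>[OF LP[OF Q(1)] Q(2)] by blast
      have "\<alpha> j (\<phi> Q) = a j (\<phi> (L P Q))" by (simp add: \<alpha>_def \<phi>_L[OF P(1) Q(1)])
      also have "\<dots> = (c ^ N i * b i j (\<lambda>m. E m (rep (L P Q)))) / (c * E l (rep (L P Q))) ^ N i"
        unfolding a_def c(2) hform_homogeneous[OF b[OF Q(3)]] ..
      also have "\<dots> = b i j (\<lambda>m. E m (rep (L P Q))) / E l (rep (L P Q)) ^ N i"
        using c(1) by (simp add: power_mult_distrib)
      finally show ?thesis .
    qed
    have terms: "\<alpha> j (\<phi> Q) * y Q ^ k = b i j (\<lambda>m. E m (rep (L P Q))) * (rep (L P Q) i ^ k * rep (L P Q) o' ^ (N i - k))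
        / (E l (rep (L P Q)) ^ N i * rep (L P Q) o' ^ N i)"
      if "Q \<in> V" "E l (rep (L P Q)) \<noteq> 0" "rep (L P Q) o' \<noteq> 0" "j \<le> D i" "k \<le> D i" for Q j k
    proof -
      have "rep (L P Q) o' ^ N i = rep (L P Q) o' ^ k * rep (L P Q) o' ^ (N i - k)"
        using that(5) D[of i] by (simp flip: power_add)
      then show ?thesis
        using that by (simp add: \<alpha>_val y_def power_divide)
    qed
    have "y \<in> first_order UNIV ?N"
    proof (rule first_order_root[OF image_module, of "D i" "\<lambda>j Q. \<alpha> j (\<phi> Q)"])
      show "(\<lambda>Q. \<alpha> j (\<phi> Q)) \<in> first_order UNIV ?N" if "j \<le> D i" for j
        by (rule pullback_first_order[OF \<alpha>[OF that]])
      show "y \<in> local_ring V e"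
        unfolding y_def
        using pull_L[OF P(1) local_ring_quotient[OF hform_coord[OF U] hform_coord[OF U] P(2)]] .
      have oE: "(\<lambda>x. x o' * E l x) \<in> hform UNIV (1 + \<delta>)" by (intro hform_mult hform_coord U E)
      have "rep (L P e) o' * E l (rep (L P e)) \<noteq> 0" using P L_e by simp
      from pullback_nonvanishing[OF L_regular[OF P(1) eV] eV oE this]
      obtain k B where B: "B \<in> hform UNIV k" "B (rep e) \<noteq> 0"
        "\<And>Q. Q \<in> V \<Longrightarrow> B (rep Q) \<noteq> 0 \<Longrightarrow> rep (L P Q) o' * E l (rep (L P Q)) \<noteq> 0" by blast
      have z: "(\<Sum>j\<le>D i. \<alpha> j (\<phi> Q) * y Q ^ j) = 0" if "Q \<in> V" "B (rep Q) \<noteq> 0" for Q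
      proof -
        have "(\<Sum>j\<le>D i. \<alpha> j (\<phi> Q) * y Q ^ j) = (\<Sum>j\<le>D i. b i j (\<lambda>m. E m (rep (L P Q))) *
          (rep (L P Q) i ^ j * rep (L P Q) o' ^ (N i - j)) / (E l (rep (L P Q)) ^ N i * rep (L P Q) o' ^ N i))"
          using B(3)[OF that] that(1) by (intro sum.cong refl terms) auto
        also have "\<dots> = 0" using rel[OF LP[OF that(1)], of i] by (simp flip: sum_divide_distrib)
        finally show ?thesis .
      qed
      show "(\<lambda>Q. \<Sum>j\<le>D i. \<alpha> j (\<phi> Q) * y Q ^ j) \<in> mp 2"
        by (rule germ_zero_mp[OF B(1,2)]) (use z eV B(2) in auto)
      have "(\<Sum>j\<le>D i. of_nat j * \<alpha> j (\<phi> e) * y e ^ (j - 1)) = (\<Sum>j<D i. of_nat (Suc j) * \<alpha> (Suc j) (\<phi> e) * y e ^ j)"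
        unfolding lessThan_Suc_atMost[symmetric] sum.lessThan_Suc_shift by simp
      also have "\<dots> = (\<Sum>j<D i. of_nat (Suc j) * b i (Suc j) (\<lambda>m. E m (rep P)) * (rep P i ^ j * rep P o' ^ (N i - j))
          / (E l (rep P) ^ N i * rep P o' ^ N i))"
      proof (rule sum.cong)
        fix j assume "j \<in> {..<D i}"
        then show "of_nat (Suc j) * \<alpha> (Suc j) (\<phi> e) * y e ^ j = of_nat (Suc j) * b i (Suc j) (\<lambda>m. E m (rep P)) *
          (rep P i ^ j * rep P o' ^ (N i - j)) / (E l (rep P) ^ N i * rep P o' ^ N i)"
          using terms[OF eV, of "Suc j" j] P L_e by (simp only: mult.assoc) simp
      qed simp
      also have "\<dots> = Df i (rep P) / (E l (rep P) ^ N i * rep P o' ^ N i)"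
        by (simp add: Df_def sum_divide_distrib)
      also have "\<dots> \<noteq> 0" using P by simp
      finally show "(\<Sum>j\<le>D i. of_nat j * \<alpha> j (\<phi> e) * y e ^ (j - 1)) \<noteq> 0" .
    qed
    then show ?thesis unfolding y_def .
  qed
  \<comment> \<open>On \<open>V\<close>, \<open>f\<close> is recovered as
    \<open>(f o L P') o L P\<close>, and near \<open>P\<close> the inner function is a quotient of
    forms.\<close>
  obtain P' where P': "P' \<in> V" "\<And>Q. Q \<in> V \<Longrightarrow> L P' (L P Q) = Q" using L_inv[OF P(1)] by blast
  have P'P: "L P' P = e" using P'(2)[OF eV] L_e[OF P(1)] by simp
  have "(\<lambda>Q. f (L P' Q)) \<in> local_ring V P"
    using regular_comp[OF L_regular[OF P'(1) P(1)], of f V] L_closed[OF P'(1)] P(1) f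
    by (simp add: P'P maxid_def)
  then obtain d F G where F: "F \<in> hform UNIV d" "G \<in> hform UNIV d" "G (rep P) \<noteq> 0"
    "\<And>Q. Q \<in> V \<Longrightarrow> G (rep Q) \<noteq> 0 \<Longrightarrow> f (L P' Q) = F (rep Q) / G (rep Q)"
    by (rule local_ringE) metis
  have fo: "(\<lambda>Q. F (rep (L P Q)) / G (rep (L P Q))) \<in> first_order UNIV ?N"
    using F P L_e L_closed
    by (intro quotient_first_order[OF U _ image_module L_regular[OF P(1) eV] eV _ _ y]) auto
  have "G (rep (L P e)) \<noteq> 0" using F(3) L_e P by simp
  from pullback_nonvanishing[OF L_regular[OF P(1) eV] eV F(2) this]
  obtain k B where B: "B \<in> hform UNIV k" "B (rep e) \<noteq> 0"
    "\<And>Q. Q \<in> V \<Longrightarrow> B (rep Q) \<noteq> 0 \<Longrightarrow> G (rep (L P Q)) \<noteq> 0" by blast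
  have z: "f Q - F (rep (L P Q)) / G (rep (L P Q)) = 0" if "Q \<in> V" "B (rep Q) \<noteq> 0" for Q
    using F(4)[OF LP[OF that(1)] B(3)[OF that]] P'(2)[OF that(1)] by simp
  have "f \<in> first_order UNIV ?N"
  proof (rule first_order_cong[OF image_module fo])
    show "f \<in> local_ring V e" using f by (simp add: maxid_def)
    show "(\<lambda>Q. f Q - F (rep (L P Q)) / G (rep (L P Q))) \<in> mp 2"
      by (rule germ_zero_mp[OF B(1,2)]) (use z eV B(2) in auto)
  qed
  then have "f \<in> ?N" using f by (simp add: first_order_def maxid_def)
  then show ?thesis by (simp add: image_module_def)
qed

lemma cotangent_surjective_iterate:
  assumes "f \<in> maxid"
  shows "\<exists>g\<in>maxid. (\<lambda>Q. f Q - g ((\<phi> ^^ s) Q)) \<in> mp 2"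
proof (induction s)
  case 0
  show ?case using assms mp_zero[of 2] by (intro bexI[of _ f]) (auto simp: zero_fun_def)
next
  case (Suc s)
  then obtain g where g: "g \<in> maxid" "(\<lambda>Q. f Q - g ((\<phi> ^^ s) Q)) \<in> mp 2" by blast
  obtain g' where g': "g' \<in> maxid" "(\<lambda>Q. g Q - g' (\<phi> Q)) \<in> mp 2" using cotangent_surjective[OF g(1)] by blast
  have "(\<lambda>Q. g ((\<phi> ^^ s) Q) - g' (\<phi> ((\<phi> ^^ s) Q))) \<in> mp 2"
    using op_stable_act[OF mp_stable g'(2), of "monom 1 s"] by (simp add: act_monom)
  from mp_add[OF g(2) this] have "(\<lambda>Q. f Q - g' ((\<phi> ^^ Suc s) Q)) \<in> mp 2" by (simp add: plus_fun_def)
  then show ?case using g'(1) by blast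
qed

end

section \<open>Cotangent eigenvalues over the number field, and invariance of periodic sets\<close>

section \<open>Eigenvalues on the cotangent space\<close>

lemma act_bound:
  assumes "degree p \<le> n"
  shows "act \<phi> p f = (\<lambda>x. \<Sum>i\<le>n. coeff p i * f ((\<phi> ^^ i) x))"
  unfolding act_def using assms
  by (intro ext sum.mono_neutral_left) (auto simp: coeff_eq_0)

lemma regular_map_id: "regular_map_at UNIV V P (\<lambda>Q. Q)"
  unfolding regular_map_at_def
  using hform_coord[OF subring_UNIV] rep_nonzero[of P]
  by (intro exI[of _ 1] exI[of _ "\<lambda>j x. x j"]) auto

context homogeneous_endo
begin

text \<open>Functions with differential in the \<open>C\<close>-span of the coordinate functions
  form a module to which \<open>quotient_first_order\<close> applies with the identity map. For
  \<open>C\<close> the image of the number field this gives the \<open>K\<close>-structure of the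
  cotangent space.\<close>

lemma cotangent_linearization:
  assumes l: "rep e l \<noteq> 0"
    and C: "is_subring C" "\<And>c. c \<in> C \<Longrightarrow> inverse c \<in> C" "\<And>i. rep e i / rep e l \<in> C"
    and F: "F \<in> hform C d" "G \<in> hform C d" "G (rep e) \<noteq> 0"
  shows "\<exists>\<alpha>. range \<alpha> \<subseteq> C \<and> (\<lambda>Q. F (rep Q) / G (rep Q) - F (rep e) / G (rep e) -
    (\<Sum>i\<in>UNIV. \<alpha> i * (rep Q i / rep Q l - rep e i / rep e l))) \<in> mp 2"
proof -
  define t where "t i Q = rep Q i / rep Q l - rep e i / rep e l" for i Q
  define N where "N = {f. \<exists>\<alpha>. range \<alpha> \<subseteq> C \<and> (\<lambda>Q. f Q - (\<Sum>i\<in>UNIV. \<alpha> i * t i Q)) \<in> mp 2}"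
  have N: "germ_module C N"
    unfolding germ_module_def
  proof (intro conjI ballI subsetI)
    fix f assume "f \<in> mp 2"
    then show "f \<in> N"
      unfolding N_def using subring_zero[OF C(1)] by (intro CollectI exI[of _ "\<lambda>_. 0"]) auto
  next
    fix f f' assume "f \<in> N" "f' \<in> N"
    then obtain \<alpha> \<alpha>' where \<alpha>: "range \<alpha> \<subseteq> C" "(\<lambda>Q. f Q - (\<Sum>i\<in>UNIV. \<alpha> i * t i Q)) \<in> mp 2"
      "range \<alpha>' \<subseteq> C" "(\<lambda>Q. f' Q - (\<Sum>i\<in>UNIV. \<alpha>' i * t i Q)) \<in> mp 2"
      by (auto simp: N_def)
    have "(\<lambda>Q. f Q + f' Q - (\<Sum>i\<in>UNIV. (\<alpha> i + \<alpha>' i) * t i Q)) \<in> mp 2"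
      using mp_add[OF \<alpha>(2,4)] by (simp add: plus_fun_def algebra_simps sum.distrib)
    moreover have "range (\<lambda>i. \<alpha> i + \<alpha>' i) \<subseteq> C" using \<alpha> subring_add[OF C(1)] by auto
    ultimately show "(\<lambda>Q. f Q + f' Q) \<in> N" unfolding N_def by blast
  next
    fix c f assume c: "c \<in> C" and "f \<in> N"
    then obtain \<alpha> where \<alpha>: "range \<alpha> \<subseteq> C" "(\<lambda>Q. f Q - (\<Sum>i\<in>UNIV. \<alpha> i * t i Q)) \<in> mp 2"
      by (auto simp: N_def)
    have "(\<lambda>Q. c * f Q - (\<Sum>i\<in>UNIV. (c * \<alpha> i) * t i Q)) \<in> mp 2"
      using mp_cscale[OF \<alpha>(2), of c] by (simp add: algebra_simps sum_distrib_left)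
    moreover have "range (\<lambda>i. c * \<alpha> i) \<subseteq> C" using \<alpha> c subring_mult[OF C(1)] by auto
    ultimately show "(\<lambda>Q. c * f Q) \<in> N" unfolding N_def by blast
  qed
  have y: "(\<lambda>Q. rep Q i / rep Q l) \<in> first_order C N" for i
  proof -
    have "(\<lambda>Q. rep Q i / rep Q l) \<in> local_ring V e"
      using l by (intro local_ring_quotient[of "\<lambda>x. x i" 1 "\<lambda>x. x l"] hform_coord subring_UNIV)
    moreover have "(\<lambda>Q. rep Q i / rep Q l - rep e i / rep e l) \<in> N"
    proof -
      have "(\<lambda>Q. rep Q i / rep Q l - rep e i / rep e l - (\<Sum>j\<in>UNIV. (if j = i then 1 else 0) * t j Q)) = 0"
        by (simp add: fun_eq_iff t_def if_distrib[of "\<lambda>z. z * _"] cong: if_cong)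
      moreover have "range (\<lambda>j. if j = i then 1 else 0) \<subseteq> C"
        using subring_one[OF C(1)] subring_zero[OF C(1)] by auto
      ultimately show ?thesis
        unfolding N_def using mp_zero[of 2]
        by (intro CollectI exI[of _ "\<lambda>j. if j = i then 1 else 0"] conjI) simp_all
    qed
    ultimately show ?thesis using C(3)[of i] by (simp add: first_order_def)
  qed
  have "(\<lambda>Q. F (rep Q) / G (rep Q)) \<in> first_order C N"
    by (rule quotient_first_order[where \<psi> = "\<lambda>Q. Q" and l = l, OF C(1,2) N regular_map_id eV _ l y F])
       auto
  then show ?thesis by (simp add: first_order_def N_def t_def)
qed

text \<open>The \<open>n\<close> coordinate functions \<open>t i\<close> span the cotangent space
  but may be dependent, so \<phi> has no canonical matrix on them; any matrix \<open>M\<close> over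
  the number field serves. Each \<open>t i\<close> is killed modulo \<open>mp 2\<close> by a
  polynomial of degree at most \<open>n\<close>, whence at most \<open>n * n\<close> roots in
  all.\<close>

lemma cotangent_eigenvalues:
  fixes h :: "'k::field_char_0 \<Rightarrow> 'a"
  assumes h: "h 1 = 1" "\<And>x y. h (x + y) = h x + h y" "\<And>x y. h (x * y) = h x * h y"
    and \<phi>C: "regular_map_at (range h) V e \<phi>"
    and l: "rep e l \<noteq> 0" "\<And>i. rep e i / rep e l \<in> range h"
  defines "n \<equiv> card (UNIV :: 'i set)"
  shows "\<exists>\<Lambda>. finite \<Lambda> \<and> card \<Lambda> \<le> n * n \<and> 0 \<notin> \<Lambda> \<and>
    (\<forall>z\<in>\<Lambda>. \<exists>p. p \<noteq> 0 \<and> (\<forall>i. coeff p i \<in> range h) \<and> degree p \<le> n \<and> poly p z = 0) \<and>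
    (\<forall>f\<in>maxid. op_killed \<phi> (mult_closure \<Lambda>) (mp 2) f)"
proof -
  define C where "C = range h"
  have C: "is_subring C" "\<And>c. c \<in> C \<Longrightarrow> inverse c \<in> C"
    unfolding C_def using range_hom_subring[OF h] range_hom_inverse[OF h] by auto
  note h0 = additive_zero_sum(1)[of h, OF h(2)]
  note hs = additive_zero_sum(2)[of h, OF h(2)]
  have hinj: "h x = 0 \<longleftrightarrow> x = 0" for x
  proof
    assume "h x = 0"
    show "x = 0"
    proof (rule ccontr)
      assume "x \<noteq> 0"
      then have "h x * h (inverse x) = 1" by (simp flip: h)
      then show False using \<open>h x = 0\<close> by simp
    qed
  qed (simp add: h0)
  define t where "t i Q = rep Q i / rep Q l - rep e i / rep e l" for i Q
  have t: "t i \<in> maxid" for i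
  proof -
    have "(\<lambda>Q. rep Q i / rep Q l) \<in> local_ring V e"
      using l by (intro local_ring_quotient[of "\<lambda>x. x i" 1 "\<lambda>x. x l"] hform_coord subring_UNIV)
    from sub_value[OF this] show ?thesis by (simp add: t_def[abs_def])
  qed
  obtain \<delta> E where E: "\<And>j. E j \<in> hform C \<delta>" "\<exists>j. E j (rep e) \<noteq> 0"
    "\<And>Q. Q \<in> V \<Longrightarrow> \<exists>j. E j (rep Q) \<noteq> 0 \<Longrightarrow> \<phi> Q = point (\<lambda>j. E j (rep Q))"
    using \<phi>C unfolding regular_map_at_def C_def by blast
  have rep\<phi>: "\<exists>c. c \<noteq> 0 \<and> rep (\<phi> Q) = (\<lambda>j. c * E j (rep Q))" if "Q \<in> V" "E j (rep Q) \<noteq> 0" for Q j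
  proof -
    have "\<phi> Q = point (\<lambda>j. E j (rep Q))" using E(3) that by blast
    then show ?thesis using rep_point[of "\<lambda>j. E j (rep Q)", OF that(2)] by (simp only:)
  qed
  obtain ce where ce: "ce \<noteq> 0" "rep e = (\<lambda>j. ce * E j (rep e))"
    using rep\<phi>[OF eV] E(2) by (auto simp: \<phi>_e)
  have El: "E l (rep e) \<noteq> 0" using l(1) ce by (metis mult_zero_right)
  have Ee: "E i (rep e) / E l (rep e) = rep e i / rep e l" for i
  proof -
    have "rep e i / rep e l = (ce * E i (rep e)) / (ce * E l (rep e))" using ce(2) by metis
    then show ?thesis using ce(1) by simp
  qed
  have lin: "\<exists>\<alpha>. range \<alpha> \<subseteq> C \<and> (\<lambda>Q. t i (\<phi> Q) - (\<Sum>j\<in>UNIV. \<alpha> j * t j Q)) \<in> mp 2" for i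
  proof -
    obtain \<alpha> where \<alpha>: "range \<alpha> \<subseteq> C" "(\<lambda>Q. E i (rep Q) / E l (rep Q) - E i (rep e) / E l (rep e) -
      (\<Sum>j\<in>UNIV. \<alpha> j * t j Q)) \<in> mp 2"
      using cotangent_linearization[OF l(1) C _ E(1)[of i] E(1)[of l] El] l(2) unfolding t_def C_def by blast
    have EU: "E l \<in> hform UNIV \<delta>" using E(1)[of l] hform_mono[of C UNIV] by auto
    have z: "t i (\<phi> Q) - (E i (rep Q) / E l (rep Q) - E i (rep e) / E l (rep e)) = 0"
      if Q: "Q \<in> V" "E l (rep Q) \<noteq> 0" for Q
    proof -
      obtain c where "c \<noteq> 0" "rep (\<phi> Q) = (\<lambda>j. c * E j (rep Q))" using rep\<phi>[OF Q] by blast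
      then show ?thesis by (simp add: t_def Ee)
    qed
    have "(\<lambda>Q. t i (\<phi> Q) - (E i (rep Q) / E l (rep Q) - E i (rep e) / E l (rep e))) \<in> mp 2"
      by (rule germ_zero_mp[OF EU El]) (use z eV El in auto)
    from mp_add[OF this \<alpha>(2)] have "(\<lambda>Q. t i (\<phi> Q) - (\<Sum>j\<in>UNIV. \<alpha> j * t j Q)) \<in> mp 2"
      by (simp add: plus_fun_def)
    then show ?thesis using \<alpha>(1) by blast
  qed
  have "\<forall>i. \<exists>\<mu>. (\<lambda>Q. t i (\<phi> Q) - (\<Sum>j\<in>UNIV. h (\<mu> j) * t j Q)) \<in> mp 2"
  proof
    fix i
    obtain \<alpha> where \<alpha>: "range \<alpha> \<subseteq> C" "(\<lambda>Q. t i (\<phi> Q) - (\<Sum>j\<in>UNIV. \<alpha> j * t j Q)) \<in> mp 2"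
      using lin by blast
    have "h (inv_into UNIV h (\<alpha> j)) = \<alpha> j" for j
      by (rule f_inv_into_f) (use \<alpha>(1) C_def in blast)
    then show "\<exists>\<mu>. (\<lambda>Q. t i (\<phi> Q) - (\<Sum>j\<in>UNIV. h (\<mu> j) * t j Q)) \<in> mp 2"
      using \<alpha>(2) by (intro exI[of _ "\<lambda>j. inv_into UNIV h (\<alpha> j)"]) simp
  qed
  from choice[OF this] obtain M where M: "\<And>i. (\<lambda>Q. t i (\<phi> Q) - (\<Sum>j\<in>UNIV. h (M i j) * t j Q)) \<in> mp 2" by blast
  \<comment> \<open>Row \<open>i\<close> of the \<open>s\<close>-th power of
    \<open>M\<close>.\<close>
  define v where "v i s = ((\<lambda>u j. \<Sum>m\<in>UNIV. u m * M m j) ^^ s) (\<lambda>j. if j = i then 1 else 0)" for i s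
  have v0: "v i 0 j = (if j = i then 1 else 0)" for i j by (simp add: v_def)
  have vS: "v i (Suc s) j = (\<Sum>m\<in>UNIV. v i s m * M m j)" for i s j by (simp add: v_def)
  have tv: "(\<lambda>Q. t i ((\<phi> ^^ s) Q) - (\<Sum>j\<in>UNIV. h (v i s j) * t j Q)) \<in> mp 2" for i s
  proof (induction s)
    case 0
    have "(\<Sum>j\<in>UNIV. h (v i 0 j) * t j Q) = t i Q" for Q
      by (simp add: v0 if_distrib[of h] h h0 if_distrib[of "\<lambda>z. z * _"] cong: if_cong)
    then show ?case using mp_zero[of 2] by (simp add: zero_fun_def)
  next
    case (Suc s)
    have "(\<lambda>Q. t i ((\<phi> ^^ s) (\<phi> Q)) - (\<Sum>j\<in>UNIV. h (v i s j) * t j (\<phi> Q))) \<in> mp 2"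
      using mp_comp[OF Suc] .
    moreover have "(\<Sum>j\<in>UNIV. (\<lambda>Q. h (v i s j) * (t j (\<phi> Q) - (\<Sum>m\<in>UNIV. h (M j m) * t m Q)))) \<in> mp 2"
      by (intro mp_sum mp_cscale M)
    ultimately have 1: "(\<lambda>Q. t i ((\<phi> ^^ s) (\<phi> Q)) - (\<Sum>j\<in>UNIV. h (v i s j) * t j (\<phi> Q))) +
      (\<Sum>j\<in>UNIV. (\<lambda>Q. h (v i s j) * (t j (\<phi> Q) - (\<Sum>m\<in>UNIV. h (M j m) * t m Q)))) \<in> mp 2"
      (is "?lhs \<in> _")
      by (rule mp_add)
    have "?lhs Q = t i ((\<phi> ^^ Suc s) Q) - (\<Sum>j\<in>UNIV. h (v i (Suc s) j) * t j Q)" for Q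
    proof -
      have "(\<Sum>j\<in>UNIV. h (v i s j) * (\<Sum>m\<in>UNIV. h (M j m) * t m Q)) = (\<Sum>m\<in>UNIV. h (v i (Suc s) m) * t m Q)"
        unfolding vS hs h sum_distrib_left sum_distrib_right
        by (subst sum.swap) (simp add: mult.assoc)
      then show ?thesis
        by (simp add: sum_fun_apply right_diff_distrib sum_subtractf funpow_swap1)
    qed
    then have "?lhs = (\<lambda>Q. t i ((\<phi> ^^ Suc s) Q) - (\<Sum>j\<in>UNIV. h (v i (Suc s) j) * t j Q))" by (rule ext)
    then show ?case using 1 by (simp only:)
  qed
  have "\<exists>p. p \<noteq> 0 \<and> (\<forall>k. coeff p k \<in> range h) \<and> degree p \<le> n \<and> act \<phi> p (t i) \<in> mp 2" for i
  proof -
    obtain g where g: "bij_betw g {0..<n} (UNIV :: 'i set)"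
      unfolding n_def using ex_bij_betw_nat_finite[of "UNIV :: 'i set"] by auto
    \<comment> \<open>The rows for \<open>s = 0, ..., n\<close> are \<open>n + 1\<close> vectors
      with \<open>n\<close> entries, so they are dependent already over the number field.\<close>
    obtain \<kappa> where \<kappa>: "\<exists>k\<in>{..n}. \<kappa> k \<noteq> 0" "\<And>j. j < n \<Longrightarrow> (\<Sum>s\<le>n. \<kappa> s * v i s (g j)) = 0"
      using linear_dependence[of "{..n}" n "\<lambda>j s. v i s (g j)"] by auto
    have \<kappa>': "(\<Sum>s\<le>n. \<kappa> s * v i s j) = 0" for j
    proof -
      have "j \<in> g ` {0..<n}" using g by (simp add: bij_betw_def)
      then show ?thesis using \<kappa>(2) by auto
    qed
    define p where "p = (\<Sum>s\<le>n. monom (h (\<kappa> s)) s)"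
    have cp: "coeff p k = (if k \<le> n then h (\<kappa> k) else 0)" for k
      by (simp add: p_def coeff_sum)
    have deg: "degree p \<le> n" by (rule degree_le) (simp add: cp)
    have "p \<noteq> 0"
    proof
      assume "p = 0"
      then have "\<kappa> k = 0" if "k \<le> n" for k using cp[of k] that by (simp add: hinj)
      then show False using \<kappa>(1) by auto
    qed
    moreover have "coeff p k \<in> range h" for k using h0 by (auto simp: cp intro: rev_image_eqI[of 0])
    moreover have "act \<phi> p (t i) \<in> mp 2"
    proof -
      have "(\<Sum>s\<le>n. (\<lambda>Q. h (\<kappa> s) * (t i ((\<phi> ^^ s) Q) - (\<Sum>j\<in>UNIV. h (v i s j) * t j Q)))) \<in> mp 2"
        by (intro mp_sum mp_cscale tv)
      moreover have "(\<Sum>s\<le>n. (\<lambda>Q. h (\<kappa> s) * (t i ((\<phi> ^^ s) Q) - (\<Sum>j\<in>UNIV. h (v i s j) * t j Q)))) = act \<phi> p (t i)"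
      proof
        fix Q
        have "(\<Sum>s\<le>n. h (\<kappa> s) * (\<Sum>j\<in>UNIV. h (v i s j) * t j Q)) = (\<Sum>j\<in>UNIV. h (\<Sum>s\<le>n. \<kappa> s * v i s j) * t j Q)"
          unfolding hs h sum_distrib_left sum_distrib_right
          by (subst sum.swap) (simp add: mult.assoc)
        also have "\<dots> = 0" by (simp add: \<kappa>' h0)
        finally show "(\<Sum>s\<le>n. (\<lambda>Q. h (\<kappa> s) * (t i ((\<phi> ^^ s) Q) - (\<Sum>j\<in>UNIV. h (v i s j) * t j Q)))) Q = act \<phi> p (t i) Q"
          by (simp add: sum_fun_apply right_diff_distrib sum_subtractf act_bound[OF deg] cp)
      qed
      ultimately show ?thesis by simp
    qed
    ultimately show ?thesis using deg by blast
  qed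
  then obtain p where p: "\<And>i. p i \<noteq> 0" "\<And>i k. coeff (p i) k \<in> range h" "\<And>i. degree (p i) \<le> n"
    "\<And>i. act \<phi> (p i) (t i) \<in> mp 2" by metis
  define \<Lambda> where "\<Lambda> = (\<Union>i. {z. poly (p i) z = 0}) - {0}"
  have fin: "finite (\<Union>i. {z. poly (p i) z = 0})" using p(1) poly_roots_finite by auto
  have "card \<Lambda> \<le> card (\<Union>i. {z. poly (p i) z = 0})" unfolding \<Lambda>_def by (intro card_mono fin) auto
  also have "\<dots> \<le> (\<Sum>i\<in>UNIV. card {z. poly (p i) z = 0})" by (rule card_UN_le) simp
  also have "\<dots> \<le> (\<Sum>i\<in>(UNIV :: 'i set). n)"
    using card_poly_roots_bound[OF p(1)] p(3) by (intro sum_mono) (meson order_trans)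
  finally have card: "card \<Lambda> \<le> n * n" by (simp add: n_def)
  define \<chi> where "\<chi> = (\<Prod>i\<in>UNIV. p i)"
  have \<chi>0: "\<chi> \<noteq> 0" by (simp add: \<chi>_def p(1))
  have kill: "act \<phi> \<chi> f \<in> mp 2" if f: "f \<in> maxid" for f
  proof -
    obtain d F G where F: "F \<in> hform UNIV d" "G \<in> hform UNIV d" "G (rep e) \<noteq> 0"
      "\<And>Q. Q \<in> V \<Longrightarrow> G (rep Q) \<noteq> 0 \<Longrightarrow> f Q = F (rep Q) / G (rep Q)"
      using f unfolding maxid_def by (auto elim!: local_ringE)
    obtain \<alpha> where \<alpha>: "(\<lambda>Q. F (rep Q) / G (rep Q) - F (rep e) / G (rep e) - (\<Sum>i\<in>UNIV. \<alpha> i * t i Q)) \<in> mp 2"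
      using cotangent_linearization[OF l(1) subring_UNIV _ _ F(1-3)] unfolding t_def by auto
    have fe: "F (rep e) / G (rep e) = 0" using F(4)[OF eV F(3)] f by (simp add: maxid_def)
    have "(\<lambda>Q. f Q - F (rep Q) / G (rep Q)) \<in> mp 2"
      by (rule germ_zero_mp[OF F(2,3)]) (use F(3,4) eV in auto)
    from mp_add[OF this \<alpha>] have r: "(\<lambda>Q. f Q - (\<Sum>i\<in>UNIV. \<alpha> i * t i Q)) \<in> mp 2"
      unfolding fe by (simp add: plus_fun_def)
    have ti: "act \<phi> \<chi> (t i) \<in> mp 2" for i
    proof -
      have "\<chi> = (\<Prod>j\<in>UNIV - {i}. p j) * p i" unfolding \<chi>_def by (subst prod.remove[of _ i]) (auto simp: mult.commute)
      then show ?thesis using op_stable_act[OF mp_stable p(4)] by (simp add: act_mult)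
    qed
    have s: "act \<phi> \<chi> (\<lambda>Q. \<Sum>i\<in>I. \<alpha> i * t i Q) \<in> mp 2" for I
    proof (induction I rule: infinite_finite_induct)
      case (insert i I)
      have "(\<lambda>Q. \<Sum>i\<in>insert i I. \<alpha> i * t i Q) = (\<lambda>Q. \<alpha> i * t i Q) + (\<lambda>Q. \<Sum>i\<in>I. \<alpha> i * t i Q)"
        using insert.hyps by (simp add: fun_eq_iff)
      then show ?case
        using insert.IH mp_cscale[OF ti, of "\<alpha> i" i] by (simp only: act_fun_add act_fun_scale mp_add)
    qed (use op_stable_act[OF mp_stable mp_zero] in \<open>simp_all add: zero_fun_def\<close>)
    have "act \<phi> \<chi> ((\<lambda>Q. f Q - (\<Sum>i\<in>UNIV. \<alpha> i * t i Q)) + (\<lambda>Q. \<Sum>i\<in>UNIV. \<alpha> i * t i Q)) \<in> mp 2"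
      unfolding act_fun_add by (rule mp_add[OF op_stable_act[OF mp_stable r] s])
    then show ?thesis by (simp add: plus_fun_def)
  qed
  \<comment> \<open>The root 0 is split off as \<open>X^s\<close>. By surjectivity every
    \<open>f\<close> equals some \<open>g o \<phi>^s\<close> modulo \<open>mp 2\<close>, so \<psi>
    applied to \<open>f\<close> agrees there with \<chi> applied to \<open>g\<close> and is
    0.\<close>
  obtain \<psi> where \<psi>: "\<chi> = [:- 0, 1:] ^ order 0 \<chi> * \<psi>" "\<not> [:- 0, 1:] dvd \<psi>"
    using order_decomp[OF \<chi>0] by blast
  define s where "s = order 0 \<chi>"
  have \<chi>\<psi>: "\<chi> = \<psi> * monom 1 s" using \<psi>(1) by (simp add: s_def monom_altdef mult.commute)
  have \<psi>0: "\<psi> \<noteq> 0" using \<chi>0 \<chi>\<psi> by auto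
  have kill\<psi>: "act \<phi> \<psi> f \<in> mp 2" if f: "f \<in> maxid" for f
  proof -
    obtain g where g: "g \<in> maxid" "(\<lambda>Q. f Q - g ((\<phi> ^^ s) Q)) \<in> mp 2"
      using cotangent_surjective_iterate[OF f] by blast
    have "act \<phi> \<psi> (\<lambda>Q. g ((\<phi> ^^ s) Q)) = act \<phi> \<chi> g"
      unfolding \<chi>\<psi> act_mult act_monom ..
    then have 1: "act \<phi> \<psi> (\<lambda>Q. g ((\<phi> ^^ s) Q)) \<in> mp 2" using kill[OF g(1)] by simp
    have "act \<phi> \<psi> ((\<lambda>Q. f Q - g ((\<phi> ^^ s) Q)) + (\<lambda>Q. g ((\<phi> ^^ s) Q))) \<in> mp 2"
      unfolding act_fun_add by (rule mp_add[OF op_stable_act[OF mp_stable g(2)] 1])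
    then show ?thesis by (simp add: plus_fun_def)
  qed
  obtain A where A: "\<psi> = smult (lead_coeff \<psi>) (\<Prod>x\<in>#A. [:- x, 1:])"
    using alg_closed_imp_factorization[OF \<psi>0] by blast
  obtain zs where zs: "mset zs = A" using ex_mset by blast
  have \<psi>zs: "\<psi> = smult (lead_coeff \<psi>) (root_poly zs)"
    using A unfolding root_poly_def zs[symmetric] by (simp flip: prod_mset_prod_list)
  have "set zs \<subseteq> \<Lambda>"
  proof
    fix z assume z: "z \<in> set zs"
    then have "poly (root_poly zs) z = 0" by (induction zs) auto
    then have "poly \<psi> z = 0" by (subst \<psi>zs) simp
    then have "z \<noteq> 0" "poly \<chi> z = 0" using \<psi>(2) by (auto simp: \<chi>\<psi> poly_eq_0_iff_dvd)
    then show "z \<in> \<Lambda>" by (auto simp: \<chi>_def \<Lambda>_def poly_prod)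
  qed
  then have zsm: "set zs \<subseteq> mult_closure \<Lambda>"
    unfolding mult_closure_def by (auto intro!: exI[of _ "[_]"])
  have "op_killed \<phi> (mult_closure \<Lambda>) (mp 2) f" if f: "f \<in> maxid" for f
  proof -
    have "act \<phi> \<psi> f = (\<lambda>x. lead_coeff \<psi> * act \<phi> (root_poly zs) f x)"
      by (subst \<psi>zs) (rule act_smult)
    then have "(\<lambda>x. inverse (lead_coeff \<psi>) * (lead_coeff \<psi> * act \<phi> (root_poly zs) f x)) \<in> mp 2"
      using mp_cscale[OF kill\<psi>[OF f], of "inverse (lead_coeff \<psi>)"] by simp
    then have "act \<phi> (root_poly zs) f \<in> mp 2" using \<psi>0 by (simp flip: mult.assoc)
    then show ?thesis unfolding op_killed_def using zsm by blast
  qed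
  moreover have "\<exists>p. p \<noteq> 0 \<and> (\<forall>i. coeff p i \<in> range h) \<and> degree p \<le> n \<and> poly p z = 0" if "z \<in> \<Lambda>" for z
    using that p(1-3) unfolding \<Lambda>_def by blast
  moreover have "finite \<Lambda>" "0 \<notin> \<Lambda>" using fin by (auto simp: \<Lambda>_def)
  ultimately show ?thesis using card by blast
qed

text \<open>An equation \<open>H\<close> of \<open>A\<close> becomes a function near
  \<open>e\<close> through a denominator \<open>B\<close>. Its pullback under
  \<open>\<phi> ^^ n0\<close> agrees on \<open>A\<close> with members of every power of the maximal
  ideal, so by Krull it vanishes on \<open>A\<close> near \<open>e\<close>, and by irreducibility on
  all of \<open>A\<close>.\<close>

lemma periodic_invariant:
  assumes A: "closed_over UNIV A" "irreducible_set A" "A \<subseteq> V" "e \<in> A"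
    and n: "n \<ge> 1" "n0 \<ge> 1" "(\<phi> ^^ n) ` A = A"
    and \<Gamma>: "1 \<in> \<Gamma>" "0 \<notin> \<Gamma>" "\<And>a b. a \<in> \<Gamma> \<Longrightarrow> b \<in> \<Gamma> \<Longrightarrow> a * b \<in> \<Gamma>"
    and kill: "\<And>f. f \<in> maxid \<Longrightarrow> op_killed \<phi> \<Gamma> (mp 2) f"
    and sep: "\<And>a b r. a \<in> \<Gamma> \<Longrightarrow> b \<in> \<Gamma> \<Longrightarrow> r \<ge> 1 \<Longrightarrow> a ^ r = b ^ r \<Longrightarrow> a ^ n0 = b ^ n0"
  shows "(\<phi> ^^ n0) ` A = A"
proof -
  have pow: "((\<phi> ^^ n) ^^ k) ` A = A" for k
    by (induction k) (simp_all only: funpow.simps image_comp[symmetric] n(3) image_id id_apply image_ident)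
  \<comment> \<open>\<open>n0 * n\<close> is a period as well, and its iterate is a power of
    \<open>\<phi> ^^ n0\<close>.\<close>
  have n0n: "(\<phi> ^^ (n0 * n)) ` A = A" using pow[of n0] by (simp add: funpow_mult mult.commute)
  have \<phi>V: "\<phi> ` V \<subseteq> V" using \<phi>_surj by simp
  have itV: "(\<phi> ^^ k) Q \<in> V" if "Q \<in> V" for k Q
    using that \<phi>V by (induction k) auto
  have "(\<phi> ^^ n0) R \<in> A" if R: "R \<in> A" for R
  proof (rule ccontr)
    assume "(\<phi> ^^ n0) R \<notin> A"
    from closed_overD[OF A(1) this] obtain d H where H: "H \<in> hform UNIV d" "\<And>Q. Q \<in> A \<Longrightarrow> H (rep Q) = 0"
      "H (rep ((\<phi> ^^ n0) R)) \<noteq> 0" by blast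
    have quot: "\<exists>B\<in>hform UNIV d. B (rep P) \<noteq> 0" for P :: "('i, 'a) proj"
    proof -
      obtain m where "rep P m \<noteq> 0" using rep_nonzero[of P] by blast
      moreover have "(\<lambda>x. x m ^ d) \<in> hform UNIV (1 * d)" by (intro hform_power hform_coord subring_UNIV)
      ultimately show ?thesis by (intro bexI[of _ "\<lambda>x. x m ^ d"]) auto
    qed
    obtain B where B: "B \<in> hform UNIV d" "B (rep e) \<noteq> 0" using quot by blast
    define f where "f Q = H (rep Q) / B (rep Q)" for Q
    have f: "f \<in> local_ring V e" unfolding f_def by (rule local_ring_quotient[OF H(1) B])
    have "\<exists>g\<in>mp k. \<forall>Q\<in>A. f ((\<phi> ^^ n0) Q) = g Q" for k
    proof (rule periodic_vanishing[OF \<Gamma> kill n(1,2) _ _ f])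
      show "s ^ n0 = t ^ n0" if "s \<in> \<Gamma>" "t \<in> \<Gamma>" "s ^ (n0 * n) = t ^ (n0 * n)" for s t
        using sep[OF that(1,2) _ that(3)] n by simp
      show "f Q = 0" if "Q \<in> A" for Q using H(2)[OF that] by (simp add: f_def)
    qed (use n0n in auto)
    from local_krull[OF A(4,3) this] obtain d' G where G: "G \<in> hform UNIV d'" "G (rep e) \<noteq> 0"
      "\<And>Q. Q \<in> A \<Longrightarrow> G (rep Q) \<noteq> 0 \<Longrightarrow> f ((\<phi> ^^ n0) Q) = 0" by blast
    have \<phi>r: "\<And>P. P \<in> V \<Longrightarrow> regular_map_at UNIV V P \<phi>" by (rule \<phi>_regular)
    have e0: "(\<phi> ^^ n0) e = e" by (induction n0) (auto simp: \<phi>_e)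
    have "(\<lambda>Q. B (rep Q) / B (rep Q)) \<in> local_ring V ((\<phi> ^^ n0) e)"
      unfolding e0 by (rule local_ring_quotient[OF B(1) B])
    from regular_iterate[OF \<phi>r \<phi>V eV this]
    have "(\<lambda>Q. B (rep ((\<phi> ^^ n0) Q)) / B (rep ((\<phi> ^^ n0) Q))) \<in> local_ring V e" by simp
    from nonvanishing_form[OF this eV] e0 B(2) obtain d'' G' where G': "G' \<in> hform UNIV d''" "G' (rep e) \<noteq> 0"
      "\<And>Q. Q \<in> V \<Longrightarrow> G' (rep Q) \<noteq> 0 \<Longrightarrow> B (rep ((\<phi> ^^ n0) Q)) / B (rep ((\<phi> ^^ n0) Q)) \<noteq> 0" by auto
    \<comment> \<open>\<open>f\<close> need not be regular at the image of \<open>R\<close>, so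
      another denominator is chosen there before the identity theorem is applied at
      \<open>R\<close>.\<close>
    obtain B' where B': "B' \<in> hform UNIV d" "B' (rep ((\<phi> ^^ n0) R)) \<noteq> 0" using quot by blast
    have RV: "R \<in> V" using R A(3) by blast
    have "(\<lambda>Q. H (rep ((\<phi> ^^ n0) Q)) / B' (rep ((\<phi> ^^ n0) Q))) \<in> local_ring V R"
      using regular_iterate[OF \<phi>r \<phi>V RV local_ring_quotient[OF H(1) B']] by simp
    then have hA: "(\<lambda>Q. H (rep ((\<phi> ^^ n0) Q)) / B' (rep ((\<phi> ^^ n0) Q))) \<in> local_ring A R"
      by (rule local_ring_subset[OF A(3)])
    have GG: "(\<lambda>x. G x * G' x) \<in> hform UNIV (d' + d'')" by (intro hform_mult subring_UNIV G G')
    have "H (rep ((\<phi> ^^ n0) R)) / B' (rep ((\<phi> ^^ n0) R)) = 0"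
    proof (rule regular_identity[OF A(2) hA R GG A(4)])
      show "G (rep e) * G' (rep e) \<noteq> 0" using G G' by simp
      fix Q assume Q: "Q \<in> A" "G (rep Q) * G' (rep Q) \<noteq> 0"
      then have "f ((\<phi> ^^ n0) Q) = 0" using G(3) by auto
      moreover have "B (rep ((\<phi> ^^ n0) Q)) \<noteq> 0" using G'(3)[of Q] Q A(3) by auto
      ultimately have "H (rep ((\<phi> ^^ n0) Q)) = 0" by (simp add: f_def)
      then show "H (rep ((\<phi> ^^ n0) Q)) / B' (rep ((\<phi> ^^ n0) Q)) = 0" by simp
    qed
    then show False using H(3) B'(2) by simp
  qed
  then have sub: "(\<phi> ^^ n0) ` A \<subseteq> A" by blast
  \<comment> \<open>\<open>\<phi> ^^ n0\<close> maps \<open>A\<close> into itself and its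
    \<open>n\<close>-th iterate maps \<open>A\<close> onto itself; hence already the map itself is
    onto.\<close>
  have "A \<subseteq> (\<phi> ^^ n0) ` A"
  proof -
    have "((\<phi> ^^ n0) ^^ k) ` A \<subseteq> A" for k
    proof (induction k)
      case (Suc k)
      then have "(\<phi> ^^ n0) ` (((\<phi> ^^ n0) ^^ k) ` A) \<subseteq> A" using sub by blast
      then show ?case by (simp only: funpow.simps image_comp)
    qed simp
    moreover have "A = ((\<phi> ^^ n0) ^^ n) ` A" using n0n by (simp add: funpow_mult mult.commute)
    moreover have "((\<phi> ^^ n0) ^^ Suc k) ` A = (\<phi> ^^ n0) ` (((\<phi> ^^ n0) ^^ k) ` A)" for k
      by (simp add: image_comp)
    moreover obtain k where "n = Suc k" using n(1) by (cases n) auto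
    ultimately show ?thesis by (metis image_mono)
  qed
  then show ?thesis using sub by blast
qed

end

section \<open>Application to isogenies of abelian varieties\<close>

section \<open>Endomorphisms of abelian varieties\<close>

text \<open>In a local formula for \<mu> the Segre coordinates are specialized by fixing those of
  \<open>P\<close>. These may lie outside \<open>C\<close>, so the coefficients are taken in the
  whole field.\<close>

lemma translation_regular:
  assumes \<mu>: "morphism_over C (product_variety V V) V \<mu>" and PQ: "P \<in> V" "Q \<in> V"
    and m: "\<And>R. R \<in> V \<Longrightarrow> \<mu> (segre P R) = m R"
  shows "regular_map_at UNIV V Q m"
proof -
  have seg: "segre P R = point (\<lambda>(i, j). rep P i * rep R j)" for R
  proof -
    have "segre (abs_proj (rep P)) (abs_proj (rep R)) = abs_proj (\<lambda>(i, j). rep P i * rep R j)"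
      using rep_nonzero[of P] rep_nonzero[of R]
      by (intro segre.abs_eq) (auto intro!: exI[of _ 1])
    then show ?thesis using point_rep[of P] point_rep[of R] unfolding point_def by simp
  qed
  have nz: "\<exists>p. (case p of (i, j) \<Rightarrow> rep P i * rep R j) \<noteq> 0" for R
    using rep_nonzero[of P] rep_nonzero[of R] by auto
  have coords: "(\<lambda>(i, j). rep P i * rep R j) \<in> coords (segre P R)" for R
    unfolding coords_def seg using nz[of R] by simp
  have mem: "segre P R \<in> product_variety V V" if "R \<in> V" for R
    unfolding product_variety_def using PQ(1) that by blast
  obtain d F where F: "\<And>j. F j \<in> forms C d" "\<exists>j. \<not> vanishes_at (F j) (segre P Q)"
    "\<forall>S\<in>product_variety V V. \<forall>x\<in>coords S. (\<exists>j. eval_mpoly (F j) x \<noteq> 0) \<longrightarrow>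
       \<mu> S = point (\<lambda>j. eval_mpoly (F j) x)"
    using \<mu> mem[OF PQ(2)] unfolding morphism_over_def by blast
  let ?E = "\<lambda>j x. eval_mpoly (F j) (\<lambda>p. rep P (fst p) * x (snd p))"
  have cp: "(\<lambda>p. rep P (fst p) * rep R (snd p)) = (\<lambda>(i, j). rep P i * rep R j)" for R
    by (simp add: fun_eq_iff)
  have FU: "eval_mpoly (F j) \<in> hform UNIV d" for j
    using F(1)[of j] hform_mono[of C UNIV "eval_mpoly (F j)" d] by (auto simp: hform_def)
  show ?thesis
    unfolding regular_map_at_def
  proof (intro exI conjI allI ballI impI)
    show "?E j \<in> hform UNIV (1 * d)" for j
    proof (rule hform_comp[OF subring_UNIV FU])
      show "(\<lambda>x. rep P (fst p) * x (snd p)) \<in> hform UNIV 1" for p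
        by (intro hform_scale hform_coord subring_UNIV UNIV_I)
    qed
    obtain j where "\<not> vanishes_at (F j) (segre P Q)" using F(2) by blast
    then have "eval_mpoly (F j) (\<lambda>(i, j). rep P i * rep Q j) \<noteq> 0"
      using hform_coords_zero_iff[OF FU coords] vanishes_at_iff[OF F(1)] by blast
    then show "?E (SOME j. ?E j (rep Q) \<noteq> 0) (rep Q) \<noteq> 0"
      unfolding cp by (rule someI)
    fix R assume R: "R \<in> V" "\<exists>j. ?E j (rep R) \<noteq> 0"
    then have "\<mu> (segre P R) = point (\<lambda>j. ?E j (rep R))"
      using F(3) mem[OF R(1)] coords[of R] unfolding cp by blast
    then show "m R = point (\<lambda>j. ?E j (rep R))" using m[OF R(1)] by simp
  qed
qed

lemma isogeny_homogeneous_endo: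
  fixes \<X> :: "('i::finite, 'a::{alg_closed_field,field_char_0}) proj monoid"
  assumes X: "abelian_variety C \<X>" and \<phi>: "isogeny C \<X> \<X> \<phi>"
  shows "homogeneous_endo (carrier \<X>) \<phi> \<one>\<^bsub>\<X>\<^esub> (\<lambda>P Q. P \<otimes>\<^bsub>\<X>\<^esub> Q)"
proof -
  interpret group \<X> using X by (simp add: abelian_variety_def)
  obtain \<mu> where \<mu>: "morphism_over C (product_variety (carrier \<X>) (carrier \<X>)) (carrier \<X>) \<mu>"
    "\<And>P Q. P \<in> carrier \<X> \<Longrightarrow> Q \<in> carrier \<X> \<Longrightarrow> \<mu> (segre P Q) = P \<otimes>\<^bsub>\<X>\<^esub> Q"
    using X unfolding abelian_variety_def by blast
  have hom: "\<phi> \<in> hom \<X> \<X>" and surj: "\<phi> ` carrier \<X> = carrier \<X>"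
    and mor: "morphism_over C (carrier \<X>) (carrier \<X>) \<phi>"
    using \<phi> by (auto simp: isogeny_def)
  show ?thesis
  proof
    show "irreducible_set (carrier \<X>)" using X by (simp add: abelian_variety_def projective_variety_def)
    show "regular_map_at UNIV (carrier \<X>) P \<phi>" if "P \<in> carrier \<X>" for P
    proof -
      have "regular_map_at C (carrier \<X>) P \<phi>" by (rule morphism_over_regular[OF mor that])
      then show ?thesis
        unfolding regular_map_at_def using hform_mono[of C UNIV] by (metis subset_UNIV)
    qed
    show "regular_map_at UNIV (carrier \<X>) Q (\<lambda>R. P \<otimes>\<^bsub>\<X>\<^esub> R)" if "P \<in> carrier \<X>" "Q \<in> carrier \<X>" for P Q
      using translation_regular[OF \<mu>(1) that, of "\<lambda>R. P \<otimes>\<^bsub>\<X>\<^esub> R"] \<mu>(2)[OF that(1)] by blast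
    show "\<exists>P'\<in>carrier \<X>. \<forall>Q\<in>carrier \<X>. P' \<otimes>\<^bsub>\<X>\<^esub> (P \<otimes>\<^bsub>\<X>\<^esub> Q) = Q" if "P \<in> carrier \<X>" for P
      using that by (intro bexI[of _ "inv\<^bsub>\<X>\<^esub> P"]) (auto simp flip: m_assoc)
  qed (use hom surj hom_one[OF hom] is_group in \<open>auto simp: hom_mult\<close>)
qed

theorem lemma6p2:
  fixes \<X> :: "('i::finite, 'k::field_char_0 alg_closure) proj monoid"
    and K :: "'k alg_closure set"
  defines "K \<equiv> range to_ac"
  assumes "number_field TYPE('k)"
    and "abelian_variety K \<X>"
  shows "\<exists>n\<^sub>0\<ge>1. \<forall>\<phi> A. isogeny K \<X> \<X> \<phi> \<and> abelian_subvariety K A \<X> \<and> periodic_subset \<phi> A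
           \<longrightarrow> (\<phi> ^^ n\<^sub>0) ` A = A"
proof -
  let ?n = "card (UNIV :: 'i set)"
  let ?h = "to_ac :: 'k \<Rightarrow> 'k alg_closure"
  have h: "?h 1 = 1" "\<And>x y. ?h (x + y) = ?h x + ?h y" "\<And>x y. ?h (x * y) = ?h x * ?h y" by simp_all
  \<comment> \<open>The exponent is fixed before \<phi> and \<open>A\<close> appear; besides the
    number field it depends only on the number \<open>?n\<close> of homogeneous coordinates.\<close>
  obtain n0 where n0: "n0 \<ge> 1" "\<forall>\<Lambda>::'k alg_closure set. finite \<Lambda> \<and> card \<Lambda> \<le> ?n * ?n \<and> 0 \<notin> \<Lambda> \<and>
      (\<forall>z\<in>\<Lambda>. \<exists>p. p \<noteq> 0 \<and> (\<forall>i. coeff p i \<in> range ?h) \<and> degree p \<le> ?n \<and> poly p z = 0) \<longrightarrow>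
      (\<forall>a\<in>mult_closure \<Lambda>. \<forall>b\<in>mult_closure \<Lambda>. \<forall>r\<ge>1. a ^ r = b ^ r \<longrightarrow> a ^ n0 = b ^ n0)"
    using uniform_exponent[of ?h "?n * ?n" ?n, OF assms(2) h] by (elim exE conjE)
  have "(\<phi> ^^ n0) ` A = A"
    if \<phi>: "isogeny K \<X> \<X> \<phi>" and A: "abelian_subvariety K A \<X>" and per: "periodic_subset \<phi> A" for \<phi> A
  proof -
    interpret homogeneous_endo "carrier \<X>" \<phi> "\<one>\<^bsub>\<X>\<^esub>" "\<lambda>P Q. P \<otimes>\<^bsub>\<X>\<^esub> Q"
      by (rule isogeny_homogeneous_endo[OF assms(3) \<phi>])
    let ?e = "\<one>\<^bsub>\<X>\<^esub>"
    have A': "closed_over K A" "irreducible_set A" "subgroup A \<X>"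
      using A by (auto simp: abelian_subvariety_def abelian_variety_def projective_variety_def)
    have AU: "closed_over UNIV A"
    proof -
      have "(\<Union>d. forms K d) \<subseteq> (\<Union>d. forms UNIV d)" by (auto simp: forms_def)
      moreover obtain S where "S \<subseteq> (\<Union>d. forms K d)" "A = {P. \<forall>F\<in>S. vanishes_at F P}"
        using A'(1) unfolding closed_over_def by blast
      ultimately show ?thesis unfolding closed_over_def by (intro exI[of _ S]) (rule conjI, rule order_trans)
    qed
    obtain x where x: "x \<in> coords ?e" "range x \<subseteq> K"
      using assms(3) by (auto simp: abelian_variety_def rational_point_def)
    obtain c where c: "c \<noteq> 0" "x = (\<lambda>i. c * rep ?e i)" using coords_scale[OF x(1)] by blast
    obtain l where l: "rep ?e l \<noteq> 0" using rep_nonzero[of ?e] by blast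
    \<comment> \<open>The chosen representative of the identity may have coordinates outside
      \<open>K\<close>, but its ratios agree with those of the rational vector
      \<open>x\<close>.\<close>
    have "rep ?e i / rep ?e l \<in> range ?h" for i
    proof -
      have eq: "rep ?e i / rep ?e l = x i * inverse (x l)" using c by (simp add: field_simps)
      have "x i \<in> range ?h" "x l \<in> range ?h" using x(2) by (auto simp: K_def)
      then show ?thesis
        unfolding eq by (intro subring_mult[OF range_hom_subring[OF h]] range_hom_inverse[OF h])
    qed
    moreover have "regular_map_at (range ?h) (carrier \<X>) ?e \<phi>"
      using \<phi> morphism_over_regular[OF _ eV] unfolding isogeny_def K_def by blast
    ultimately obtain \<Lambda> where \<Lambda>: "finite \<Lambda>" "card \<Lambda> \<le> ?n * ?n" "0 \<notin> \<Lambda>"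
      "\<forall>z\<in>\<Lambda>. \<exists>p. p \<noteq> 0 \<and> (\<forall>i. coeff p i \<in> range ?h) \<and> degree p \<le> ?n \<and> poly p z = 0"
      "\<And>f. f \<in> maxid \<Longrightarrow> op_killed \<phi> (mult_closure \<Lambda>) (mp 2) f"
      using cotangent_eigenvalues[OF h _ l] by blast
    obtain n where n: "n \<ge> 1" "(\<phi> ^^ n) ` A = A" using per by (auto simp: periodic_subset_def)
    show ?thesis
    proof (rule periodic_invariant[OF AU A'(2) _ _ n(1) n0(1) n(2) _ _ _ \<Lambda>(5)])
      show "A \<subseteq> carrier \<X>" "?e \<in> A"
        using A'(3) subgroup.subset subgroup.one_closed by blast+
      show "1 \<in> mult_closure \<Lambda>" unfolding mult_closure_def by (auto intro!: exI[of _ "[]"])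
      show "0 \<notin> mult_closure \<Lambda>"
        using \<Lambda>(3) by (auto simp: mult_closure_def prod_list_zero_iff)
      show "a * b \<in> mult_closure \<Lambda>" if ab: "a \<in> mult_closure \<Lambda>" "b \<in> mult_closure \<Lambda>" for a b
      proof -
        obtain as bs where "set as \<subseteq> \<Lambda>" "a = prod_list as" "set bs \<subseteq> \<Lambda>" "b = prod_list bs"
          using ab by (auto simp: mult_closure_def)
        then show ?thesis unfolding mult_closure_def by (intro CollectI exI[of _ "as @ bs"]) auto
      qed
      show "a ^ n0 = b ^ n0"
        if "a \<in> mult_closure \<Lambda>" "b \<in> mult_closure \<Lambda>" "r \<ge> 1" "a ^ r = b ^ r" for a b r
        using n0(2) \<Lambda>(1-4) that by blast
    qed
  qed
  then show ?thesis using n0(1) by blast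
qed

end
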